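(* Let $(M,F)$ be a Finsler manifold, $x_0,x_1\in M$, $p\in\mathbb{R}\setminus\{0\}$, and let $c\in\Omega$ be a geodesic with constant speed $\|\dot c\|=v$. Let $(c_{s_1s_2})_{s_1,s_2\in(-\epsilon,\epsilon)}\subset\Omega$ be a two-parameter variation of $c$ (with $c_{00}=c$), and put $X(t)=\frac{\partial c_{s_1s_2}}{\partial s_1}(0,0,t)\in T_c\Omega$, $Y(t)=\frac{\partial c_{s_1s_2}}{\partial s_2}(0,0,t)\in T_c\Omega$ and $I_p(X,Y)=\frac{\partial^2E_p(c_{s_1s_2})}{\partial s_1\partial s_2}(0,0)$. Then $$\frac{1}{p\,v^{p-4}}I_p(X,Y)=-\sum_t g\Big(Y,\ v^2\Delta_t\Big(\frac{\nabla X}{dt}\Big)+(p-2)\,g\Big(\Delta_t\Big(\frac{\nabla X}{dt}\Big),\dot c\Big)\dot c\Big)$$ $$-\int_0^1 g\Big(Y,\ v^2\Big[\frac{\nabla}{dt}\frac{\nabla X}{dt}+R^2(X,\dot c)\dot c\Big]+(p-2)\,g\Big(\Big[\frac{\nabla}{dt}\frac{\nabla X}{dt}+R^2(X,\dot c)\dot c\Big],\dot c\Big)\dot c\Big)\,dt,$$ where $\Delta_t\big(\frac{\nabla X}{dt}\big)=\big(\frac{\nabla X}{dt}\big)_{t^+}-\big(\frac{\nabla X}{dt}\big)_{t^-}$ is the jump of $\frac{\nabla X}{dt}$ at the discontinuity point $t\in(0,1)$, and the sum runs over the discontinuity points.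
   Context: $(M,F)$ is a connected $n$-dimensional Finsler manifold: $F:TM\to\mathbb{R}$ satisfies $F(x,y)>0$ for $y\neq0$; $F(x,\lambda y)=|\lambda|F(x,y)$ for all $\lambda\in\mathbb{R}$; $g_{ij}(x,y)=\frac12\frac{\partial^2F^2}{\partial y^i\partial y^j}$ is positive definite (for $y\ne0$); $F$ is $C^\infty$ at every $(x,y)$ with $y\neq0$ and continuous at every $(x,0)$. Along a regular curve $c$, put $g(X,Y)=g_{ij}(c,\dot c)X^iY^j$ and $\|X\|=\sqrt{g(X,X)}$ for vector fields $X,Y$ along $c$. Cartan connection: let $\gamma^i_{jk}=\frac12g^{im}\left(\frac{\partial g_{mk}}{\partial x^j}+\frac{\partial g_{jm}}{\partial x^k}-\frac{\partial g_{jk}}{\partial x^m}\right)$, $N^i_j=\frac12\frac{\partial}{\partial y^j}(\gamma^i_{kl}y^ky^l)$, $\frac{\delta}{\delta x^i}=\frac{\partial}{\partial x^i}-N^j_i\frac{\partial}{\partial y^j}$, $L^i_{jk}=\frac12g^{im}\left(\frac{\delta g_{mk}}{\delta x^j}+\frac{\delta g_{jm}}{\delta x^k}-\frac{\delta g_{jk}}{\delta x^m}\right)$, $C^i_{jk}=\frac12g^{im}\frac{\partial g_{mj}}{\partial y^k}$. The covariant derivative along $c$ is $$\frac{\nabla X}{dt}=\Big\{\frac{dX^i}{dt}+X^m\Big[L^i_{mk}(c,\dot c)\dot c^k+C^i_{mk}(c,\dot c)\big(\ddot c^k+N^k_l(c,\dot c)\dot c^l\big)\Big]\Big\}\frac{\partial}{\partial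 x^i}.$$ A geodesic is a (smooth, regular) curve with $\frac{\nabla\dot c}{dt}=0$. Curvature: $R^i_{jk}=\frac{\delta N^i_j}{\delta x^k}-\frac{\delta N^i_k}{\delta x^j}$, $R^i_{hjk}=\frac{\delta L^i_{hj}}{\delta x^k}-\frac{\delta L^i_{hk}}{\delta x^j}+L^s_{hj}L^i_{sk}-L^s_{hk}L^i_{sj}+C^i_{hs}R^s_{jk}$ (the Finsler $h$-curvature), which satisfy $R^i_{jk}=R^i_{mjk}y^m$. Along $c$, $$R^2(X,\dot c)\dot c=R^l_{ijk}(c,\dot c)\dot c^i\dot c^jX^k\frac{\partial}{\partial x^l}=R^l_{jk}(c,\dot c)\dot c^jX^k\frac{\partial}{\partial x^l}.$$ $\Omega$ is the set of piecewise $C^\infty$ regular curves $c:[0,1]\to M$ with $c(0)=x_0$, $c(1)=x_1$ ($x_0,x_1$ not necessarily distinct). $T_c\Omega$ is the set of continuous, piecewise $C^\infty$ vector fields $X$ along $c$ with $X(0)=X(1)=0$. Variations are continuous in all variables and smooth on $(-\epsilon,\epsilon)^2\times[t_{k-1},t_k]$ for some subdivision $0=t_0<\dots<t_r=1$. The $p$-energy is $E_p(c)=\int_0^1\|\dot c\|^p\,dt$. *)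

theory Defs
  imports "HOL-Analysis.Analysis"
begin

section \<open>Smooth maps between Euclidean spaces\<close>

text \<open>Meant for open \<open>S\<close> in a finite-dimensional space, where it is the usual \<open>C\<^sup>k\<close>.\<close>

primrec Ck_on :: "nat \<Rightarrow> 'a::real_normed_vector set \<Rightarrow> ('a \<Rightarrow> 'b::real_normed_vector) \<Rightarrow> bool" where
  "Ck_on 0 S f = continuous_on S f"
| "Ck_on (Suc k) S f =
     ((\<forall>x\<in>S. f differentiable (at x)) \<and> (\<forall>v. Ck_on k S (\<lambda>x. frechet_derivative f (at x) v)))"

definition smooth_on :: "'a::real_normed_vector set \<Rightarrow> ('a \<Rightarrow> 'b::real_normed_vector) \<Rightarrow> bool" where
  "smooth_on S f \<longleftrightarrow> (\<forall>k. Ck_on k S f)"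


section \<open>Smooth manifolds\<close>

text \<open>A chart is a domain together with a coordinate map; the values of the coordinate map outside
  the domain are irrelevant.\<close>

type_synonym ('m, 'n) chart = "'m set \<times> ('m \<Rightarrow> real^'n)"

definition chart_inv :: "('m, 'n::finite) chart \<Rightarrow> real^'n \<Rightarrow> 'm" where
  "chart_inv \<phi> = the_inv_into (fst \<phi>) (snd \<phi>)"

definition transition :: "('m, 'n::finite) chart \<Rightarrow> ('m, 'n) chart \<Rightarrow> real^'n \<Rightarrow> real^'n" where
  "transition \<phi> \<psi> = snd \<psi> \<circ> chart_inv \<phi>"

definition is_chart :: "('m::topological_space, 'n::finite) chart \<Rightarrow> bool" where
  "is_chart \<phi> \<longleftrightarrow> open (fst \<phi>) \<and> open (snd \<phi> ` fst \<phi>) \<and>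
     homeomorphism (fst \<phi>) (snd \<phi> ` fst \<phi>) (snd \<phi>) (chart_inv \<phi>)"

definition charts_at :: "('m, 'n::finite) chart set \<Rightarrow> 'm \<Rightarrow> ('m, 'n) chart set" where
  "charts_at A q = {\<phi>\<in>A. q \<in> fst \<phi>}"

locale connected_smooth_manifold =
  fixes A :: "('m::{t2_space,second_countable_topology}, 'n::finite) chart set"
  assumes charts: "\<And>\<phi>. \<phi> \<in> A \<Longrightarrow> is_chart \<phi>"
    and covering: "\<And>q. charts_at A q \<noteq> {}"
    and compatible: "\<And>\<phi> \<psi>. \<phi> \<in> A \<Longrightarrow> \<psi> \<in> A \<Longrightarrow>
          smooth_on (snd \<phi> ` (fst \<phi> \<inter> fst \<psi>)) (transition \<phi> \<psi>)"
    and connected_space: "connected (UNIV :: 'm set)"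

text \<open>A tangent vector at \<open>q\<close> is the family of its component vectors in the charts about \<open>q\<close>,
  related by the differentials of the coordinate changes. The entries at all other charts are \<open>0\<close>,
  so that equality of families is equality of tangent vectors.\<close>

type_synonym ('m, 'n) tvec = "('m, 'n) chart \<Rightarrow> real^'n"

definition tangent_space :: "('m, 'n::finite) chart set \<Rightarrow> 'm \<Rightarrow> ('m, 'n) tvec set" where
  "tangent_space A q = {v. (\<forall>\<phi>. \<phi> \<notin> charts_at A q \<longrightarrow> v \<phi> = 0) \<and>
     (\<forall>\<phi>\<in>charts_at A q. \<forall>\<psi>\<in>charts_at A q.
        v \<psi> = frechet_derivative (transition \<phi> \<psi>) (at (snd \<phi> q)) (v \<phi>))}"

definition tvec_of :: "('m, 'n::finite) chart set \<Rightarrow> 'm \<Rightarrow> ('m, 'n) chart \<Rightarrow> real^'n \<Rightarrow> ('m, 'n) tvec" where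
  "tvec_of A q \<phi> y = (\<lambda>\<psi>. if \<psi> \<in> charts_at A q
     then frechet_derivative (transition \<phi> \<psi>) (at (snd \<phi> q)) y else 0)"

text \<open>Smoothness on an arbitrary subset of a Euclidean space means local extendability to a smooth
  map on an open set; this is what \<open>C\<^sup>\<infinity>\<close> means on closed intervals and their products.\<close>

definition smooth_into ::
  "('m, 'n::finite) chart set \<Rightarrow> 'a::euclidean_space set \<Rightarrow> ('a \<Rightarrow> 'm) \<Rightarrow> bool" where
  "smooth_into A S f \<longleftrightarrow> (\<forall>z\<in>S. \<forall>\<phi>\<in>charts_at A (f z). \<exists>W h. open W \<and> z \<in> W \<and> smooth_on W h \<and>
     (\<forall>w\<in>W \<inter> S. f w \<in> fst \<phi> \<and> snd \<phi> (f w) = h w))"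


section \<open>Local Finsler geometry\<close>

definition partial_x :: "'n::finite \<Rightarrow> (real^'n \<Rightarrow> real^'n \<Rightarrow> real) \<Rightarrow> real^'n \<Rightarrow> real^'n \<Rightarrow> real" where
  "partial_x i f x y = deriv (\<lambda>h. f (x + h *\<^sub>R axis i 1) y) 0"

definition partial_y :: "'n::finite \<Rightarrow> (real^'n \<Rightarrow> real^'n \<Rightarrow> real) \<Rightarrow> real^'n \<Rightarrow> real^'n \<Rightarrow> real" where
  "partial_y i f x y = deriv (\<lambda>h. f x (y + h *\<^sub>R axis i 1)) 0"

context
  fixes f :: "real^'n::finite \<Rightarrow> real^'n \<Rightarrow> real"
begin

definition fund_g :: "'n \<Rightarrow> 'n \<Rightarrow> real^'n \<Rightarrow> real^'n \<Rightarrow> real" where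
  "fund_g i j x y = (1/2) * partial_y i (partial_y j (\<lambda>x y. (f x y)\<^sup>2)) x y"

definition fund_ginv :: "'n \<Rightarrow> 'n \<Rightarrow> real^'n \<Rightarrow> real^'n \<Rightarrow> real" where
  "fund_ginv i j x y = matrix_inv (\<chi> k l. fund_g k l x y) $ i $ j"

definition christoffel :: "'n \<Rightarrow> 'n \<Rightarrow> 'n \<Rightarrow> real^'n \<Rightarrow> real^'n \<Rightarrow> real" where
  "christoffel i j k x y = (1/2) * (\<Sum>m\<in>UNIV. fund_ginv i m x y *
     (partial_x j (fund_g m k) x y + partial_x k (fund_g j m) x y - partial_x m (fund_g j k) x y))"

definition nonlin_N :: "'n \<Rightarrow> 'n \<Rightarrow> real^'n \<Rightarrow> real^'n \<Rightarrow> real" where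
  "nonlin_N i j x y = (1/2) *
     partial_y j (\<lambda>x y. \<Sum>k\<in>UNIV. \<Sum>l\<in>UNIV. christoffel i k l x y * y $ k * y $ l) x y"

definition delta_x :: "'n \<Rightarrow> (real^'n \<Rightarrow> real^'n \<Rightarrow> real) \<Rightarrow> real^'n \<Rightarrow> real^'n \<Rightarrow> real" where
  "delta_x i u x y = partial_x i u x y - (\<Sum>j\<in>UNIV. nonlin_N j i x y * partial_y j u x y)"

definition cartan_L :: "'n \<Rightarrow> 'n \<Rightarrow> 'n \<Rightarrow> real^'n \<Rightarrow> real^'n \<Rightarrow> real" where
  "cartan_L i j k x y = (1/2) * (\<Sum>m\<in>UNIV. fund_ginv i m x y *
     (delta_x j (fund_g m k) x y + delta_x k (fund_g j m) x y - delta_x m (fund_g j k) x y))"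

definition cartan_C :: "'n \<Rightarrow> 'n \<Rightarrow> 'n \<Rightarrow> real^'n \<Rightarrow> real^'n \<Rightarrow> real" where
  "cartan_C i j k x y = (1/2) * (\<Sum>m\<in>UNIV. fund_ginv i m x y * partial_y k (fund_g m j) x y)"

definition curv_N :: "'n \<Rightarrow> 'n \<Rightarrow> 'n \<Rightarrow> real^'n \<Rightarrow> real^'n \<Rightarrow> real" where
  "curv_N i j k x y = delta_x k (nonlin_N i j) x y - delta_x j (nonlin_N i k) x y"

text \<open>\<open>curv_h i h j k\<close> is \<open>R\<^sup>i\<^bsub>hjk\<^esub>\<close>: the first argument is the upper index.\<close>

definition curv_h :: "'n \<Rightarrow> 'n \<Rightarrow> 'n \<Rightarrow> 'n \<Rightarrow> real^'n \<Rightarrow> real^'n \<Rightarrow> real" where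
  "curv_h i h j k x y = delta_x k (cartan_L i h j) x y - delta_x j (cartan_L i h k) x y
     + (\<Sum>s\<in>UNIV. cartan_L s h j x y * cartan_L i s k x y)
     - (\<Sum>s\<in>UNIV. cartan_L s h k x y * cartan_L i s j x y)
     + (\<Sum>s\<in>UNIV. cartan_C i h s x y * curv_N s j k x y)"

end


section \<open>Finsler manifolds\<close>

definition local_F ::
  "('m, 'n::finite) chart set \<Rightarrow> ('m \<Rightarrow> ('m, 'n) tvec \<Rightarrow> real) \<Rightarrow> ('m, 'n) chart
     \<Rightarrow> real^'n \<Rightarrow> real^'n \<Rightarrow> real" where
  "local_F A F \<phi> x y = F (chart_inv \<phi> x) (tvec_of A (chart_inv \<phi> x) \<phi> y)"

text \<open>Only the values of \<open>F\<close> on the tangent spaces matter.\<close>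

locale finsler_manifold = connected_smooth_manifold A
  for A :: "('m::{t2_space,second_countable_topology}, 'n::finite) chart set" +
  fixes F :: "'m \<Rightarrow> ('m, 'n) tvec \<Rightarrow> real"
  assumes F_pos: "\<And>q v. v \<in> tangent_space A q \<Longrightarrow> v \<noteq> (\<lambda>\<phi>. 0) \<Longrightarrow> F q v > 0"
    and F_homogeneous: "\<And>q v a. v \<in> tangent_space A q \<Longrightarrow> F q (\<lambda>\<phi>. a *\<^sub>R v \<phi>) = \<bar>a\<bar> * F q v"
    and F_smooth: "\<And>\<phi>. \<phi> \<in> A \<Longrightarrow>
          smooth_on ((snd \<phi> ` fst \<phi>) \<times> (UNIV - {0})) (\<lambda>(x, y). local_F A F \<phi> x y)"
    and F_continuous: "\<And>\<phi>. \<phi> \<in> A \<Longrightarrow>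
          continuous_on ((snd \<phi> ` fst \<phi>) \<times> UNIV) (\<lambda>(x, y). local_F A F \<phi> x y)"
    and g_pos_def: "\<And>\<phi> x y w. \<phi> \<in> A \<Longrightarrow> x \<in> snd \<phi> ` fst \<phi> \<Longrightarrow> y \<noteq> 0 \<Longrightarrow> w \<noteq> 0 \<Longrightarrow>
          (\<Sum>i\<in>UNIV. \<Sum>j\<in>UNIV. fund_g (local_F A F \<phi>) i j x y * w $ i * w $ j) > 0"


section \<open>Calculus along curves\<close>

text \<open>Curves and fields along them are total functions on the reals, of which only the restriction
  to \<open>[0, 1]\<close> matters. Hence time derivatives are taken within \<open>[0, 1]\<close> (or within a piece of it)
  and are one-sided at its ends. A field along a curve is given by its components in each chart.\<close>

definition velocity ::
  "('m, 'n::finite) chart set \<Rightarrow> real set \<Rightarrow> (real \<Rightarrow> 'm) \<Rightarrow> real \<Rightarrow> ('m, 'n) tvec" where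
  "velocity A S c t = (\<lambda>\<phi>. if \<phi> \<in> charts_at A (c t)
     then vector_derivative (\<lambda>\<tau>. snd \<phi> (c \<tau>)) (at t within S) else 0)"

definition subdivision :: "nat \<Rightarrow> (nat \<Rightarrow> real) \<Rightarrow> bool" where
  "subdivision r \<tau> \<longleftrightarrow> \<tau> 0 = 0 \<and> \<tau> r = 1 \<and> (\<forall>k<r. \<tau> k < \<tau> (Suc k))"

definition regular_on :: "('m, 'n::finite) chart set \<Rightarrow> real set \<Rightarrow> (real \<Rightarrow> 'm) \<Rightarrow> bool" where
  "regular_on A S c \<longleftrightarrow> smooth_into A S c \<and> (\<forall>t\<in>S. velocity A S c t \<noteq> (\<lambda>\<phi>. 0))"

definition path_space ::
  "('m::topological_space, 'n::finite) chart set \<Rightarrow> 'm \<Rightarrow> 'm \<Rightarrow> (real \<Rightarrow> 'm) set" where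
  "path_space A x\<^sub>0 x\<^sub>1 = {c. continuous_on {0..1} c \<and> c 0 = x\<^sub>0 \<and> c 1 = x\<^sub>1 \<and>
     (\<exists>r \<tau>. subdivision r \<tau> \<and> (\<forall>k<r. regular_on A {\<tau> k..\<tau> (Suc k)} c))}"

definition two_param_variation ::
  "('m::topological_space, 'n::finite) chart set \<Rightarrow> 'm \<Rightarrow> 'm \<Rightarrow> (real \<Rightarrow> 'm) \<Rightarrow> real
     \<Rightarrow> (real \<Rightarrow> real \<Rightarrow> real \<Rightarrow> 'm) \<Rightarrow> bool" where
  "two_param_variation A x\<^sub>0 x\<^sub>1 c \<epsilon> cs \<longleftrightarrow> \<epsilon> > 0 \<and>
     (\<forall>s\<^sub>1\<in>{-\<epsilon><..<\<epsilon>}. \<forall>s\<^sub>2\<in>{-\<epsilon><..<\<epsilon>}. cs s\<^sub>1 s\<^sub>2 \<in> path_space A x\<^sub>0 x\<^sub>1) \<and>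
     (\<forall>t\<in>{0..1}. cs 0 0 t = c t) \<and>
     continuous_on ({-\<epsilon><..<\<epsilon>} \<times> {-\<epsilon><..<\<epsilon>} \<times> {0..1}) (\<lambda>(s\<^sub>1, s\<^sub>2, t). cs s\<^sub>1 s\<^sub>2 t) \<and>
     (\<exists>r \<tau>. subdivision r \<tau> \<and> (\<forall>k<r.
        smooth_into A ({-\<epsilon><..<\<epsilon>} \<times> {-\<epsilon><..<\<epsilon>} \<times> {\<tau> k..\<tau> (Suc k)}) (\<lambda>(s\<^sub>1, s\<^sub>2, t). cs s\<^sub>1 s\<^sub>2 t)))"

definition variation_field ::
  "('m, 'n::finite) chart set \<Rightarrow> (real \<Rightarrow> real \<Rightarrow> 'm) \<Rightarrow> real \<Rightarrow> ('m, 'n) tvec" where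
  "variation_field A \<gamma> t = (\<lambda>\<phi>. if \<phi> \<in> charts_at A (\<gamma> 0 t)
     then vector_derivative (\<lambda>s. snd \<phi> (\<gamma> s t)) (at 0) else 0)"

text \<open>The jump is zero at a chart not about \<open>c t\<close>, like every tangent vector at \<open>c t\<close>.\<close>

definition jump ::
  "('m, 'n::finite) chart set \<Rightarrow> (real \<Rightarrow> 'm) \<Rightarrow> (real \<Rightarrow> ('m, 'n) tvec) \<Rightarrow> real \<Rightarrow> ('m, 'n) tvec" where
  "jump A c V t = (\<lambda>\<phi>. if \<phi> \<in> charts_at A (c t)
     then Lim (at_right t) (\<lambda>\<tau>. V \<tau> \<phi>) - Lim (at_left t) (\<lambda>\<tau>. V \<tau> \<phi>) else 0)"

definition discontinuities ::
  "('m, 'n::finite) chart set \<Rightarrow> (real \<Rightarrow> 'm) \<Rightarrow> (real \<Rightarrow> ('m, 'n) tvec) \<Rightarrow> real set" where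
  "discontinuities A c V =
     {t\<in>{0<..<1}. \<exists>\<phi>\<in>charts_at A (c t). \<not> continuous (at t) (\<lambda>\<tau>. V \<tau> \<phi>)}"

context
  fixes A :: "('m, 'n::finite) chart set"
    and F :: "'m \<Rightarrow> ('m, 'n) tvec \<Rightarrow> real"
begin

text \<open>\<open>g\<^bsub>ij\<^esub>(q, y) V\<^sup>i W\<^sup>j\<close> is the same in all charts about \<open>q\<close>, so it is evaluated in an
  arbitrary one.\<close>

definition inner_g :: "'m \<Rightarrow> ('m, 'n) tvec \<Rightarrow> ('m, 'n) tvec \<Rightarrow> ('m, 'n) tvec \<Rightarrow> real" where
  "inner_g q y V W = (let \<phi> = (SOME \<phi>. \<phi> \<in> charts_at A q) in
     \<Sum>i\<in>UNIV. \<Sum>j\<in>UNIV. fund_g (local_F A F \<phi>) i j (snd \<phi> q) (y \<phi>) * V \<phi> $ i * W \<phi> $ j)"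

definition g_along :: "(real \<Rightarrow> 'm) \<Rightarrow> real \<Rightarrow> ('m, 'n) tvec \<Rightarrow> ('m, 'n) tvec \<Rightarrow> real" where
  "g_along c t V W = inner_g (c t) (velocity A {0..1} c t) V W"

definition norm_along :: "(real \<Rightarrow> 'm) \<Rightarrow> real \<Rightarrow> ('m, 'n) tvec \<Rightarrow> real" where
  "norm_along c t V = sqrt (g_along c t V V)"

definition covar_deriv ::
  "(real \<Rightarrow> 'm) \<Rightarrow> (real \<Rightarrow> ('m, 'n) tvec) \<Rightarrow> real \<Rightarrow> ('m, 'n) tvec" where
  "covar_deriv c X t = (\<lambda>\<phi>. if \<phi> \<in> charts_at A (c t) then
     (let f = local_F A F \<phi>; x = snd \<phi> (c t); y = velocity A {0..1} c t \<phi>;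
          y' = vector_derivative (\<lambda>\<tau>. velocity A {0..1} c \<tau> \<phi>) (at t within {0..1});
          X' = vector_derivative (\<lambda>\<tau>. X \<tau> \<phi>) (at t within {0..1})
      in \<chi> i. X' $ i + (\<Sum>m\<in>UNIV. X t \<phi> $ m *
           ((\<Sum>k\<in>UNIV. cartan_L f i m k x y * y $ k) +
            (\<Sum>k\<in>UNIV. cartan_C f i m k x y *
               (y' $ k + (\<Sum>l\<in>UNIV. nonlin_N f k l x y * y $ l))))))
     else 0)"

definition geodesic :: "(real \<Rightarrow> 'm) \<Rightarrow> bool" where
  "geodesic c \<longleftrightarrow> regular_on A {0..1} c \<and>
     (\<forall>t\<in>{0..1}. covar_deriv c (velocity A {0..1} c) t = (\<lambda>\<phi>. 0))"

text \<open>\<open>R\<^sup>2(X, c')c'\<close> along \<open>c\<close>.\<close>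

definition curv_R2 ::
  "(real \<Rightarrow> 'm) \<Rightarrow> (real \<Rightarrow> ('m, 'n) tvec) \<Rightarrow> real \<Rightarrow> ('m, 'n) tvec" where
  "curv_R2 c X t = (\<lambda>\<phi>. if \<phi> \<in> charts_at A (c t) then
     (let f = local_F A F \<phi>; x = snd \<phi> (c t); y = velocity A {0..1} c t \<phi>
      in \<chi> l. \<Sum>i\<in>UNIV. \<Sum>j\<in>UNIV. \<Sum>k\<in>UNIV. curv_h f l i j k x y * y $ i * y $ j * X t \<phi> $ k)
     else 0)"

text \<open>At the finitely many break points of \<open>c\<close> the integrand has an arbitrary value, which does
  not affect the integral.\<close>

definition p_energy :: "real \<Rightarrow> (real \<Rightarrow> 'm) \<Rightarrow> real" where
  "p_energy p c = integral {0..1} (\<lambda>t. norm_along c t (velocity A {0..1} c t) powr p)"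

definition second_variation :: "real \<Rightarrow> (real \<Rightarrow> real \<Rightarrow> real \<Rightarrow> 'm) \<Rightarrow> real" where
  "second_variation p cs = deriv (\<lambda>s\<^sub>1. deriv (\<lambda>s\<^sub>2. p_energy p (cs s\<^sub>1 s\<^sub>2)) 0) 0"

end

end

theory Submission
  imports Defs
begin

text \<open>
  Put \<open>\<L> = F\<^sup>p\<close>, a function of position and velocity, and let \<open>\<omega>\<close> be its Hilbert form
  \<open>\<partial>\<L>/\<partial>y\<^sup>i Y\<^sup>i\<close>. In a chart, Euler's relations for the homogeneous function \<open>F\<^sup>2\<close> give the
  first variation identity \<open>\<partial>\<^sub>2 \<L> = \<partial>\<^sub>t \<omega> - M\<^sub>i\<^sub>j S\<^sup>j Y\<^sup>i\<close>, where
  \<open>M\<^sub>i\<^sub>j = \<partial>\<^sup>2\<L>/\<partial>y\<^sup>i\<partial>y\<^sup>j\<close> and \<open>S = x'' + \<gamma>(x')(x', x')\<close>. Since \<open>S\<close> vanishes along the geodesic, so does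
  every term of the \<open>s\<^sub>1\<close>-derivative except \<open>\<partial>\<^sub>1 \<partial>\<^sub>2 \<L> = \<partial>\<^sub>t \<partial>\<^sub>1 \<omega> - M\<^sub>i\<^sub>j (\<partial>\<^sub>1 S\<^sup>j) Y\<^sup>i\<close>, and
  \<open>\<partial>\<^sub>1 S\<close> is the Jacobi expression of \<open>X\<close>. As \<open>\<L>\<close> and \<open>\<omega>\<close> do not depend on the chart, the
  identity can be integrated over a whole smooth piece although it is verified in a different chart
  at each time, and no transformation law of the connection or of its curvature is needed. At a
  break point the two boundary terms \<open>\<partial>\<^sub>1 \<omega>\<close> differ only through the jump of \<open>\<nabla>X/dt\<close>.
\<close>

section \<open>Calculus of smooth maps\<close>

text \<open>The factor p v^(p-4) and the weights v^2 and p - 2 come from the Hessian M of F^p =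
  (F^2)^(p/2): where F = v it is p v^(p-4) times the form sending (A, B) to v^2 g(A, B) + (p-2) g(A,
  y) g(B, y). The spray of F^2 serves for every p because F^2 is constant along it, so that
  differentiating the outer power adds exactly the contribution of the rank-one part of M.

  The obstacle is regularity at the ends of a piece. There the variation is known only through local
  smooth extensions \<open>h\<close>, which agree with it for times in the piece and are unrelated
  to it outside; and \<open>covar_deriv\<close> differentiates within [0,1], so at a break point it
  need not describe either side. Hence the geodesic and Jacobi identities are used in the open
  piece, the boundary term is continuous on the closed piece, and the fundamental theorem is applied
  in its interior form. One-sided limits of the covariant derivative are read off from its
  coordinate formula in \<open>h\<close>.

  Since the end points are fixed, the Hilbert form vanishes at times 0 and 1 for all parameters, so
  no outer boundary term remains.\<close>

definition dirD :: "('a::real_normed_vector \<Rightarrow> 'b::real_normed_vector) \<Rightarrow> 'a \<Rightarrow> 'a \<Rightarrow> 'b" where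
  "dirD f v x = frechet_derivative f (at x) v"

lemma has_derivative_dirD: "f differentiable (at x) \<Longrightarrow> (f has_derivative (\<lambda>v. dirD f v x)) (at x)"
  by (simp add: dirD_def frechet_derivative_works)

lemma dirD_eq: "(f has_derivative D) (at x) \<Longrightarrow> dirD f v x = D v"
  by (simp add: dirD_def frechet_derivative_at[symmetric])

lemma dirD_cong:
  assumes "open S" "x \<in> S" "\<And>z. z \<in> S \<Longrightarrow> f z = g z"
  shows "dirD f v x = dirD g v x"
proof (cases "f differentiable (at x)")
  case True
  then have "(f has_derivative (\<lambda>v. dirD f v x)) (at x)" by (rule has_derivative_dirD)
  then have "(g has_derivative (\<lambda>v. dirD f v x)) (at x)"
    using assms by (rule has_derivative_transform_within_open)
  from dirD_eq[OF this, of v] show ?thesis by simp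
next
  case False
  \<comment> \<open>Where no derivative exists, \<open>frechet_derivative\<close> is a choice
    governed by the predicate "is a derivative". That predicate depends only on the germ, so the two
    default values coincide as well.\<close>
  have "(f has_derivative D) (at x) \<longleftrightarrow> (g has_derivative D) (at x)" for D
    using assms has_derivative_transform_within_open[of f D x UNIV S g]
       has_derivative_transform_within_open[of g D x UNIV S f] by auto
  then show ?thesis by (simp add: dirD_def frechet_derivative_def)
qed

lemma Ck_on_cong:
  assumes "open S" "\<And>z. z \<in> S \<Longrightarrow> f z = g z" "Ck_on k S f"
  shows "Ck_on k S g"
  using assms(2,3)
proof (induction k arbitrary: f g)
  case 0
  then show ?case using continuous_on_cong[of S S f g] by simp
next
  case (Suc k)
  have "g differentiable (at x)" if "x \<in> S" for x
    using Suc.prems that assms(1) has_derivative_transform_within_open[of f _ x UNIV S g]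
    by (auto simp: differentiable_def) blast
  moreover have "Ck_on k S (\<lambda>x. frechet_derivative g (at x) v)" for v
    using Suc.IH[of "\<lambda>x. frechet_derivative f (at x) v" "\<lambda>x. frechet_derivative g (at x) v"]
       Suc.prems dirD_cong[OF assms(1), of _ f g v] by (simp add: dirD_def)
  ultimately show ?case by simp
qed

section \<open>Closure properties of C^k maps\<close>

lemma Ck_on_subset: "Ck_on k S f \<Longrightarrow> T \<subseteq> S \<Longrightarrow> Ck_on k T f"
  by (induction k arbitrary: f) (auto intro: continuous_on_subset)

lemma Ck_on_imp_continuous_on: "Ck_on k S f \<Longrightarrow> continuous_on S f"
  by (cases k) (auto intro!: continuous_at_imp_continuous_on differentiable_imp_continuous_within)

lemma Ck_on_SucD: "Ck_on (Suc k) S f \<Longrightarrow> Ck_on k S f"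
proof (induction k arbitrary: f)
  case 0
  then show ?case using Ck_on_imp_continuous_on by fastforce
next
  case (Suc k)
  then show ?case by (metis Ck_on.simps(2))
qed

lemma Ck_on_const: "Ck_on k S (\<lambda>x. c)"
  by (induction k arbitrary: c) auto

lemma Ck_on_bounded_linear: "bounded_linear f \<Longrightarrow> Ck_on k S f"
proof (cases k)
  case (Suc j)
  assume f: "bounded_linear f"
  then have "(f has_derivative f) (at x)" for x by (rule bounded_linear_imp_has_derivative)
  then have "f differentiable (at x)" "frechet_derivative f (at x) = f" for x
    by (auto simp: differentiable_def frechet_derivative_at[symmetric])
  then show ?thesis using Suc by (simp add: Ck_on_const)
qed (simp add: linear_continuous_on)

lemma Ck_on_add:
  assumes "open S"
  shows "Ck_on k S f \<Longrightarrow> Ck_on k S g \<Longrightarrow> Ck_on k S (\<lambda>x. f x + g x)"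
proof (induction k arbitrary: f g)
  case (Suc k)
  have "Ck_on k S (\<lambda>x. frechet_derivative (\<lambda>x. f x + g x) (at x) v)" for v
  proof (rule Ck_on_cong[OF assms _ Suc.IH])
    show "frechet_derivative f (at z) v + frechet_derivative g (at z) v
      = frechet_derivative (\<lambda>x. f x + g x) (at z) v" if "z \<in> S" for z
      using dirD_eq[OF has_derivative_add[OF has_derivative_dirD has_derivative_dirD], of f z g v] Suc.prems that
      by (auto simp: dirD_def)
  qed (use Suc.prems in auto)
  then show ?case using Suc.prems by auto
qed (auto intro: continuous_intros)

lemma Ck_on_bilinear:
  assumes "open S" "bounded_bilinear B"
  shows "Ck_on k S f \<Longrightarrow> Ck_on k S g \<Longrightarrow> Ck_on k S (\<lambda>x. B (f x) (g x))"
proof (induction k arbitrary: f g)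
  case 0 then show ?case using bounded_bilinear.continuous_on[OF assms(2)] by auto
next
  case (Suc k)
  have "Ck_on k S (\<lambda>x. frechet_derivative (\<lambda>x. B (f x) (g x)) (at x) v)" for v
  proof (rule Ck_on_cong[OF assms(1) _ Ck_on_add[OF assms(1) Suc.IH Suc.IH]])
    show "B (f z) (frechet_derivative g (at z) v) + B (frechet_derivative f (at z) v) (g z)
      = frechet_derivative (\<lambda>x. B (f x) (g x)) (at z) v" if "z \<in> S" for z
      using dirD_eq[OF bounded_bilinear.FDERIV[OF assms(2) has_derivative_dirD has_derivative_dirD], of f z g v] Suc.prems that
      by (auto simp: dirD_def)
  qed (use Suc.prems Ck_on_SucD in auto)
  moreover have "(\<lambda>x. B (f x) (g x)) differentiable (at z)" if "z \<in> S" for z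
    using Suc.prems that
    by (intro differentiableI[OF bounded_bilinear.FDERIV[OF assms(2) has_derivative_dirD has_derivative_dirD]]) auto
  ultimately show ?case by simp
qed

lemma Ck_on_sum:
  assumes "open S" "\<And>i. i \<in> I \<Longrightarrow> Ck_on k S (f i)"
  shows "Ck_on k S (\<lambda>x. \<Sum>i\<in>I. f i x)"
proof (cases "finite I")
  case True
  then show ?thesis using assms(2) by (induction I) (auto intro!: Ck_on_const Ck_on_add[OF assms(1)])
qed (simp add: Ck_on_const)

text \<open>The chain rule evaluates the derivative of \<open>g\<close> in a direction that moves
  with the point, whereas the induction hypothesis concerns fixed directions. Expanding the moving
  direction in the basis of the middle space gives a finite sum of products of C^k
  functions.\<close>

lemma Ck_on_compose:
  fixes f :: "'a::euclidean_space \<Rightarrow> 'b::euclidean_space"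
  assumes "open S" "open T" "f ` S \<subseteq> T"
  shows "Ck_on k S f \<Longrightarrow> Ck_on k T g \<Longrightarrow> Ck_on k S (\<lambda>x. g (f x))"
proof (induction k arbitrary: g)
  case 0
  then show ?case using assms continuous_on_compose2[of T g S f] by auto
next
  case (Suc k)
  have df: "f differentiable (at z)" if "z \<in> S" for z using Suc.prems that by auto
  have dg: "g differentiable (at (f z))" if "z \<in> S" for z using Suc.prems that assms(3) by auto
  have D: "((\<lambda>x. g (f x)) has_derivative (\<lambda>v. dirD g (dirD f v z) (f z))) (at z)" if "z \<in> S" for z
    using has_derivative_compose[OF has_derivative_dirD[OF df[OF that]] has_derivative_dirD[OF dg[OF that]]] .
  have "Ck_on k S (\<lambda>x. frechet_derivative (\<lambda>x. g (f x)) (at x) v)" for v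
  proof (rule Ck_on_cong[OF assms(1)])
    show "(\<Sum>b\<in>Basis. (dirD f v z \<bullet> b) *\<^sub>R dirD g b (f z)) = frechet_derivative (\<lambda>x. g (f x)) (at z) v"
      if "z \<in> S" for z
    proof -
      have "linear (\<lambda>v. dirD g v (f z))"
        using has_derivative_dirD[OF dg[OF that]] has_derivative_linear by blast
      note lin = this
      have "(\<Sum>b\<in>Basis. (dirD f v z \<bullet> b) *\<^sub>R dirD g b (f z))
           = dirD g (\<Sum>b\<in>Basis. (dirD f v z \<bullet> b) *\<^sub>R b) (f z)"
        by (simp add: linear_sum[OF lin] linear_cmul[OF lin])
      also have "\<dots> = dirD (\<lambda>x. g (f x)) v z"
        using dirD_eq[OF D[OF that], of v] by (simp add: euclidean_representation)
      finally show ?thesis by (simp add: dirD_def)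
    qed
    show "Ck_on k S (\<lambda>x. \<Sum>b\<in>Basis. (dirD f v x \<bullet> b) *\<^sub>R dirD g b (f x))"
    proof (intro Ck_on_sum[OF assms(1)] Ck_on_bilinear[OF assms(1) bounded_bilinear_scaleR])
      fix b :: 'b assume "b \<in> Basis"
      have "Ck_on k S (\<lambda>x. dirD f v x)" using Suc.prems by (simp add: dirD_def)
      then show "Ck_on k S (\<lambda>x. dirD f v x \<bullet> b)"
        by (intro Ck_on_bilinear[OF assms(1) bounded_bilinear_inner] Ck_on_const)
      show "Ck_on k S (\<lambda>x. dirD g b (f x))"
        using Suc.IH[of "\<lambda>y. dirD g b y"] Suc.prems Ck_on_SucD by (auto simp: dirD_def)
    qed
  qed
  moreover have "(\<lambda>x. g (f x)) differentiable (at z)" if "z \<in> S" for z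
    using D[OF that] by (auto simp: differentiable_def)
  ultimately show ?case by simp
qed

lemma Ck_on_inverse_real: "Ck_on k (-{0::real}) inverse"
proof (induction k)
  case (Suc k)
  have D: "(inverse has_derivative (\<lambda>v. - (inverse x * v * inverse x))) (at x)" if "x \<noteq> 0" for x :: real
    using that by (rule has_derivative_inverse')
  have "Ck_on k (-{0}) (\<lambda>x. frechet_derivative inverse (at x) v)" for v :: real
  proof (rule Ck_on_cong)
    show "Ck_on k (-{0}) (\<lambda>x. (- v) * (inverse x * inverse x))"
      by (intro Ck_on_bilinear[OF _ bounded_bilinear_mult] Ck_on_const Suc.IH) auto
    show "(- v) * (inverse z * inverse z) = frechet_derivative inverse (at z) v" if "z \<in> -{0}" for z
      using dirD_eq[OF D, of z v] that by (auto simp: dirD_def)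
  qed auto
  then show ?case using D by (auto simp: differentiable_def)
qed (auto intro!: continuous_intros)

lemma Ck_on_powr_real: "Ck_on k {0<..} (\<lambda>x::real. x powr a)"
proof (induction k arbitrary: a)
  case (Suc k)
  have D: "((\<lambda>x. x powr a) has_derivative (\<lambda>v. v * (a * x powr (a - 1)))) (at x)" if "x > 0" for x :: real
    using has_real_derivative_powr[OF that, of a] by (simp add: has_field_derivative_def mult.commute[of _ "a * _"] )
  have "Ck_on k {0<..} (\<lambda>x. frechet_derivative (\<lambda>x. x powr a) (at x) v)" for v :: real
  proof (rule Ck_on_cong)
    show "Ck_on k {0<..} (\<lambda>x. v * (a * x powr (a - 1)))"
      by (intro Ck_on_bilinear[OF _ bounded_bilinear_mult] Ck_on_const Suc.IH) auto
    show "v * (a * z powr (a - 1)) = frechet_derivative (\<lambda>x. x powr a) (at z) v" if "z \<in> {0<..}" for z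
      using dirD_eq[OF D, of z v] that by (auto simp: dirD_def)
  qed auto
  then show ?case using D by (fastforce simp: differentiable_def)
qed (auto intro!: continuous_intros)

lemma smooth_on_cong: "open S \<Longrightarrow> (\<And>z. z \<in> S \<Longrightarrow> f z = g z) \<Longrightarrow> smooth_on S f \<Longrightarrow> smooth_on S g"
  by (auto simp: smooth_on_def intro: Ck_on_cong)

lemma smooth_on_subset: "smooth_on S f \<Longrightarrow> T \<subseteq> S \<Longrightarrow> smooth_on T f"
  by (auto simp: smooth_on_def intro: Ck_on_subset)

lemma smooth_on_const: "smooth_on S (\<lambda>x. c)"
  by (simp add: smooth_on_def Ck_on_const)

lemma smooth_on_bounded_linear: "bounded_linear f \<Longrightarrow> smooth_on S f"
  by (simp add: smooth_on_def Ck_on_bounded_linear)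

lemma smooth_on_add: "open S \<Longrightarrow> smooth_on S f \<Longrightarrow> smooth_on S g \<Longrightarrow> smooth_on S (\<lambda>x. f x + g x)"
  by (simp add: smooth_on_def Ck_on_add)

lemma smooth_on_bilinear:
  "open S \<Longrightarrow> bounded_bilinear B \<Longrightarrow> smooth_on S f \<Longrightarrow> smooth_on S g \<Longrightarrow> smooth_on S (\<lambda>x. B (f x) (g x))"
  by (simp add: smooth_on_def Ck_on_bilinear)

lemma smooth_on_sum: "open S \<Longrightarrow> (\<And>i. i \<in> I \<Longrightarrow> smooth_on S (f i)) \<Longrightarrow> smooth_on S (\<lambda>x. \<Sum>i\<in>I. f i x)"
  by (simp add: smooth_on_def Ck_on_sum)

lemma smooth_on_mult:
  fixes f g :: "'a::real_normed_vector \<Rightarrow> real"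
  shows "open S \<Longrightarrow> smooth_on S f \<Longrightarrow> smooth_on S g \<Longrightarrow> smooth_on S (\<lambda>x. f x * g x)"
  by (rule smooth_on_bilinear[OF _ bounded_bilinear_mult])

lemma smooth_on_diff:
  fixes f g :: "'a::real_normed_vector \<Rightarrow> real"
  shows "open S \<Longrightarrow> smooth_on S f \<Longrightarrow> smooth_on S g \<Longrightarrow> smooth_on S (\<lambda>x. f x - g x)"
  using smooth_on_add[of S f "\<lambda>x. (-1) * g x"] smooth_on_mult[of S "\<lambda>x. -1" g] by (simp add: smooth_on_const)

lemma smooth_on_prod:
  fixes f :: "'i \<Rightarrow> 'a::real_normed_vector \<Rightarrow> real"
  assumes "open S" "\<And>i. i \<in> I \<Longrightarrow> smooth_on S (f i)"
  shows "smooth_on S (\<lambda>x. \<Prod>i\<in>I. f i x)"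
proof (cases "finite I")
  case True
  then show ?thesis using assms(2) by (induction I) (auto intro!: smooth_on_const smooth_on_mult[OF assms(1)])
qed (simp add: smooth_on_const)

lemma smooth_on_compose:
  fixes f :: "'a::euclidean_space \<Rightarrow> 'b::euclidean_space"
  shows "open S \<Longrightarrow> open T \<Longrightarrow> (\<And>z. z \<in> S \<Longrightarrow> f z \<in> T) \<Longrightarrow> smooth_on S f \<Longrightarrow> smooth_on T g
    \<Longrightarrow> smooth_on S (\<lambda>x. g (f x))"
  using Ck_on_compose[of S T f _ g] unfolding smooth_on_def by blast

lemma smooth_on_inverse:
  fixes f :: "'a::euclidean_space \<Rightarrow> real"
  shows "open S \<Longrightarrow> smooth_on S f \<Longrightarrow> (\<And>z. z \<in> S \<Longrightarrow> f z \<noteq> 0) \<Longrightarrow> smooth_on S (\<lambda>x. inverse (f x))"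
  by (rule smooth_on_compose[of S "-{0}" f inverse]) (auto simp: Ck_on_inverse_real smooth_on_def[of _ inverse])

lemma smooth_on_powr:
  fixes f :: "'a::euclidean_space \<Rightarrow> real"
  shows "open S \<Longrightarrow> smooth_on S f \<Longrightarrow> (\<And>z. z \<in> S \<Longrightarrow> f z > 0) \<Longrightarrow> smooth_on S (\<lambda>x. f x powr a)"
  by (rule smooth_on_compose[of S "{0<..}" f "\<lambda>x. x powr a"])
    (auto simp: Ck_on_powr_real smooth_on_def[of _ "\<lambda>x. x powr a"])

lemma smooth_on_dirD: "smooth_on S f \<Longrightarrow> smooth_on S (dirD f v)"
  unfolding smooth_on_def using Ck_on.simps(2)[of _ S f] by (simp add: dirD_def[abs_def])

lemma smooth_on_differentiable: "smooth_on S f \<Longrightarrow> x \<in> S \<Longrightarrow> f differentiable (at x)"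
  unfolding smooth_on_def using Ck_on.simps(2)[of 0 S f] by blast

lemma smooth_on_continuous_on: "smooth_on S f \<Longrightarrow> continuous_on S f"
  by (metis smooth_on_def Ck_on.simps(1))

lemma smooth_on_has_derivative: "smooth_on S f \<Longrightarrow> x \<in> S \<Longrightarrow> (f has_derivative (\<lambda>v. dirD f v x)) (at x)"
  by (intro has_derivative_dirD smooth_on_differentiable)

section \<open>Derivatives along lines and symmetry of second derivatives\<close>

lemma has_vector_derivative_line:
  assumes "f differentiable (at (z + a *\<^sub>R v))"
  shows "((\<lambda>a. f (z + a *\<^sub>R v)) has_vector_derivative dirD f v (z + a *\<^sub>R v)) (at a)"
proof -
  have "((\<lambda>a. z + a *\<^sub>R v) has_derivative (\<lambda>h. h *\<^sub>R v)) (at a)"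
    by (auto intro!: derivative_eq_intros)
  from has_derivative_compose[OF this has_derivative_dirD[OF assms]]
  have "((\<lambda>a. f (z + a *\<^sub>R v)) has_derivative (\<lambda>h. dirD f (h *\<^sub>R v) (z + a *\<^sub>R v))) (at a)" .
  then show ?thesis
    using linear_cmul[OF has_derivative_linear[OF has_derivative_dirD[OF assms]]]
    by (simp add: has_vector_derivative_def)
qed

text \<open>By the mean value theorem, applied in both orders, the second difference divided by
  \<open>s\<^sup>2\<close> is a value of either mixed derivative.\<close>

lemma second_difference_value:
  fixes f :: "'a::euclidean_space \<Rightarrow> real"
  assumes f: "smooth_on S f" and s: "s > 0"
    and sub: "\<And>a b. 0 \<le> a \<Longrightarrow> a \<le> s \<Longrightarrow> 0 \<le> b \<Longrightarrow> b \<le> s \<Longrightarrow> x + a *\<^sub>R v + b *\<^sub>R w \<in> S"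
  shows "\<exists>a b. 0 \<le> a \<and> a \<le> s \<and> 0 \<le> b \<and> b \<le> s \<and>
    f (x + s *\<^sub>R v + s *\<^sub>R w) - f (x + s *\<^sub>R v) - f (x + s *\<^sub>R w) + f x
      = s * s * dirD (dirD f v) w (x + a *\<^sub>R v + b *\<^sub>R w)"
proof -
  have d1: "((\<lambda>a. f (x + a *\<^sub>R v + b *\<^sub>R w)) has_real_derivative dirD f v (x + a *\<^sub>R v + b *\<^sub>R w)) (at a)"
    if "0 \<le> a" "a \<le> s" "0 \<le> b" "b \<le> s" for a b
    using has_vector_derivative_line[of f "x + b *\<^sub>R w" a v] smooth_on_differentiable[OF f sub[OF that]]
    by (simp add: has_real_derivative_iff_has_vector_derivative ac_simps)
  have d2: "((\<lambda>b. dirD f v (x + a *\<^sub>R v + b *\<^sub>R w)) has_real_derivative dirD (dirD f v) w (x + a *\<^sub>R v + b *\<^sub>R w)) (at b)"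
    if "0 \<le> a" "a \<le> s" "0 \<le> b" "b \<le> s" for a b
    using has_vector_derivative_line[of "dirD f v" "x + a *\<^sub>R v" b w]
      smooth_on_differentiable[OF smooth_on_dirD[OF f] sub[OF that], of v]
    by (simp add: has_real_derivative_iff_has_vector_derivative)
  have "((\<lambda>a. f (x + a *\<^sub>R v + s *\<^sub>R w) - f (x + a *\<^sub>R v)) has_real_derivative
      dirD f v (x + a *\<^sub>R v + s *\<^sub>R w) - dirD f v (x + a *\<^sub>R v)) (at a)" if "0 \<le> a" "a \<le> s" for a
    using DERIV_diff[OF d1[OF that, of s] d1[OF that, of 0]] s by simp
  from MVT2[OF s this] obtain a where a: "0 < a" "a < s"
    "f (x + s *\<^sub>R v + s *\<^sub>R w) - f (x + s *\<^sub>R v) - (f (x + s *\<^sub>R w) - f x) =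
     s * (dirD f v (x + a *\<^sub>R v + s *\<^sub>R w) - dirD f v (x + a *\<^sub>R v))" by auto
  have "((\<lambda>b. dirD f v (x + a *\<^sub>R v + b *\<^sub>R w)) has_real_derivative dirD (dirD f v) w (x + a *\<^sub>R v + b *\<^sub>R w)) (at b)"
    if "0 \<le> b" "b \<le> s" for b using d2[of a b] that a by simp
  from MVT2[OF s this] obtain b where b: "0 < b" "b < s"
    "dirD f v (x + a *\<^sub>R v + s *\<^sub>R w) - dirD f v (x + a *\<^sub>R v) = s * dirD (dirD f v) w (x + a *\<^sub>R v + b *\<^sub>R w)"
    by auto
  show ?thesis using a b by (intro exI[of _ a] exI[of _ b]) (auto simp: algebra_simps)
qed

text \<open>If the two values differed, continuity would keep each mixed derivative within half the
  gap of its value at \<open>x\<close> on a small parallelogram, although the second difference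
  quotient is a value of both.\<close>

lemma dirD_commute_real:
  fixes f :: "'a::euclidean_space \<Rightarrow> real"
  assumes f: "smooth_on S f" and S: "open S" "x \<in> S"
  shows "dirD (dirD f v) w x = dirD (dirD f w) v x"
proof (rule ccontr)
  define A where "A = dirD (dirD f v) w"
  define B where "B = dirD (dirD f w) v"
  assume "dirD (dirD f v) w x \<noteq> dirD (dirD f w) v x"
  then have e: "\<bar>A x - B x\<bar> / 2 > 0" (is "?e > 0") by (simp add: A_def B_def)
  have "continuous_on S A" "continuous_on S B"
    unfolding A_def B_def by (auto intro!: smooth_on_continuous_on smooth_on_dirD f)
  then have "isCont A x" "isCont B x" using S by (auto simp: continuous_on_eq_continuous_at)
  then have "\<forall>\<^sub>F z in nhds x. dist (A z) (A x) < ?e" "\<forall>\<^sub>F z in nhds x. dist (B z) (B x) < ?e"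
    using e tendstoD[of A "A x" "nhds x" ?e] tendstoD[of B "B x" "nhds x" ?e]
    by (auto simp: isCont_def tendsto_at_iff_tendsto_nhds)
  then have "\<forall>\<^sub>F z in nhds x. dist (A z) (A x) < ?e \<and> dist (B z) (B x) < ?e \<and> z \<in> S"
    using S by (intro eventually_conj) (auto simp: eventually_nhds)
  then obtain d where d: "d > 0" "\<And>z. dist z x < d \<Longrightarrow> dist (A z) (A x) < ?e \<and> dist (B z) (B x) < ?e \<and> z \<in> S"
    unfolding eventually_nhds_metric by blast
  \<comment> \<open>With this step the parallelogram spanned by \<open>s *\<^sub>R v\<close> and
    \<open>s *\<^sub>R w\<close> lies within d / 2 of \<open>x\<close>; the summand 1 keeps the
    denominator positive when both directions vanish.\<close>
  define s where "s = d / (2 * (norm v + norm w + 1))"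
  have n: "norm v + norm w + 1 > 0" by (simp add: add_nonneg_pos)
  have s: "s > 0" unfolding s_def using d(1) n by simp
  have near: "dist (x + a *\<^sub>R v + b *\<^sub>R w) x < d" if "0 \<le> a" "a \<le> s" "0 \<le> b" "b \<le> s" for a b
  proof -
    have "dist (x + a *\<^sub>R v + b *\<^sub>R w) x = norm (a *\<^sub>R v + b *\<^sub>R w)" by (simp add: dist_norm algebra_simps)
    also have "\<dots> \<le> a * norm v + b * norm w" using that norm_triangle_ineq[of "a *\<^sub>R v" "b *\<^sub>R w"] by simp
    also have "\<dots> \<le> s * norm v + s * norm w" using that by (intro add_mono mult_right_mono) auto
    also have "\<dots> \<le> s * (norm v + norm w + 1)" using s by (simp add: algebra_simps)
    also have "\<dots> = d / 2" unfolding s_def using n by (simp add: field_simps)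
    finally show ?thesis using d(1) by simp
  qed
  obtain a b where ab: "0 \<le> a" "a \<le> s" "0 \<le> b" "b \<le> s"
    "f (x + s *\<^sub>R v + s *\<^sub>R w) - f (x + s *\<^sub>R v) - f (x + s *\<^sub>R w) + f x = s * s * A (x + a *\<^sub>R v + b *\<^sub>R w)"
    using second_difference_value[OF f s, of x v w] d(2)[OF near] unfolding A_def by blast
  have near': "x + b *\<^sub>R w + a *\<^sub>R v \<in> S" if "0 \<le> a" "a \<le> s" "0 \<le> b" "b \<le> s" for a b
    using d(2)[OF near[OF that]] by (simp add: ac_simps)
  obtain a' b' where ab': "0 \<le> a'" "a' \<le> s" "0 \<le> b'" "b' \<le> s"
    "f (x + s *\<^sub>R w + s *\<^sub>R v) - f (x + s *\<^sub>R w) - f (x + s *\<^sub>R v) + f x = s * s * B (x + a' *\<^sub>R w + b' *\<^sub>R v)"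
    using second_difference_value[OF f s, of x w v] near' unfolding B_def by blast
  have eq: "x + s *\<^sub>R w + s *\<^sub>R v = x + s *\<^sub>R v + s *\<^sub>R w" "x + a' *\<^sub>R w + b' *\<^sub>R v = x + b' *\<^sub>R v + a' *\<^sub>R w"
    by simp_all
  have "s * s * A (x + a *\<^sub>R v + b *\<^sub>R w) = s * s * B (x + b' *\<^sub>R v + a' *\<^sub>R w)"
    using ab(5) ab'(5)[unfolded eq] by linarith
  then have "A (x + a *\<^sub>R v + b *\<^sub>R w) = B (x + b' *\<^sub>R v + a' *\<^sub>R w)" using s by simp
  moreover have "dist (A (x + a *\<^sub>R v + b *\<^sub>R w)) (A x) < ?e" "dist (B (x + b' *\<^sub>R v + a' *\<^sub>R w)) (B x) < ?e"
    using d(2)[OF near[OF ab(1-4)]] d(2)[OF near[OF ab'(3,4,1,2)]] by blast+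
  ultimately show False unfolding dist_real_def by (smt (verit) field_sum_of_halves)
qed

lemma dirD_bounded_linear:
  assumes "bounded_linear L" "f differentiable (at x)"
  shows "dirD (\<lambda>z. L (f z)) v x = L (dirD f v x)"
  using dirD_eq[OF bounded_linear.has_derivative[OF assms(1) has_derivative_dirD[OF assms(2)]]] .

lemma dirD_commute:
  fixes f :: "'a::euclidean_space \<Rightarrow> 'b::euclidean_space"
  assumes f: "smooth_on S f" and S: "open S" "x \<in> S"
  shows "dirD (dirD f v) w x = dirD (dirD f w) v x"
proof (rule euclidean_eqI)
  fix b :: 'b assume "b \<in> Basis"
  have L: "bounded_linear (\<lambda>z. z \<bullet> b)" by (rule bounded_linear_inner_left)
  have f': "smooth_on S (\<lambda>z. f z \<bullet> b)"
    by (intro smooth_on_bilinear[OF S(1) bounded_bilinear_inner] f smooth_on_const)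
  have D: "dirD (dirD f v) w x \<bullet> b = dirD (dirD (\<lambda>z. f z \<bullet> b) v) w x" for v w
  proof -
    have "dirD (dirD (\<lambda>z. f z \<bullet> b) v) w x = dirD (\<lambda>z. dirD f v z \<bullet> b) w x"
      by (rule dirD_cong[OF S]) (auto intro!: dirD_bounded_linear[OF L] smooth_on_differentiable[OF f])
    also have "\<dots> = dirD (dirD f v) w x \<bullet> b"
      by (intro dirD_bounded_linear[OF L] smooth_on_differentiable[OF smooth_on_dirD[OF f]] S)
    finally show ?thesis by simp
  qed
  show "dirD (dirD f v) w x \<bullet> b = dirD (dirD f w) v x \<bullet> b"
    unfolding D by (rule dirD_commute_real[OF f' S])
qed


section \<open>Local Finsler geometry\<close>

lemma dirD_add_smooth:
  assumes "smooth_on S f" "smooth_on S g" "x \<in> S"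
  shows "dirD (\<lambda>z. f z + g z) v x = dirD f v x + dirD g v x"
  using dirD_eq[OF has_derivative_add[OF smooth_on_has_derivative[OF assms(1,3)] smooth_on_has_derivative[OF assms(2,3)]]] .

lemma dirD_diff_smooth:
  assumes "smooth_on S f" "smooth_on S g" "x \<in> S"
  shows "dirD (\<lambda>z. f z - g z) v x = dirD f v x - dirD g v x"
  using dirD_eq[OF has_derivative_diff[OF smooth_on_has_derivative[OF assms(1,3)] smooth_on_has_derivative[OF assms(2,3)]]] .

lemma dirD_mult_smooth:
  fixes f g :: "'a::real_normed_vector \<Rightarrow> real"
  assumes "smooth_on S f" "smooth_on S g" "x \<in> S"
  shows "dirD (\<lambda>z. f z * g z) v x = f x * dirD g v x + dirD f v x * g x"
  using dirD_eq[OF has_derivative_mult[OF smooth_on_has_derivative[OF assms(1,3)] smooth_on_has_derivative[OF assms(2,3)]]] .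

lemma dirD_cmult_smooth:
  fixes f :: "'a::real_normed_vector \<Rightarrow> real"
  assumes "smooth_on S f" "x \<in> S"
  shows "dirD (\<lambda>z. c * f z) v x = c * dirD f v x"
  using dirD_eq[OF has_derivative_mult_right[OF smooth_on_has_derivative[OF assms]]] .

lemma dirD_sum_smooth:
  assumes "\<And>i. i \<in> I \<Longrightarrow> smooth_on S (f i)" "x \<in> S"
  shows "dirD (\<lambda>z. \<Sum>i\<in>I. f i z) v x = (\<Sum>i\<in>I. dirD (f i) v x)"
  by (rule dirD_eq[OF has_derivative_sum[OF smooth_on_has_derivative]]) (use assms in auto)

lemma dirD_powr_smooth:
  fixes f :: "'a::real_normed_vector \<Rightarrow> real"
  assumes "smooth_on S f" "x \<in> S" "f x > 0"
  shows "dirD (\<lambda>z. f z powr a) v x = a * f x powr (a - 1) * dirD f v x"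
proof -
  have "((\<lambda>x. x powr a) has_derivative (\<lambda>h. a * f x powr (a - 1) * h)) (at (f x))"
    using has_real_derivative_powr[OF assms(3), of a] by (simp add: has_field_derivative_def)
  from dirD_eq[OF has_derivative_compose[OF smooth_on_has_derivative[OF assms(1,2)] this]]
  show ?thesis .
qed

lemma dirD_vec_nth:
  fixes f :: "'a::real_normed_vector \<Rightarrow> real^'n"
  assumes "f differentiable (at x)"
  shows "dirD (\<lambda>z. f z $ i) v x = dirD f v x $ i"
  using dirD_bounded_linear[OF bounded_linear_vec_nth assms] .

lemma smooth_on_vec_nth: "open S \<Longrightarrow> smooth_on S f \<Longrightarrow> smooth_on S (\<lambda>z. f z $ i)"
  for f :: "'a::euclidean_space \<Rightarrow> real^'n"
  using smooth_on_compose[of S UNIV f "\<lambda>y. y $ i"] smooth_on_bounded_linear[OF bounded_linear_vec_nth] by auto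

lemma smooth_on_Pair:
  fixes f :: "'a::euclidean_space \<Rightarrow> 'b::euclidean_space" and g :: "'a \<Rightarrow> 'c::euclidean_space"
  assumes "open S" "smooth_on S f" "smooth_on S g"
  shows "smooth_on S (\<lambda>z. (f z, g z))"
proof -
  have L: "bounded_linear (\<lambda>x::'b. (x, 0::'c))" "bounded_linear (\<lambda>y::'c. (0::'b, y))"
    by (intro bounded_linear_Pair bounded_linear_ident bounded_linear_zero)+
  have "smooth_on S (\<lambda>z. (f z, 0) + (0, g z))"
    using smooth_on_compose[OF assms(1) open_UNIV _ assms(2) smooth_on_bounded_linear[OF L(1)]]
      smooth_on_compose[OF assms(1) open_UNIV _ assms(3) smooth_on_bounded_linear[OF L(2)]] assms(1)
    by (intro smooth_on_add) auto
  then show ?thesis by simp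
qed

lemma dirD_linear:
  assumes "smooth_on S f" "x \<in> S"
  shows "linear (\<lambda>v. dirD f v x)"
  using has_derivative_linear[OF smooth_on_has_derivative[OF assms]] .

text \<open>Determinants enter through Cramer's rule for the inverse metric in
  \<open>smooth_gi\<close>.\<close>

lemma det_smooth:
  fixes M :: "'n::finite \<Rightarrow> 'n \<Rightarrow> 'a::euclidean_space \<Rightarrow> real"
  assumes "open S" "\<And>i j. smooth_on S (M i j)"
  shows "smooth_on S (\<lambda>z. det (\<chi> i j. M i j z))"
  unfolding det_def by (auto intro!: smooth_on_sum smooth_on_mult smooth_on_prod smooth_on_const assms)

text \<open>The local geometry is defined with curried functions and one-variable
  \<open>deriv\<close>, while \<open>dirD\<close> and \<open>smooth_on\<close> act on functions of
  one point of the product; this is the bridge between the two.\<close>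

definition uncurried :: "('a \<Rightarrow> 'b \<Rightarrow> 'c) \<Rightarrow> 'a \<times> 'b \<Rightarrow> 'c" where
  "uncurried u z = u (fst z) (snd z)"

locale local_finsler =
  fixes U :: "(real^'n::finite) set" and f :: "real^'n \<Rightarrow> real^'n \<Rightarrow> real"
  assumes open_U: "open U"
    and smooth_f: "smooth_on (U \<times> (UNIV - {0})) (\<lambda>(x, y). f x y)"
    and hom_f: "\<And>x y a. x \<in> U \<Longrightarrow> f x (a *\<^sub>R y) = \<bar>a\<bar> * f x y"
    and pos_f: "\<And>x y. x \<in> U \<Longrightarrow> y \<noteq> 0 \<Longrightarrow> f x y > 0"
    and pos_def: "\<And>x y w. x \<in> U \<Longrightarrow> y \<noteq> 0 \<Longrightarrow> w \<noteq> 0 \<Longrightarrow>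
          (\<Sum>i\<in>UNIV. \<Sum>j\<in>UNIV. fund_g f i j x y * w $ i * w $ j) > 0"
begin

text \<open>The slit tangent bundle over the chart: the zero section is removed because smoothness
  and positive definiteness are assumed only away from it.\<close>

abbreviation "D \<equiv> U \<times> (UNIV - {0::real^'n})"
text \<open>\<open>X i\<close> and \<open>Y i\<close> are the coordinate directions of position and velocity.\<close>

definition "X i = (axis i 1 :: real^'n, 0 :: real^'n)"
definition "Y i = (0 :: real^'n, axis i 1 :: real^'n)"

lemma open_D: "open D"
  using open_U by (intro open_Times open_delete) auto

lemma dirD_Pair:
  fixes u :: "(real^'n) \<times> (real^'n) \<Rightarrow> real"
  assumes "smooth_on D u" "z \<in> D"
  shows "dirD u (a, b) z = (\<Sum>i\<in>UNIV. a $ i * dirD u (X i) z) + (\<Sum>i\<in>UNIV. b $ i * dirD u (Y i) z)"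
proof -
  have ax: "a = (\<Sum>i\<in>UNIV. a $ i *\<^sub>R axis i 1)" for a :: "real^'n"
    using basis_expansion[of a] by (simp add: scalar_mult_eq_scaleR)
  have "(a, b) = (\<Sum>i\<in>UNIV. a $ i *\<^sub>R X i) + (\<Sum>i\<in>UNIV. b $ i *\<^sub>R Y i)"
    using ax[of a] ax[of b] by (simp add: X_def Y_def prod_eq_iff fst_sum snd_sum)
  note L = dirD_linear[OF assms]
  show ?thesis
    by (subst \<open>(a, b) = _\<close>) (simp add: linear_add[OF L] linear_sum[OF L] linear_cmul[OF L])
qed

lemma deriv_line:
  assumes "smooth_on D u" "z \<in> D"
  shows "deriv (\<lambda>h. u (z + h *\<^sub>R v)) 0 = dirD u v z"
  using has_vector_derivative_line[of u z 0 v] smooth_on_differentiable[OF assms]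
  by (intro DERIV_imp_deriv) (simp add: has_real_derivative_iff_has_vector_derivative)

lemma partial_x_eq:
  assumes "smooth_on D (uncurried u)" "z \<in> D"
  shows "uncurried (partial_x i u) z = dirD (uncurried u) (X i) z"
  using deriv_line[OF assms, of "X i"] by (simp add: uncurried_def partial_x_def X_def)

lemma partial_y_eq:
  assumes "smooth_on D (uncurried u)" "z \<in> D"
  shows "uncurried (partial_y i u) z = dirD (uncurried u) (Y i) z"
  using deriv_line[OF assms, of "Y i"] by (simp add: uncurried_def partial_y_def Y_def)

lemma smooth_partial_y: "smooth_on D (uncurried u) \<Longrightarrow> smooth_on D (uncurried (partial_y i u))"
  using smooth_on_cong[OF open_D _ smooth_on_dirD, of "uncurried u" "Y i"] partial_y_eq[of u] by fastforce

lemma uncurried_simps: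
  "uncurried (\<lambda>x y. u x y + w x y) = (\<lambda>z. uncurried u z + uncurried w z)"
  "uncurried (\<lambda>x y. u x y - w x y) = (\<lambda>z. uncurried u z - uncurried w z)"
  "uncurried (\<lambda>x y. u x y * w x y) = (\<lambda>z. uncurried u z * uncurried w z)"
  "uncurried (\<lambda>x y. \<Sum>k\<in>I. v k x y) = (\<lambda>z. \<Sum>k\<in>I. uncurried (v k) z)"
  "uncurried (\<lambda>x y. c) = (\<lambda>z. c)"
  "uncurried (\<lambda>x y. y $ k) = (\<lambda>z. snd z $ k)"
  by (auto simp: uncurried_def fun_eq_iff)

lemma smooth_snd: "smooth_on D (\<lambda>z. snd z $ k)"
  by (rule smooth_on_bounded_linear[OF bounded_linear_compose[OF bounded_linear_vec_nth bounded_linear_snd]])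

lemmas smooth_intros = smooth_on_add smooth_on_mult smooth_on_diff smooth_on_sum smooth_on_const
  smooth_on_dirD smooth_snd open_D

text \<open>In the notation of the paper, \<open>gi\<close> is the inverse \<open>g\<^sup>i\<^sup>j\<close>, \<open>G2\<close> is \<open>\<gamma>\<^sup>i\<^bsub>kl\<^esub> y\<^sup>k y\<^sup>l\<close>, and \<open>del k\<close>,
  defined below, is \<open>\<delta>/\<delta>x\<^sup>k\<close>.\<close>

definition "Q = uncurried (\<lambda>x y. (f x y)\<^sup>2)"
definition "q i = dirD Q (Y i)"
definition "g i j = uncurried (fund_g f i j)"
definition "gi i j = uncurried (fund_ginv f i j)"
definition "G2 i z = (\<Sum>k\<in>UNIV. \<Sum>l\<in>UNIV. uncurried (christoffel f i k l) z * snd z $ k * snd z $ l)"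
definition "N i j = uncurried (nonlin_N f i j)"
definition "L i j k = uncurried (cartan_L f i j k)"
definition "C i j k = uncurried (cartan_C f i j k)"

section \<open>Smoothness of the metric, its inverse and the connection coefficients\<close>

lemma smooth_Q: "smooth_on D Q"
proof -
  have "smooth_on D (\<lambda>z. uncurried f z * uncurried f z)"
    using smooth_f by (intro smooth_on_mult open_D) (simp_all add: uncurried_def[abs_def] case_prod_beta')
  then show ?thesis by (simp add: Q_def uncurried_def[abs_def] power2_eq_square)
qed

lemma Q_pos: "z \<in> D \<Longrightarrow> Q z > 0"
  using pos_f[of "fst z" "snd z"] by (auto simp: Q_def uncurried_def)

lemma smooth_q: "smooth_on D (q i)"
  unfolding q_def by (intro smooth_on_dirD smooth_Q)

lemma g_eq: "z \<in> D \<Longrightarrow> g i j z = 1/2 * dirD (q j) (Y i) z"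
proof -
  assume z: "z \<in> D"
  have "uncurried (partial_y j (\<lambda>x y. (f x y)\<^sup>2)) w = q j w" if "w \<in> D" for w
    using partial_y_eq[OF _ that] smooth_Q by (auto simp: q_def Q_def)
  then have "dirD (uncurried (partial_y j (\<lambda>x y. (f x y)\<^sup>2))) (Y i) z = dirD (q j) (Y i) z"
    by (rule dirD_cong[OF open_D z])
  moreover have "smooth_on D (uncurried (partial_y j (\<lambda>x y. (f x y)\<^sup>2)))"
    using smooth_Q by (intro smooth_partial_y) (simp add: Q_def)
  ultimately show ?thesis
    using partial_y_eq[OF _ z] by (simp add: g_def fund_g_def uncurried_def[of "fund_g f i j"]) (simp add: uncurried_def)
qed

lemma smooth_g: "smooth_on D (g i j)"
  by (rule smooth_on_cong[OF open_D g_eq[symmetric]]) (assumption | intro smooth_intros smooth_q)+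

lemma g_sym: "z \<in> D \<Longrightarrow> g i j z = g j i z"
  using dirD_commute[OF smooth_Q open_D, of z "Y i" "Y j"] by (simp add: g_eq q_def)

definition "Gm z = (\<chi> k l. g k l z)"

text \<open>The quadratic form of \<open>w\<close> is the inner product of \<open>w\<close> with
  \<open>Gm z *v w\<close>, so positive definiteness makes the kernel trivial.\<close>

lemma inv_Gm: assumes "z \<in> D"
  shows "Gm z ** matrix_inv (Gm z) = mat 1" "matrix_inv (Gm z) ** Gm z = mat 1" "det (Gm z) \<noteq> 0"
proof -
  have "w = 0" if "Gm z *v w = 0" for w
  proof (rule ccontr)
    assume "w \<noteq> 0"
    then have "(\<Sum>i\<in>UNIV. \<Sum>j\<in>UNIV. g i j z * w $ i * w $ j) > 0"
      using pos_def[of "fst z" "snd z" w] assms by (simp add: mem_Times_iff g_def uncurried_def)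
    moreover have "(\<Sum>i\<in>UNIV. \<Sum>j\<in>UNIV. g i j z * w $ i * w $ j) = w \<bullet> (Gm z *v w)"
      by (simp add: inner_vec_def matrix_vector_mult_def Gm_def sum_distrib_left ac_simps)
    ultimately show False using that by simp
  qed
  then have "\<exists>B. B ** Gm z = mat 1" by (simp add: matrix_left_invertible_ker)
  then have i: "invertible (Gm z)" using invertible_left_inverse by blast
  then show "det (Gm z) \<noteq> 0" by (simp add: invertible_det_nz)
  from i show "Gm z ** matrix_inv (Gm z) = mat 1" "matrix_inv (Gm z) ** Gm z = mat 1"
    unfolding invertible_def matrix_inv_def by (metis (mono_tags, lifting) someI_ex)+
qed

lemma gi_eq: "gi i j z = matrix_inv (Gm z) $ i $ j"
  by (simp add: gi_def uncurried_def fund_ginv_def Gm_def g_def)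

lemma g_gi: "z \<in> D \<Longrightarrow> (\<Sum>m\<in>UNIV. g a m z * gi m b z) = (if a = b then 1 else 0)"
  using arg_cong[OF inv_Gm(1), of z "\<lambda>A. A $ a $ b"]
  by (simp add: matrix_matrix_mult_def mat_def gi_eq Gm_def)

lemma gi_g: "z \<in> D \<Longrightarrow> (\<Sum>m\<in>UNIV. gi a m z * g m b z) = (if a = b then 1 else 0)"
  using arg_cong[OF inv_Gm(2), of z "\<lambda>A. A $ a $ b"]
  by (simp add: matrix_matrix_mult_def mat_def gi_eq Gm_def)

text \<open>Cramer's rule exhibits each entry as a quotient of determinants in the smooth functions
  \<open>g\<close>, with nonvanishing denominator; this avoids differentiating
  \<open>matrix_inv\<close>.\<close>

lemma smooth_gi: "smooth_on D (gi i j)"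
proof (rule smooth_on_cong[OF open_D])
  \<comment> \<open>The metric with column \<open>i\<close> replaced by the \<open>j\<close>-th unit
    vector, as Cramer's rule prescribes for column \<open>j\<close> of the inverse.\<close>
  let ?E = "\<lambda>a b z. if b = i then (if a = j then 1 else 0) else g a b z"
  let ?M = "\<lambda>z. det (\<chi> a b. ?E a b z)"
  have "smooth_on D (?E a b)" for a b
    by (cases "b = i") (simp_all add: smooth_on_const smooth_g)
  then show "smooth_on D (\<lambda>z. ?M z * inverse (det (Gm z)))"
    unfolding Gm_def
    by (intro smooth_on_mult smooth_on_inverse det_smooth open_D smooth_g)
      (use inv_Gm(3) in \<open>simp_all add: Gm_def\<close>)
  fix z assume z: "z \<in> D"
  have "Gm z *v (\<chi> a. gi a j z) = axis j 1"
    using g_gi[OF z] by (simp add: vec_eq_iff matrix_vector_mult_def Gm_def axis_def)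
  then have "(\<chi> a. gi a j z) $ i = det (\<chi> a b. if b = i then axis j 1 $ a else Gm z $ a $ b) / det (Gm z)"
    unfolding cramer[OF inv_Gm(3)[OF z]] by simp
  moreover have "(\<chi> a b. if b = i then axis j 1 $ a else Gm z $ a $ b)
      = (\<chi> a b. if b = i then (if a = j then 1 else 0) else g a b z)"
    by (simp add: vec_eq_iff axis_def Gm_def)
  ultimately show "?M z * inverse (det (Gm z)) = gi i j z" by (simp add: divide_inverse)
qed

text \<open>The Christoffel symbols and L have the shape 1/2 g^(im) T_m; contracting with the metric
  removes the inverse and leaves first derivatives of \<open>g\<close>.\<close>

lemma lower:
  assumes "z \<in> D"
  shows "(\<Sum>i\<in>UNIV. g a i z * (1/2 * (\<Sum>m\<in>UNIV. gi i m z * T m))) = 1/2 * T a"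
proof -
  have "(\<Sum>i\<in>UNIV. g a i z * (1/2 * (\<Sum>m\<in>UNIV. gi i m z * T m)))
      = (\<Sum>i\<in>UNIV. \<Sum>m\<in>UNIV. 1/2 * (g a i z * gi i m z) * T m)"
    by (simp add: sum_distrib_left ac_simps)
  also have "\<dots> = (\<Sum>m\<in>UNIV. 1/2 * (\<Sum>i\<in>UNIV. g a i z * gi i m z) * T m)"
    by (subst sum.swap) (simp add: sum_distrib_left sum_distrib_right)
  also have "\<dots> = (\<Sum>m\<in>UNIV. 1/2 * (if a = m then T m else 0))"
    by (intro sum.cong) (auto simp: g_gi[OF assms])
  also have "\<dots> = 1/2 * T a" unfolding sum_distrib_left[symmetric] by simp
  finally show ?thesis .
qed

text \<open>Nondegeneracy of the metric. Identities between coefficients are verified with the index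
  lowered, so that no derivative of the inverse metric is ever computed.\<close>

lemma cancel_g:
  assumes z: "z \<in> D" and eq: "\<And>a. (\<Sum>i\<in>UNIV. g a i z * u i) = (\<Sum>i\<in>UNIV. g a i z * w i)"
  shows "u j = w j"
proof -
  have "(\<Sum>a\<in>UNIV. gi j a z * (\<Sum>i\<in>UNIV. g a i z * u i)) = u j" for u
  proof -
    have "(\<Sum>a\<in>UNIV. gi j a z * (\<Sum>i\<in>UNIV. g a i z * u i)) = (\<Sum>i\<in>UNIV. (\<Sum>a\<in>UNIV. gi j a z * g a i z) * u i)"
      unfolding sum_distrib_left sum_distrib_right by (subst sum.swap) (simp add: ac_simps)
    also have "\<dots> = (\<Sum>i\<in>UNIV. if j = i then u i else 0)"
      by (intro sum.cong) (auto simp: gi_g[OF z])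
    finally show ?thesis by simp
  qed
  from this[of u] this[of w] show ?thesis unfolding eq by simp
qed

lemma uncurried_partial_x: "smooth_on D (uncurried u) \<Longrightarrow> z \<in> D \<Longrightarrow> partial_x i u (fst z) (snd z) = dirD (uncurried u) (X i) z"
  using partial_x_eq by (simp add: uncurried_def)

lemma uncurried_partial_y: "smooth_on D (uncurried u) \<Longrightarrow> z \<in> D \<Longrightarrow> partial_y i u (fst z) (snd z) = dirD (uncurried u) (Y i) z"
  using partial_y_eq by (simp add: uncurried_def)

lemma partial_g: "z \<in> D \<Longrightarrow> partial_x a (fund_g f b c) (fst z) (snd z) = dirD (g b c) (X a) z"
  "z \<in> D \<Longrightarrow> partial_y a (fund_g f b c) (fst z) (snd z) = dirD (g b c) (Y a) z"
  using uncurried_partial_x[OF smooth_g[unfolded g_def]] uncurried_partial_y[OF smooth_g[unfolded g_def]] by (simp_all add: g_def)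

lemma christoffel_eq: "z \<in> D \<Longrightarrow> uncurried (christoffel f i j k) z = 1/2 * (\<Sum>m\<in>UNIV. gi i m z *
     (dirD (g m k) (X j) z + dirD (g j m) (X k) z - dirD (g j k) (X m) z))"
  by (simp add: uncurried_def[of "christoffel f i j k"] christoffel_def partial_g) (simp add: gi_def uncurried_def)

lemma smooth_christoffel: "smooth_on D (uncurried (christoffel f i j k))"
  by (rule smooth_on_cong[OF open_D christoffel_eq[symmetric]]) (assumption | intro smooth_intros smooth_g smooth_gi)+

lemma smooth_G2: "smooth_on D (G2 i)"
  unfolding G2_def[abs_def] by (intro smooth_intros smooth_christoffel)

lemma G2_uncurried: "G2 i = uncurried (\<lambda>x y. \<Sum>k\<in>UNIV. \<Sum>l\<in>UNIV. christoffel f i k l x y * y $ k * y $ l)"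
  by (simp add: G2_def[abs_def] uncurried_simps)

lemma N_eq: "z \<in> D \<Longrightarrow> N i j z = 1/2 * dirD (G2 i) (Y j) z"
  using uncurried_partial_y[of "\<lambda>x y. \<Sum>k\<in>UNIV. \<Sum>l\<in>UNIV. christoffel f i k l x y * y $ k * y $ l" z j] smooth_G2[of i]
  unfolding G2_uncurried by (simp add: N_def nonlin_N_def uncurried_def[of "nonlin_N f i j"])

lemma smooth_N: "smooth_on D (N i j)"
  by (rule smooth_on_cong[OF open_D N_eq[symmetric]]) (assumption | intro smooth_intros smooth_G2)+

text \<open>Written as one derivative in the horizontal direction (e_k, -N_k), so that the product
  and congruence rules for \<open>dirD\<close> apply to it directly; \<open>del_eq\<close> recovers
  the usual expression.\<close>

definition "del k (u :: (real^'n) \<times> (real^'n) \<Rightarrow> real) z = dirD u (axis k 1, - (\<chi> j. N j k z)) z"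

lemma del_eq: 
  assumes "smooth_on D u" "z \<in> D"
  shows "del k u z = dirD u (X k) z - (\<Sum>j\<in>UNIV. N j k z * dirD u (Y j) z)"
  by (simp add: del_def dirD_Pair[OF assms] axis_def if_distrib if_distribR sum.delta' sum_negf cong: if_cong)

lemma uncurried_delta_x:
  assumes "smooth_on D (uncurried u)" "z \<in> D"
  shows "delta_x f k u (fst z) (snd z) = del k (uncurried u) z"
  using assms by (simp add: delta_x_def del_eq uncurried_partial_x uncurried_partial_y) (simp add: N_def uncurried_def)

lemma smooth_del:
  assumes u: "smooth_on D u"
  shows "smooth_on D (del k u)"
  by (rule smooth_on_cong[OF open_D del_eq[OF u, symmetric]]) (assumption | intro smooth_intros smooth_N u)+

lemma delta_g: "z \<in> D \<Longrightarrow> delta_x f a (fund_g f b c) (fst z) (snd z) = del a (g b c) z"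
  using uncurried_delta_x[OF smooth_g[unfolded g_def]] by (simp add: g_def)

lemma L_eq: "z \<in> D \<Longrightarrow> L i j k z = 1/2 * (\<Sum>m\<in>UNIV. gi i m z *
     (del j (g m k) z + del k (g j m) z - del m (g j k) z))"
  by (simp add: L_def uncurried_def[of "cartan_L f i j k"] cartan_L_def delta_g) (simp add: gi_def uncurried_def)

lemma smooth_L: "smooth_on D (L i j k)"
  by (rule smooth_on_cong[OF open_D L_eq[symmetric]]) (assumption | intro smooth_intros smooth_g smooth_gi smooth_del)+

lemma C_eq: "z \<in> D \<Longrightarrow> C i j k z = 1/2 * (\<Sum>m\<in>UNIV. gi i m z * dirD (g m j) (Y k) z)"
  by (simp add: C_def uncurried_def[of "cartan_C f i j k"] cartan_C_def partial_g) (simp add: gi_def uncurried_def)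

lemma curv_h_eq: "z \<in> D \<Longrightarrow> uncurried (curv_h f i h j k) z = del k (L i h j) z - del j (L i h k) z
     + (\<Sum>s\<in>UNIV. L s h j z * L i s k z) - (\<Sum>s\<in>UNIV. L s h k z * L i s j z)
     + (\<Sum>s\<in>UNIV. C i h s z * uncurried (curv_N f s j k) z)"
  using uncurried_delta_x[OF smooth_L[unfolded L_def]]
  by (simp add: uncurried_def[of "curv_h f i h j k"] curv_h_def L_def[symmetric]) (simp add: L_def C_def uncurried_def)

end


section \<open>Identities of the Cartan connection\<close>

context local_finsler
begin

abbreviation "y z k \<equiv> snd z $ k"

section \<open>Euler relations for Q and the metric\<close>

lemma sum_XY [simp]: "(\<Sum>k\<in>UNIV. snd (Y i) $ k * t k) = t i" "(\<Sum>k\<in>UNIV. snd (X i) $ k * t k) = 0" for t :: "'n \<Rightarrow> real"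
  by (simp_all add: X_def Y_def axis_def if_distrib if_distribR sum.delta' cong: if_cong)

lemma dirD_snd: "dirD (\<lambda>z. y z k) v z = snd v $ k"
  by (rule dirD_eq[OF bounded_linear_imp_has_derivative[OF bounded_linear_compose[OF bounded_linear_vec_nth bounded_linear_snd]]])

lemma dirD_ysum:
  assumes "\<And>k. smooth_on D (u k)" "z \<in> D"
  shows "dirD (\<lambda>z. \<Sum>k\<in>UNIV. y z k * u k z) v z
    = (\<Sum>k\<in>UNIV. snd v $ k * u k z) + (\<Sum>k\<in>UNIV. y z k * dirD (u k) v z)"
proof -
  have "dirD (\<lambda>z. \<Sum>k\<in>UNIV. y z k * u k z) v z = (\<Sum>k\<in>UNIV. dirD (\<lambda>z. y z k * u k z) v z)"
    by (rule dirD_sum_smooth) (auto intro!: smooth_intros assms)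
  also have "\<dots> = (\<Sum>k\<in>UNIV. y z k * dirD (u k) v z + snd v $ k * u k z)"
    by (simp add: dirD_mult_smooth[OF smooth_snd assms(1,2)] dirD_snd)
  finally show ?thesis by (simp add: sum.distrib)
qed

lemma dirD_congD: "z \<in> D \<Longrightarrow> (\<And>z. z \<in> D \<Longrightarrow> u z = w z) \<Longrightarrow> dirD u v z = dirD w v z"
  by (rule dirD_cong[OF open_D])

text \<open>Euler's relation in degree 2: on the ray in direction (0, y) the function Q equals (1 +
  h)^2 Q(z). The relations for its derivatives follow by differentiating this one.\<close>

lemma y_q: assumes "z \<in> D" shows "(\<Sum>k\<in>UNIV. y z k * q k z) = 2 * Q z"
proof -
  have "Q (z + h *\<^sub>R (0, snd z)) = (1 + h)\<^sup>2 * Q z" for h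
  proof -
    have "f (fst z) (snd z + h *\<^sub>R snd z) = \<bar>1 + h\<bar> * f (fst z) (snd z)"
      using hom_f[of "fst z" "1 + h" "snd z"] assms by (auto simp: scaleR_add_left)
    then show ?thesis by (simp add: Q_def uncurried_def power_mult_distrib)
  qed
  then have "dirD Q (0, snd z) z = deriv (\<lambda>h. (1 + h)\<^sup>2 * Q z) 0"
    using deriv_line[OF smooth_Q assms, of "(0, snd z)"] by simp
  also have "\<dots> = 2 * Q z"
    by (rule DERIV_imp_deriv) (auto intro!: derivative_eq_intros)
  finally show ?thesis by (simp add: dirD_Pair[OF smooth_Q assms] q_def)
qed

lemma dirD_q: "z \<in> D \<Longrightarrow> dirD (q k) (Y i) z = 2 * g i k z"
  by (simp add: g_eq)

lemma y_g: assumes "z \<in> D" shows "(\<Sum>k\<in>UNIV. y z k * g i k z) = 1/2 * q i z"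
proof -
  have "dirD (\<lambda>z. \<Sum>k\<in>UNIV. y z k * q k z) (Y i) z = dirD (\<lambda>z. 2 * Q z) (Y i) z"
    by (rule dirD_congD[OF assms y_q])
  then have "q i z + (\<Sum>k\<in>UNIV. y z k * (2 * g i k z)) = 2 * q i z"
    unfolding dirD_ysum[OF smooth_q assms] dirD_cmult_smooth[OF smooth_Q assms] sum_XY dirD_q[OF assms] q_def[symmetric] .
  moreover have "(\<Sum>k\<in>UNIV. y z k * (2 * g i k z)) = 2 * (\<Sum>k\<in>UNIV. y z k * g i k z)"
    by (simp add: sum_distrib_left ac_simps)
  ultimately show ?thesis by simp
qed

lemma dirD_g_sym: "z \<in> D \<Longrightarrow> dirD (g i j) v z = dirD (g j i) v z"
  by (rule dirD_congD[OF _ g_sym])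

text \<open>Up to a factor 1/2 these are third y-derivatives of Q, hence symmetric in all indices
  (the Cartan tensor).\<close>

lemma dirD_g_YY: "z \<in> D \<Longrightarrow> dirD (g i k) (Y m) z = dirD (g m k) (Y i) z"
proof -
  assume z: "z \<in> D"
  have "dirD (g i k) (Y m) z = 1/2 * dirD (dirD (q k) (Y i)) (Y m) z" for i m
  proof -
    have "dirD (g i k) (Y m) z = dirD (\<lambda>z. 1/2 * dirD (q k) (Y i) z) (Y m) z"
      by (rule dirD_congD[OF z g_eq])
    also have "\<dots> = 1/2 * dirD (dirD (q k) (Y i)) (Y m) z"
      by (rule dirD_cmult_smooth[OF smooth_on_dirD[OF smooth_q] z])
    finally show ?thesis .
  qed
  from this[of i m] this[of m i] show ?thesis using dirD_commute[OF smooth_q open_D z, of k "Y i" "Y m"] by simp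
qed

text \<open>Euler's relation in degree 0: differentiating \<open>y_g\<close> produces g_im on both
  sides, which cancels.\<close>

lemma y_dirD_g_Y: assumes "z \<in> D" shows "(\<Sum>k\<in>UNIV. y z k * dirD (g i k) (Y m) z) = 0"
proof -
  have "dirD (\<lambda>z. \<Sum>k\<in>UNIV. y z k * g i k z) (Y m) z = dirD (\<lambda>z. 1/2 * q i z) (Y m) z"
    by (rule dirD_congD[OF assms y_g])
  then have "g i m z + (\<Sum>k\<in>UNIV. y z k * dirD (g i k) (Y m) z) = g m i z"
    unfolding dirD_cmult_smooth[OF smooth_q assms] dirD_ysum[OF smooth_g assms] sum_XY dirD_q[OF assms] by simp
  then show ?thesis using g_sym[OF assms, of i m] by simp
qed

lemma y_dirD_g_X: assumes "z \<in> D" shows "(\<Sum>k\<in>UNIV. y z k * dirD (g i k) (X m) z) = 1/2 * dirD (q i) (X m) z"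
proof -
  have "dirD (\<lambda>z. \<Sum>k\<in>UNIV. y z k * g i k z) (X m) z = dirD (\<lambda>z. 1/2 * q i z) (X m) z"
    by (rule dirD_congD[OF assms y_g])
  then show ?thesis unfolding dirD_cmult_smooth[OF smooth_q assms] dirD_ysum[OF smooth_g assms] sum_XY by simp
qed

lemma y_dirD_q_X: assumes "z \<in> D" shows "(\<Sum>k\<in>UNIV. y z k * dirD (q k) (X m) z) = 2 * dirD Q (X m) z"
proof -
  have "dirD (\<lambda>z. \<Sum>k\<in>UNIV. y z k * q k z) (X m) z = dirD (\<lambda>z. 2 * Q z) (X m) z"
    by (rule dirD_congD[OF assms y_q])
  then show ?thesis unfolding dirD_cmult_smooth[OF smooth_Q assms] dirD_ysum[OF smooth_q assms] sum_XY by simp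
qed

text \<open>Twice the right side is the acceleration-free part of the Euler-Lagrange expression of
  Q, so G2 is the spray of F^2. The first two Christoffel terms contribute equally by symmetry of
  \<open>g\<close>, and the third collapses by Euler's relation.\<close>

lemma G2_low:
  assumes z: "z \<in> D"
  shows "(\<Sum>i\<in>UNIV. g a i z * G2 i z) = 1/2 * (\<Sum>k\<in>UNIV. y z k * dirD (q a) (X k) z) - 1/2 * dirD Q (X a) z"
proof -
  let ?G = "\<lambda>i k l. uncurried (christoffel f i k l) z"
  have "(\<Sum>i\<in>UNIV. g a i z * G2 i z) = (\<Sum>i\<in>UNIV. \<Sum>k\<in>UNIV. \<Sum>l\<in>UNIV. y z k * y z l * (g a i z * ?G i k l))"
    by (simp add: G2_def sum_distrib_left ac_simps)
  also have "\<dots> = (\<Sum>k\<in>UNIV. \<Sum>i\<in>UNIV. \<Sum>l\<in>UNIV. y z k * y z l * (g a i z * ?G i k l))"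
    by (rule sum.swap)
  also have "\<dots> = (\<Sum>k\<in>UNIV. \<Sum>l\<in>UNIV. y z k * y z l * (\<Sum>i\<in>UNIV. g a i z * ?G i k l))"
    unfolding sum_distrib_left by (intro sum.cong refl sum.swap)
  also have "\<dots> = (\<Sum>k\<in>UNIV. \<Sum>l\<in>UNIV. y z k * y z l *
      (1/2 * (dirD (g a l) (X k) z + dirD (g k a) (X l) z - dirD (g k l) (X a) z)))"
    unfolding christoffel_eq[OF z] lower[OF z] ..
  also have "\<dots> = 1/2 * (\<Sum>k\<in>UNIV. y z k * (\<Sum>l\<in>UNIV. y z l * dirD (g a l) (X k) z))
     + 1/2 * (\<Sum>k\<in>UNIV. \<Sum>l\<in>UNIV. y z l * (y z k * dirD (g k a) (X l) z))
     - 1/2 * (\<Sum>k\<in>UNIV. y z k * (\<Sum>l\<in>UNIV. y z l * dirD (g k l) (X a) z))"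
    by (simp add: sum_distrib_left sum.distrib sum_subtractf algebra_simps)
  also have "(\<Sum>k\<in>UNIV. \<Sum>l\<in>UNIV. y z l * (y z k * dirD (g k a) (X l) z))
     = (\<Sum>l\<in>UNIV. y z l * (\<Sum>k\<in>UNIV. y z k * dirD (g a k) (X l) z))"
    unfolding sum_distrib_left by (subst sum.swap) (simp add: dirD_g_sym[OF z, of _ a])
  also have "(\<Sum>k\<in>UNIV. y z k * (\<Sum>l\<in>UNIV. y z l * dirD (g k l) (X a) z)) = dirD Q (X a) z"
    using y_dirD_q_X[OF z, of a] by (simp add: y_dirD_g_X[OF z] flip: sum_distrib_left sum_divide_distrib)
  finally show ?thesis by (simp add: y_dirD_g_X[OF z] flip: sum_divide_distrib)
qed

section \<open>Connection coefficients and curvature contracted with the velocity\<close>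

lemma dirD_q_XY: "z \<in> D \<Longrightarrow> dirD (dirD (q a) (X k)) (Y j) z = 2 * dirD (g j a) (X k) z"
proof -
  assume z: "z \<in> D"
  have "dirD (dirD (q a) (X k)) (Y j) z = dirD (dirD (q a) (Y j)) (X k) z"
    by (rule dirD_commute[OF smooth_q open_D z])
  also have "\<dots> = dirD (\<lambda>z. 2 * g j a z) (X k) z"
    by (rule dirD_congD[OF z dirD_q])
  finally show ?thesis by (simp add: dirD_cmult_smooth[OF smooth_g z])
qed

text \<open>\<open>G2_low\<close> differentiated in y^j. The last term is what the product rule
  leaves when the derivative falls on the metric.\<close>

lemma N_low:
  assumes z: "z \<in> D"
  shows "(\<Sum>i\<in>UNIV. g a i z * N i j z) = 1/2 * (\<Sum>k\<in>UNIV. y z k * dirD (g j a) (X k) z)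
    + 1/4 * dirD (q a) (X j) z - 1/4 * dirD (q j) (X a) z - 1/2 * (\<Sum>i\<in>UNIV. G2 i z * dirD (g a i) (Y j) z)"
proof -
  have "dirD (\<lambda>z. \<Sum>i\<in>UNIV. g a i z * G2 i z) (Y j) z =
     dirD (\<lambda>z. 1/2 * (\<Sum>k\<in>UNIV. y z k * dirD (q a) (X k) z) - 1/2 * dirD Q (X a) z) (Y j) z"
    by (rule dirD_congD[OF z G2_low])
  also have "\<dots> = dirD (\<lambda>z. 1/2 * (\<Sum>k\<in>UNIV. y z k * dirD (q a) (X k) z)) (Y j) z - dirD (\<lambda>z. 1/2 * dirD Q (X a) z) (Y j) z"
    by (intro dirD_diff_smooth[OF _ _ z] smooth_intros smooth_q smooth_Q)
  also have "dirD (\<lambda>z. 1/2 * dirD Q (X a) z) (Y j) z = 1/2 * dirD (q j) (X a) z"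
    by (subst dirD_cmult_smooth[OF _ z]) (simp_all add: smooth_Q smooth_on_dirD dirD_commute[OF smooth_Q open_D z, of "X a"] q_def)
  also have "dirD (\<lambda>z. 1/2 * (\<Sum>k\<in>UNIV. y z k * dirD (q a) (X k) z)) (Y j) z
      = 1/2 * dirD (\<lambda>z. \<Sum>k\<in>UNIV. y z k * dirD (q a) (X k) z) (Y j) z"
    by (intro dirD_cmult_smooth[OF _ z] smooth_intros smooth_q)
  also have "dirD (\<lambda>z. \<Sum>k\<in>UNIV. y z k * dirD (q a) (X k) z) (Y j) z
      = dirD (q a) (X j) z + 2 * (\<Sum>k\<in>UNIV. y z k * dirD (g j a) (X k) z)"
    by (subst dirD_ysum[OF smooth_on_dirD[OF smooth_q] z]) (simp add: dirD_q_XY[OF z] sum_distrib_left ac_simps)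
  also have "dirD (\<lambda>z. \<Sum>i\<in>UNIV. g a i z * G2 i z) (Y j) z = (\<Sum>i\<in>UNIV. dirD (\<lambda>z. g a i z * G2 i z) (Y j) z)"
    by (rule dirD_sum_smooth[OF _ z]) (intro smooth_intros smooth_g smooth_G2)
  also have "\<dots> = 2 * (\<Sum>i\<in>UNIV. g a i z * N i j z) + (\<Sum>i\<in>UNIV. G2 i z * dirD (g a i) (Y j) z)"
    unfolding dirD_mult_smooth[OF smooth_g smooth_G2 z] N_eq[OF z] sum.distrib sum_distrib_left
    by (simp add: mult.commute)
  finally show ?thesis by (simp add: field_simps)
qed

text \<open>Euler's relation for G2, which has degree 2 in y. In lowered form the last term of
  \<open>N_low\<close> drops out by homogeneity, and the remaining terms recombine to
  \<open>G2_low\<close>.\<close>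

lemma N_y:
  assumes z: "z \<in> D"
  shows "(\<Sum>j\<in>UNIV. y z j * N i j z) = G2 i z"
proof (rule cancel_g[OF z, where j = i and u = "\<lambda>i. \<Sum>j\<in>UNIV. y z j * N i j z" and w = "\<lambda>i. G2 i z"])
  fix a
  have "(\<Sum>i\<in>UNIV. g a i z * (\<Sum>j\<in>UNIV. y z j * N i j z)) = (\<Sum>i\<in>UNIV. \<Sum>j\<in>UNIV. y z j * (g a i z * N i j z))"
    by (simp add: sum_distrib_left ac_simps)
  also have "\<dots> = (\<Sum>j\<in>UNIV. y z j * (\<Sum>i\<in>UNIV. g a i z * N i j z))"
    unfolding sum_distrib_left by (rule sum.swap)
  also have "\<dots> = (\<Sum>j\<in>UNIV. \<Sum>k\<in>UNIV. 1/2 * (y z j * (y z k * dirD (g j a) (X k) z)))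
     + (\<Sum>j\<in>UNIV. 1/4 * (y z j * dirD (q a) (X j) z)) - (\<Sum>j\<in>UNIV. 1/4 * (y z j * dirD (q j) (X a) z))
     - (\<Sum>j\<in>UNIV. \<Sum>i\<in>UNIV. 1/2 * (y z j * (G2 i z * dirD (g a i) (Y j) z)))"
    unfolding N_low[OF z] by (simp add: sum_distrib_left sum.distrib sum_subtractf algebra_simps)
  also have "(\<Sum>j\<in>UNIV. \<Sum>k\<in>UNIV. 1/2 * (y z j * (y z k * dirD (g j a) (X k) z)))
     = 1/2 * (\<Sum>k\<in>UNIV. y z k * (\<Sum>j\<in>UNIV. y z j * dirD (g a j) (X k) z))"
    unfolding sum_distrib_left by (subst sum.swap) (simp add: dirD_g_sym[OF z, of _ a] ac_simps)
  also have "(\<Sum>j\<in>UNIV. \<Sum>i\<in>UNIV. 1/2 * (y z j * (G2 i z * dirD (g a i) (Y j) z)))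
     = 1/2 * (\<Sum>i\<in>UNIV. G2 i z * (\<Sum>j\<in>UNIV. y z j * dirD (g a i) (Y j) z))"
    unfolding sum_distrib_left by (subst sum.swap) (simp add: ac_simps)
  also have "(\<lambda>i. \<Sum>j\<in>UNIV. y z j * dirD (g a i) (Y j) z) = (\<lambda>i. 0)"
    using y_dirD_g_Y[OF z] dirD_g_YY[OF z] dirD_g_sym[OF z] by (metis (no_types, lifting) sum.cong)
  finally show "(\<Sum>i\<in>UNIV. g a i z * (\<Sum>j\<in>UNIV. y z j * N i j z)) = (\<Sum>i\<in>UNIV. g a i z * G2 i z)"
    using y_dirD_q_X[OF z, of a]
    by (simp add: y_dirD_g_X[OF z] G2_low[OF z] flip: sum_distrib_left sum_divide_distrib)
qed

text \<open>The contraction is the geodesic spray as a vector field, that is, the time derivative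
  along geodesics.\<close>

lemma y_del:
  assumes u: "smooth_on D u" and z: "z \<in> D"
  shows "(\<Sum>k\<in>UNIV. y z k * del k u z) = (\<Sum>k\<in>UNIV. y z k * dirD u (X k) z) - (\<Sum>m\<in>UNIV. G2 m z * dirD u (Y m) z)"
proof -
  have "(\<Sum>k\<in>UNIV. \<Sum>m\<in>UNIV. y z k * (N m k z * dirD u (Y m) z)) = (\<Sum>m\<in>UNIV. (\<Sum>k\<in>UNIV. y z k * N m k z) * dirD u (Y m) z)"
    unfolding sum_distrib_right by (subst sum.swap) (simp add: ac_simps)
  then show ?thesis by (simp add: del_eq[OF u z] N_y[OF z] right_diff_distrib sum_subtractf sum_distrib_left)
qed

lemma y_del_g:
  assumes z: "z \<in> D"
  shows "(\<Sum>k\<in>UNIV. y z k * del j (g a k) z) = 1/2 * dirD (q a) (X j) z"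
proof -
  have "(\<Sum>k\<in>UNIV. \<Sum>m\<in>UNIV. y z k * (N m j z * dirD (g a k) (Y m) z)) = (\<Sum>m\<in>UNIV. N m j z * (\<Sum>k\<in>UNIV. y z k * dirD (g a k) (Y m) z))"
    unfolding sum_distrib_left by (subst sum.swap) (simp add: ac_simps)
  then show ?thesis
    by (simp add: del_eq[OF smooth_g z] y_dirD_g_X[OF z] y_dirD_g_Y[OF z] right_diff_distrib sum_subtractf sum_distrib_left)
qed

lemma del_g_sym: "z \<in> D \<Longrightarrow> del k (g i j) z = del k (g j i) z"
  unfolding del_def by (rule dirD_g_sym)

lemma L_sym: assumes z: "z \<in> D" shows "L i j k z = L i k j z"
proof -
  have "del j (g m k) z + del k (g j m) z - del m (g j k) z = del k (g m j) z + del j (g k m) z - del m (g k j) z" for m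
    using del_g_sym[OF z, of j m k] del_g_sym[OF z, of k j m] del_g_sym[OF z, of m j k] by linarith
  then show ?thesis by (simp only: L_eq[OF z])
qed

text \<open>The lowered left side splits into three contracted derivatives of \<open>g\<close>: the
  outer two reduce by \<open>y_del_g\<close>, the middle one is a spray derivative by
  \<open>y_del\<close>, and together they are the right side of \<open>N_low\<close>.\<close>

lemma L_y:
  assumes z: "z \<in> D"
  shows "(\<Sum>k\<in>UNIV. y z k * L i j k z) = N i j z"
proof (rule cancel_g[OF z, where j = i and u = "\<lambda>i. \<Sum>k\<in>UNIV. y z k * L i j k z" and w = "\<lambda>i. N i j z"])
  fix a
  have "(\<Sum>i\<in>UNIV. g a i z * (\<Sum>k\<in>UNIV. y z k * L i j k z)) = (\<Sum>i\<in>UNIV. \<Sum>k\<in>UNIV. y z k * (g a i z * L i j k z))"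
    by (simp add: sum_distrib_left ac_simps)
  also have "\<dots> = (\<Sum>k\<in>UNIV. y z k * (\<Sum>i\<in>UNIV. g a i z * L i j k z))"
    unfolding sum_distrib_left by (rule sum.swap)
  also have "\<dots> = (\<Sum>k\<in>UNIV. y z k * (1/2 * (del j (g a k) z + del k (g j a) z - del a (g j k) z)))"
    unfolding L_eq[OF z] lower[OF z] ..
  also have "\<dots> = (\<Sum>k\<in>UNIV. 1/2 * (y z k * del j (g a k) z + y z k * del k (g j a) z - y z k * del a (g j k) z))"
    by (simp add: algebra_simps)
  also have "\<dots> = 1/2 * ((\<Sum>k\<in>UNIV. y z k * del j (g a k) z) + (\<Sum>k\<in>UNIV. y z k * del k (g j a) z)
      - (\<Sum>k\<in>UNIV. y z k * del a (g j k) z))"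
    by (simp only: sum_distrib_left[symmetric] sum_subtractf sum.distrib)
  also have "\<dots> = (\<Sum>i\<in>UNIV. g a i z * N i j z)"
    unfolding y_del_g[OF z] y_del[OF smooth_g z] N_low[OF z] dirD_g_sym[OF z, of a] dirD_g_YY[OF z, of _ a j]
    by (simp add: field_simps)
  finally show "(\<Sum>i\<in>UNIV. g a i z * (\<Sum>k\<in>UNIV. y z k * L i j k z)) = (\<Sum>i\<in>UNIV. g a i z * N i j z)" .
qed

lemma C_y:
  assumes z: "z \<in> D"
  shows "(\<Sum>j\<in>UNIV. y z j * C i j k z) = 0"
proof -
  have "(\<Sum>j\<in>UNIV. y z j * C i j k z) = (\<Sum>m\<in>UNIV. 1/2 * gi i m z * (\<Sum>j\<in>UNIV. y z j * dirD (g m j) (Y k) z))"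
    unfolding C_eq[OF z] sum_distrib_left by (subst sum.swap) (simp add: ac_simps)
  then show ?thesis by (simp add: y_dirD_g_Y[OF z])
qed

text \<open>The horizontal derivative of y^h is -N^h_k, so differentiating the contraction of L with
  y produces the correction term.\<close>

lemma y_del_L:
  assumes z: "z \<in> D"
  shows "(\<Sum>h\<in>UNIV. y z h * del k (L i h j) z) = del k (N i j) z + (\<Sum>h\<in>UNIV. N h k z * L i h j z)"
proof -
  have "(\<Sum>h\<in>UNIV. y z h * L i h j z) = N i j z" if "z \<in> D" for z
    using L_y[OF that, of i j] L_sym[OF that, of i j] by simp
  from dirD_congD[OF z this] have "del k (\<lambda>z. \<Sum>h\<in>UNIV. y z h * L i h j z) z = del k (N i j) z"
    unfolding del_def .
  then show ?thesis
    unfolding del_def by (simp add: dirD_ysum[OF smooth_L z] sum_negf)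
qed

text \<open>The same device for \<open>N_y\<close>. The vertical derivatives of G2 are 2 N, and one
  of the two resulting products N N cancels against the term from differentiating y.\<close>

lemma y_del_N:
  assumes z: "z \<in> D"
  shows "(\<Sum>j\<in>UNIV. y z j * del k (N i j) z) = dirD (G2 i) (X k) z - (\<Sum>s\<in>UNIV. N i s z * N s k z)"
proof -
  from dirD_congD[OF z N_y] have "del k (\<lambda>z. \<Sum>j\<in>UNIV. y z j * N i j z) z = del k (G2 i) z"
    unfolding del_def .
  moreover have "del k (\<lambda>z. \<Sum>j\<in>UNIV. y z j * N i j z) z = (\<Sum>j\<in>UNIV. y z j * del k (N i j) z) - (\<Sum>s\<in>UNIV. N i s z * N s k z)"
    unfolding del_def by (simp add: dirD_ysum[OF smooth_N z] sum_negf ac_simps)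
  moreover have "del k (G2 i) z = dirD (G2 i) (X k) z - 2 * (\<Sum>s\<in>UNIV. N i s z * N s k z)"
    by (simp add: del_eq[OF smooth_G2 z] N_eq[OF z, of i] sum_distrib_left ac_simps)
  ultimately show ?thesis by simp
qed

text \<open>Two contractions with the velocity bring the curvature to the form in which it arises
  when the geodesic equation is linearised: only G2, N and their first derivatives remain.\<close>

lemma curv_h_yy:
  assumes z: "z \<in> D"
  shows "(\<Sum>h\<in>UNIV. \<Sum>j\<in>UNIV. uncurried (curv_h f i h j k) z * y z h * y z j) =
    dirD (G2 i) (X k) z - (\<Sum>s\<in>UNIV. N i s z * N s k z)
    - (\<Sum>j\<in>UNIV. y z j * dirD (N i k) (X j) z) + (\<Sum>s\<in>UNIV. G2 s z * dirD (N i k) (Y s) z)"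
proof -
  have L': "(\<Sum>h\<in>UNIV. y z h * L s h j z) = N s j z" for s j
    using L_y[OF z, of s j] L_sym[OF z, of s j] by simp
  have LL: "(\<Sum>h\<in>UNIV. y z h * (\<Sum>s\<in>UNIV. L s h j z * L i s k z)) = (\<Sum>s\<in>UNIV. N s j z * L i s k z)" for j k
  proof -
    have "(\<Sum>h\<in>UNIV. y z h * (\<Sum>s\<in>UNIV. L s h j z * L i s k z)) = (\<Sum>s\<in>UNIV. (\<Sum>h\<in>UNIV. y z h * L s h j z) * L i s k z)"
      unfolding sum_distrib_left sum_distrib_right by (subst sum.swap) (simp add: ac_simps)
    then show ?thesis by (simp add: L')
  qed
  have CC: "(\<Sum>h\<in>UNIV. y z h * (\<Sum>s\<in>UNIV. C i h s z * uncurried (curv_N f s j k) z)) = 0" for j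
  proof -
    have "(\<Sum>h\<in>UNIV. y z h * (\<Sum>s\<in>UNIV. C i h s z * uncurried (curv_N f s j k) z)) = (\<Sum>s\<in>UNIV. (\<Sum>h\<in>UNIV. y z h * C i h s z) * uncurried (curv_N f s j k) z)"
      unfolding sum_distrib_left sum_distrib_right by (subst sum.swap) (simp add: ac_simps)
    then show ?thesis by (simp add: C_y[OF z])
  qed
  \<comment> \<open>The N L terms from \<open>y_del_L\<close> cancel the contracted products of L,
    and the C term vanishes by homogeneity.\<close>
  have h: "(\<Sum>h\<in>UNIV. y z h * uncurried (curv_h f i h j k) z) = del k (N i j) z - del j (N i k) z" for j
    unfolding curv_h_eq[OF z]
    by (simp add: distrib_left right_diff_distrib sum.distrib sum_subtractf LL CC y_del_L[OF z])
  have "(\<Sum>h\<in>UNIV. \<Sum>j\<in>UNIV. uncurried (curv_h f i h j k) z * y z h * y z j)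
      = (\<Sum>j\<in>UNIV. y z j * (\<Sum>h\<in>UNIV. y z h * uncurried (curv_h f i h j k) z))"
    unfolding sum_distrib_left by (subst sum.swap) (simp add: ac_simps)
  also have "\<dots> = (\<Sum>j\<in>UNIV. y z j * del k (N i j) z) - (\<Sum>j\<in>UNIV. y z j * del j (N i k) z)"
    unfolding h by (simp add: right_diff_distrib sum_subtractf)
  finally show ?thesis by (simp add: y_del_N[OF z] y_del[OF smooth_N z])
qed

end


section \<open>Variations inside one chart\<close>

context local_finsler
begin

section \<open>The Lagrangian F^p and its Hessian\<close>

definition "Lag p z = Q z powr (p / 2)"
definition "Ly p i = dirD (Lag p) (Y i)"
definition "M p i j = dirD (Ly p i) (Y j)"

lemma smooth_Lag: "smooth_on D (Lag p)"
  unfolding Lag_def[abs_def] by (rule smooth_on_powr[OF open_D smooth_Q Q_pos])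

lemma smooth_Ly: "smooth_on D (Ly p i)"
  unfolding Ly_def by (rule smooth_on_dirD[OF smooth_Lag])

lemma smooth_M: "smooth_on D (M p i j)"
  unfolding M_def by (rule smooth_on_dirD[OF smooth_Ly])

lemma dirD_Lag: "z \<in> D \<Longrightarrow> dirD (Lag p) v z = p/2 * Q z powr (p/2 - 1) * dirD Q v z"
  unfolding Lag_def[abs_def] by (rule dirD_powr_smooth[OF smooth_Q _ Q_pos])

lemma dirD_Ly:
  assumes z: "z \<in> D"
  shows "dirD (Ly p i) v z = p/2 * Q z powr (p/2 - 1) * dirD (q i) v z
    + p/2 * (p/2 - 1) * Q z powr (p/2 - 2) * dirD Q v z * q i z"
proof -
  have P: "smooth_on D (\<lambda>z. Q z powr (p/2 - 1))"
    by (rule smooth_on_powr[OF open_D smooth_Q Q_pos])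
  have "dirD (Ly p i) v z = dirD (\<lambda>z. p/2 * (Q z powr (p/2 - 1) * q i z)) v z"
    by (rule dirD_congD[OF z]) (simp add: Ly_def dirD_Lag q_def)
  also have "\<dots> = p/2 * dirD (\<lambda>z. Q z powr (p/2 - 1) * q i z) v z"
    by (intro dirD_cmult_smooth[OF _ z] smooth_on_mult open_D P smooth_q)
  also have "dirD (\<lambda>z. Q z powr (p/2 - 1) * q i z) v z
     = Q z powr (p/2 - 1) * dirD (q i) v z + (p/2 - 1) * Q z powr (p/2 - 1 - 1) * dirD Q v z * q i z"
    by (subst dirD_mult_smooth[OF P smooth_q z]) (simp only: dirD_powr_smooth[OF smooth_Q z Q_pos[OF z]])
  finally show ?thesis by (simp add: algebra_simps)
qed

lemma M_eq: "z \<in> D \<Longrightarrow> M p i j z = p * Q z powr (p/2 - 1) * g i j z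
    + p/2 * (p/2 - 1) * Q z powr (p/2 - 2) * q j z * q i z"
  unfolding M_def dirD_Ly dirD_q q_def[symmetric] using g_sym[of z i j] by simp

text \<open>Energy conservation: the spray annihilates Q. It follows by contracting
  \<open>G2_low\<close> with y.\<close>

lemma y_dirD_Q_X:
  assumes z: "z \<in> D"
  shows "(\<Sum>k\<in>UNIV. y z k * dirD Q (X k) z) = (\<Sum>i\<in>UNIV. q i z * G2 i z)"
proof -
  have "1/2 * (\<Sum>i\<in>UNIV. q i z * G2 i z) = (\<Sum>i\<in>UNIV. (\<Sum>a\<in>UNIV. y z a * g i a z) * G2 i z)"
    unfolding y_g[OF z] sum_distrib_left by (simp add: mult.assoc)
  also have "\<dots> = (\<Sum>a\<in>UNIV. y z a * (\<Sum>i\<in>UNIV. g a i z * G2 i z))"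
    unfolding sum_distrib_left sum_distrib_right
    by (subst sum.swap, rule sum.cong[OF refl], rule sum.cong[OF refl], subst g_sym[OF z]) (simp add: mult.assoc)
  also have "\<dots> = (\<Sum>a\<in>UNIV. \<Sum>k\<in>UNIV. 1/2 * (y z k * (y z a * dirD (q a) (X k) z))) - (\<Sum>a\<in>UNIV. 1/2 * (y z a * dirD Q (X a) z))"
    unfolding G2_low[OF z] right_diff_distrib sum_subtractf sum_distrib_left by (simp add: mult.left_commute)
  also have "(\<Sum>a\<in>UNIV. \<Sum>k\<in>UNIV. 1/2 * (y z k * (y z a * dirD (q a) (X k) z)))
     = (\<Sum>k\<in>UNIV. 1/2 * (y z k * (\<Sum>a\<in>UNIV. y z a * dirD (q a) (X k) z)))"
    unfolding sum_distrib_left by (rule sum.swap)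
  also have "\<dots> = (\<Sum>k\<in>UNIV. y z k * dirD Q (X k) z)"
    unfolding y_dirD_q_X[OF z] by simp
  finally show ?thesis by (simp only: sum_distrib_left[symmetric])
qed

text \<open>The outer power p/2 adds a multiple of q_i times the contraction of y with the
  x-derivatives of Q. By \<open>y_dirD_Q_X\<close> this equals the rank-one part of the Hessian
  applied to G2, so the same G2 serves for every p.\<close>

lemma Euler_Lagrange_spray:
  assumes z: "z \<in> D"
  shows "(\<Sum>k\<in>UNIV. y z k * dirD (Ly p i) (X k) z) - dirD (Lag p) (X i) z = (\<Sum>j\<in>UNIV. M p i j z * G2 j z)"
proof -
  let ?a = "p/2 * Q z powr (p/2 - 1)" and ?b = "p/2 * (p/2 - 1) * Q z powr (p/2 - 2)"
  have "(\<Sum>k\<in>UNIV. y z k * dirD (Ly p i) (X k) z)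
     = (\<Sum>k\<in>UNIV. ?a * (y z k * dirD (q i) (X k) z) + ?b * q i z * (y z k * dirD Q (X k) z))"
    by (simp add: dirD_Ly[OF z] algebra_simps)
  also have "\<dots> = ?a * (\<Sum>k\<in>UNIV. y z k * dirD (q i) (X k) z) + ?b * q i z * (\<Sum>j\<in>UNIV. q j z * G2 j z)"
    by (simp only: sum_distrib_left[symmetric] sum.distrib y_dirD_Q_X[OF z])
  finally have 1: "(\<Sum>k\<in>UNIV. y z k * dirD (Ly p i) (X k) z) = \<dots>" .
  have "(\<Sum>j\<in>UNIV. M p i j z * G2 j z) = (\<Sum>j\<in>UNIV. 2 * ?a * (g i j z * G2 j z) + ?b * q i z * (q j z * G2 j z))"
    by (simp add: M_eq[OF z] algebra_simps)
  also have "\<dots> = 2 * ?a * (\<Sum>j\<in>UNIV. g i j z * G2 j z) + ?b * q i z * (\<Sum>j\<in>UNIV. q j z * G2 j z)"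
    by (simp only: sum_distrib_left[symmetric] sum.distrib)
  finally show ?thesis unfolding 1 G2_low[OF z] dirD_Lag[OF z] by (simp add: algebra_simps)
qed

text \<open>With Q = v^2 and q_i twice the lowered velocity, the two parts of \<open>M_eq\<close>
  acquire the coefficients p v^(p-2) and p (p-2) v^(p-4); taking out p v^(p-4) gives the vector that
  is paired with Y in the formula.\<close>

lemma M_contract:
  assumes z: "z \<in> D" and v: "Q z = v\<^sup>2" "v > 0"
  shows "(\<Sum>i\<in>UNIV. \<Sum>j\<in>UNIV. M p i j z * A j * B i) = p * v powr (p - 4) *
    (\<Sum>i\<in>UNIV. \<Sum>j\<in>UNIV. g i j z * B i * (v\<^sup>2 * A j + (p - 2) * (\<Sum>a\<in>UNIV. \<Sum>b\<in>UNIV. g a b z * A a * y z b) * y z j))"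
proof -
  have P: "Q z powr r = v powr (2 * r)" for r
    using v by (simp add: powr_powr[symmetric] powr_numeral del: powr_powr)
  have v4: "v powr (p - 4) * v\<^sup>2 = v powr (p - 2)"
    using v(2) powr_add[of v "p - 4" 2] by (simp add: powr_numeral)
  have q: "q i z = 2 * (\<Sum>b\<in>UNIV. g i b z * y z b)" for i
    using y_g[OF z, of i] by (simp add: mult.commute)
  have qA: "(\<Sum>a\<in>UNIV. \<Sum>b\<in>UNIV. g a b z * A a * y z b) = (\<Sum>j\<in>UNIV. 1/2 * (q j z * A j))" for A :: "'n \<Rightarrow> real"
    by (simp add: q sum_distrib_left sum_distrib_right ac_simps)
  have "(\<Sum>i\<in>UNIV. \<Sum>j\<in>UNIV. M p i j z * A j * B i) =
     (\<Sum>i\<in>UNIV. \<Sum>j\<in>UNIV. p * v powr (p - 2) * (g i j z * A j * B i) + p * (p - 2) * v powr (p - 4) * (1/2 * (q i z * B i) * (1/2 * (q j z * A j))))"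
    by (simp add: M_eq[OF z] P algebra_simps)
  also have "\<dots> = p * v powr (p - 2) * (\<Sum>i\<in>UNIV. \<Sum>j\<in>UNIV. g i j z * A j * B i)
     + p * (p - 2) * v powr (p - 4) * ((\<Sum>i\<in>UNIV. 1/2 * (q i z * B i)) * (\<Sum>j\<in>UNIV. 1/2 * (q j z * A j)))"
    unfolding sum_product sum.distrib unfolding sum_distrib_left ..
  also have "\<dots> = p * v powr (p - 4) * (v\<^sup>2 * (\<Sum>i\<in>UNIV. \<Sum>j\<in>UNIV. g i j z * A j * B i)
     + (p - 2) * (\<Sum>j\<in>UNIV. 1/2 * (q j z * A j)) * (\<Sum>i\<in>UNIV. \<Sum>j\<in>UNIV. g i j z * B i * y z j))"
    unfolding qA v4[symmetric] by (simp only: algebra_simps)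
  also have "\<dots> = p * v powr (p - 4) * (\<Sum>i\<in>UNIV. \<Sum>j\<in>UNIV. v\<^sup>2 * (g i j z * A j * B i)
     + (p - 2) * (\<Sum>j\<in>UNIV. 1/2 * (q j z * A j)) * (g i j z * B i * y z j))"
    by (simp only: sum.distrib sum_distrib_left)
  finally show ?thesis unfolding qA by (simp only: algebra_simps)
qed

text \<open>The covariant derivative of a field \<open>V\<close> at a point with position and velocity \<open>z\<close>, where \<open>y'\<close> and
  \<open>V'\<close> stand for the time derivatives of the velocity and of \<open>V\<close>.\<close>

definition "cov i z y' V V' = V' $ i + (\<Sum>m\<in>UNIV. V $ m *
  ((\<Sum>k\<in>UNIV. L i m k z * y z k) + (\<Sum>k\<in>UNIV. C i m k z * (y' $ k + (\<Sum>l\<in>UNIV. N k l z * y z l)))))"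
  for V V' y' :: "real^'n"

text \<open>Homogeneity removes the C term and contracting L twice yields G2; hence the geodesic
  equation is the vanishing of y' + G2.\<close>

lemma cov_velocity:
  assumes z: "z \<in> D"
  shows "cov i z y' (snd z) y' = y' $ i + G2 i z"
proof -
  let ?w = "\<lambda>k. y' $ k + (\<Sum>l\<in>UNIV. N k l z * y z l)"
  have "(\<Sum>m\<in>UNIV. y z m * (\<Sum>k\<in>UNIV. C i m k z * ?w k)) = (\<Sum>k\<in>UNIV. ?w k * (\<Sum>m\<in>UNIV. y z m * C i m k z))"
    unfolding sum_distrib_left by (subst sum.swap) (simp add: ac_simps)
  also have "\<dots> = 0" by (simp add: C_y[OF z])
  finally have "(\<Sum>m\<in>UNIV. y z m * (\<Sum>k\<in>UNIV. C i m k z * ?w k)) = 0" .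
  moreover have "(\<Sum>m\<in>UNIV. y z m * (\<Sum>k\<in>UNIV. L i m k z * y z k)) = G2 i z"
    using L_y[OF z, of i] N_y[OF z, of i] by (simp add: mult.commute)
  ultimately show ?thesis unfolding cov_def distrib_left sum.distrib by simp
qed

text \<open>On a geodesic the vector multiplied by C is itself zero, and one contraction of L leaves
  N.\<close>

lemma cov_geodesic:
  assumes z: "z \<in> D" and geo: "\<And>k. y' $ k + G2 k z = 0"
  shows "cov i z y' V V' = V' $ i + (\<Sum>m\<in>UNIV. N i m z * V $ m)"
proof -
  have "y' $ k + (\<Sum>l\<in>UNIV. N k l z * y z l) = 0" for k
    using geo[of k] N_y[OF z, of k] by (simp add: mult.commute)
  moreover have "(\<Sum>k\<in>UNIV. L i m k z * y z k) = N i m z" for m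
    using L_y[OF z, of i m] by (simp add: mult.commute)
  ultimately show ?thesis unfolding cov_def by (simp add: mult.commute)
qed

end

abbreviation (input) e1 :: "real \<times> real \<times> real" where "e1 \<equiv> (1, 0, 0)"
abbreviation (input) e2 :: "real \<times> real \<times> real" where "e2 \<equiv> (0, 1, 0)"
abbreviation (input) e3 :: "real \<times> real \<times> real" where "e3 \<equiv> (0, 0, 1)"

text \<open>\<open>h\<close> stands for the variation in coordinates, with arguments first
  parameter, second parameter, time. Its domain is open so that time can be treated like the
  parameters, and \<open>h_regular\<close> keeps the velocity nonzero, as membership in
  \<open>D\<close> requires.\<close>

locale local_variation = local_finsler U f
  for U :: "(real^'n::finite) set" and f :: "real^'n \<Rightarrow> real^'n \<Rightarrow> real" +
  fixes W :: "(real \<times> real \<times> real) set" and h :: "real \<times> real \<times> real \<Rightarrow> real^'n" and p :: real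
  assumes open_W: "open W" and smooth_h: "smooth_on W h"
    and h_U: "\<And>z. z \<in> W \<Longrightarrow> h z \<in> U" and h_regular: "\<And>z. z \<in> W \<Longrightarrow> dirD h e3 z \<noteq> 0"
begin

definition "H z = (h z, dirD h e3 z)"
definition "\<omega> z = (\<Sum>i\<in>UNIV. Ly p i (H z) * dirD h e2 z $ i)"
definition "S j z = dirD (dirD h e3) e3 z $ j + G2 j (H z)"

lemma H_D: "z \<in> W \<Longrightarrow> H z \<in> D"
  using h_U h_regular by (auto simp: H_def)

lemma smooth_dh: "smooth_on W (dirD h v)" "smooth_on W (dirD (dirD h v) w)"
  by (intro smooth_on_dirD smooth_h)+

lemma smooth_H: "smooth_on W H"
  unfolding H_def[abs_def] by (intro smooth_on_Pair open_W smooth_h smooth_dh)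

lemma smooth_uH: "smooth_on D u \<Longrightarrow> smooth_on W (\<lambda>z. u (H z))" for u :: "_ \<Rightarrow> real"
  by (rule smooth_on_compose[OF open_W open_D H_D smooth_H])

lemma dirD_uH:
  fixes u :: "_ \<Rightarrow> real"
  assumes u: "smooth_on D u" and z: "z \<in> W"
  shows "dirD (\<lambda>z. u (H z)) v z = (\<Sum>k\<in>UNIV. dirD h v z $ k * dirD u (X k) (H z))
    + (\<Sum>k\<in>UNIV. dirD (dirD h e3) v z $ k * dirD u (Y k) (H z))"
proof -
  have "(H has_derivative (\<lambda>v. (dirD h v z, dirD (dirD h e3) v z))) (at z)"
    unfolding H_def[abs_def]
    by (intro has_derivative_Pair smooth_on_has_derivative[OF smooth_h z] smooth_on_has_derivative[OF smooth_dh(1) z])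
  from dirD_eq[OF has_derivative_compose[OF this smooth_on_has_derivative[OF u H_D[OF z]]]]
  show ?thesis by (simp add: dirD_Pair[OF u H_D[OF z]])
qed

lemma smooth_dh_nth: "smooth_on W (\<lambda>z. dirD h v z $ i)" "smooth_on W (\<lambda>z. dirD (dirD h v) w z $ i)"
  by (intro smooth_on_vec_nth open_W smooth_dh)+

lemma dirD_dh_nth: "z \<in> W \<Longrightarrow> dirD (\<lambda>z. dirD h v z $ i) w z = dirD (dirD h v) w z $ i"
  by (intro dirD_vec_nth smooth_on_differentiable[OF smooth_dh(1)])

lemma smooth_\<omega>: "smooth_on W \<omega>"
  unfolding \<omega>_def[abs_def] by (intro smooth_on_sum smooth_on_mult open_W smooth_uH smooth_Ly smooth_dh_nth)

lemma smooth_S: "smooth_on W (S j)"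
  unfolding S_def[abs_def] by (intro smooth_on_add open_W smooth_dh_nth smooth_uH smooth_G2)

lemma smooth_LagH: "smooth_on W (\<lambda>z. Lag p (H z))"
  by (intro smooth_uH smooth_Lag)

lemma dirD_\<omega>:
  assumes z: "z \<in> W"
  shows "dirD \<omega> v z = (\<Sum>i\<in>UNIV. Ly p i (H z) * dirD (dirD h e2) v z $ i
    + ((\<Sum>k\<in>UNIV. dirD h v z $ k * dirD (Ly p i) (X k) (H z))
      + (\<Sum>k\<in>UNIV. dirD (dirD h e3) v z $ k * M p i k (H z))) * dirD h e2 z $ i)"
proof -
  have "dirD \<omega> v z = (\<Sum>i\<in>UNIV. dirD (\<lambda>z. Ly p i (H z) * dirD h e2 z $ i) v z)"
    unfolding \<omega>_def[abs_def]
    by (rule dirD_sum_smooth[OF _ z]) (intro smooth_on_mult open_W smooth_uH smooth_Ly smooth_dh_nth)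
  then show ?thesis
    by (simp only: dirD_mult_smooth[OF smooth_uH[OF smooth_Ly] smooth_dh_nth(1) z] dirD_uH[OF smooth_Ly z]
      dirD_dh_nth[OF z] M_def)
qed

text \<open>Valid at every point of \<open>W\<close>, hence along all neighbouring curves, which is
  what allows it to be differentiated once more in the first parameter. It combines
  \<open>Euler_Lagrange_spray\<close> with the exchange of the time and second-parameter derivatives
  of \<open>h\<close>.\<close>

lemma first_variation:
  assumes z: "z \<in> W"
  shows "dirD (\<lambda>z. Lag p (H z)) e2 z = dirD \<omega> e3 z - (\<Sum>i\<in>UNIV. \<Sum>j\<in>UNIV. M p i j (H z) * S j z * dirD h e2 z $ i)"
proof -
  let ?h2 = "dirD h e2 z"
  have EL: "(\<Sum>k\<in>UNIV. dirD h e3 z $ k * dirD (Ly p i) (X k) (H z)) + (\<Sum>k\<in>UNIV. dirD (dirD h e3) e3 z $ k * M p i k (H z))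
     = dirD (Lag p) (X i) (H z) + (\<Sum>j\<in>UNIV. M p i j (H z) * S j z)" for i
    using Euler_Lagrange_spray[OF H_D[OF z], of p i]
    by (simp add: S_def H_def distrib_left sum.distrib mult.commute)
  have c: "dirD (dirD h e2) e3 z = dirD (dirD h e3) e2 z"
    by (rule dirD_commute[OF smooth_h open_W z])
  have "dirD \<omega> e3 z = (\<Sum>i\<in>UNIV. Ly p i (H z) * dirD (dirD h e3) e2 z $ i) + (\<Sum>i\<in>UNIV. dirD (Lag p) (X i) (H z) * ?h2 $ i)
     + (\<Sum>i\<in>UNIV. \<Sum>j\<in>UNIV. M p i j (H z) * S j z * ?h2 $ i)"
    unfolding dirD_\<omega>[OF z] EL c by (simp add: distrib_right sum.distrib sum_distrib_right)
  then show ?thesis unfolding dirD_uH[OF smooth_Lag z] by (simp add: Ly_def mult.commute)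
qed

lemma second_variation_density:
  assumes z: "z \<in> W" and S0: "\<And>j. S j z = 0"
  shows "dirD (dirD (\<lambda>z. Lag p (H z)) e2) e1 z = dirD (dirD \<omega> e1) e3 z
    - (\<Sum>i\<in>UNIV. \<Sum>j\<in>UNIV. M p i j (H z) * dirD (S j) e1 z * dirD h e2 z $ i)"
proof -
  let ?T = "\<lambda>i j z. M p i j (H z) * S j z * dirD h e2 z $ i"
  have sMS: "smooth_on W (\<lambda>z. M p i j (H z) * S j z)" for i j
    by (intro smooth_on_mult open_W smooth_uH smooth_M smooth_S)
  have sT: "smooth_on W (?T i j)" for i j
    by (intro smooth_on_mult[OF open_W sMS] smooth_dh_nth)
  have dT: "dirD (?T i j) e1 z = M p i j (H z) * dirD (S j) e1 z * dirD h e2 z $ i" for i j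
    unfolding dirD_mult_smooth[OF sMS smooth_dh_nth(1) z] dirD_mult_smooth[OF smooth_uH[OF smooth_M] smooth_S z]
    by (simp add: S0)
  have "dirD (dirD (\<lambda>z. Lag p (H z)) e2) e1 z = dirD (\<lambda>z. dirD \<omega> e3 z - (\<Sum>i\<in>UNIV. \<Sum>j\<in>UNIV. ?T i j z)) e1 z"
    by (rule dirD_cong[OF open_W z first_variation])
  also have "\<dots> = dirD (dirD \<omega> e3) e1 z - dirD (\<lambda>z. \<Sum>i\<in>UNIV. \<Sum>j\<in>UNIV. ?T i j z) e1 z"
    by (intro dirD_diff_smooth[OF _ _ z] smooth_on_dirD smooth_\<omega> smooth_on_sum open_W sT)
  also have "dirD (\<lambda>z. \<Sum>i\<in>UNIV. \<Sum>j\<in>UNIV. ?T i j z) e1 z = (\<Sum>i\<in>UNIV. dirD (\<lambda>z. \<Sum>j\<in>UNIV. ?T i j z) e1 z)"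
    by (intro dirD_sum_smooth[OF _ z] smooth_on_sum open_W sT)
  also have "\<dots> = (\<Sum>i\<in>UNIV. \<Sum>j\<in>UNIV. dirD (?T i j) e1 z)"
    by (intro sum.cong refl dirD_sum_smooth[OF _ z] sT)
  also have "dirD (dirD \<omega> e3) e1 z = dirD (dirD \<omega> e1) e3 z"
    by (rule dirD_commute[OF smooth_\<omega> open_W z])
  finally show ?thesis unfolding dT .
qed

section \<open>The linearised geodesic equation\<close>

lemma dirD_S_e1:
  assumes z: "z \<in> W"
  shows "dirD (S j) e1 z = dirD (dirD (dirD h e1) e3) e3 z $ j + 2 * (\<Sum>m\<in>UNIV. N j m (H z) * dirD (dirD h e1) e3 z $ m)
    + (\<Sum>k\<in>UNIV. dirD (G2 j) (X k) (H z) * dirD h e1 z $ k)"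
proof -
  have c: "dirD (dirD h e3) e1 z = dirD (dirD h e1) e3 z" if "z \<in> W" for z
    by (rule dirD_commute[OF smooth_h open_W that])
  have c3: "dirD (dirD (dirD h e3) e3) e1 z = dirD (dirD (dirD h e1) e3) e3 z"
    using dirD_commute[OF smooth_dh(1) open_W z, of e3 e3 e1] dirD_cong[OF open_W z c] by simp
  have "dirD (S j) e1 z = dirD (\<lambda>z. dirD (dirD h e3) e3 z $ j) e1 z + dirD (\<lambda>z. G2 j (H z)) e1 z"
    unfolding S_def[abs_def] by (intro dirD_add_smooth[OF _ _ z] smooth_dh_nth smooth_uH smooth_G2)
  also have "dirD (\<lambda>z. dirD (dirD h e3) e3 z $ j) e1 z = dirD (dirD (dirD h e1) e3) e3 z $ j"
    unfolding c3[symmetric] by (rule dirD_vec_nth[OF smooth_on_differentiable[OF smooth_dh(2) z]])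
  \<comment> \<open>The factor 2 arises because N is half the y-derivative of G2.\<close>
  finally show ?thesis
    unfolding dirD_uH[OF smooth_G2 z] c[OF z] by (simp add: N_eq[OF H_D[OF z]] sum_distrib_left mult.commute)
qed

text \<open>The covariant derivative of X in the form that it takes along geodesics. As a formula in
  \<open>h\<close> it is smooth on all of \<open>W\<close>, also beyond the ends of the time
  interval, which later yields one-sided limits.\<close>

definition "DX z = (\<chi> i. dirD (dirD h e1) e3 z $ i + (\<Sum>m\<in>UNIV. N i m (H z) * dirD h e1 z $ m))"

lemma smooth_DX_nth: "smooth_on W (\<lambda>z. DX z $ i)"
  unfolding DX_def vec_lambda_beta
  by (intro smooth_on_add smooth_on_sum smooth_on_mult open_W smooth_dh_nth smooth_uH smooth_N)

text \<open>Differentiating N in time produces its spray derivative, and \<open>curv_h_yy\<close>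
  contains the same terms with opposite sign; the two products N N cancel likewise. What remains is
  the linearisation of y' + G2.\<close>

lemma Jacobi:
  assumes z: "z \<in> W" and S0: "\<And>j. S j z = 0"
  shows "dirD (\<lambda>z. DX z $ i) e3 z + (\<Sum>m\<in>UNIV. N i m (H z) * DX z $ m)
    + (\<Sum>a\<in>UNIV. \<Sum>b\<in>UNIV. \<Sum>k\<in>UNIV. uncurried (curv_h f i a b k) (H z) * dirD h e3 z $ a * dirD h e3 z $ b * dirD h e1 z $ k)
    = dirD (S i) e1 z"
proof -
  let ?h1 = "dirD h e1 z" and ?h3 = "dirD h e3 z" and ?h13 = "dirD (dirD h e1) e3 z"
  \<comment> \<open>The geodesic equation replaces the acceleration by -G2, which turns a time
    derivative into a derivative along the spray.\<close>
  have h33: "dirD (dirD h e3) e3 z $ j = - G2 j (H z)" for j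
    using S0[of j] by (simp add: S_def)
  have y: "y (H z) k = ?h3 $ k" for k by (simp add: H_def)
  let ?dN = "\<lambda>m. (\<Sum>k\<in>UNIV. ?h3 $ k * dirD (N i m) (X k) (H z)) - (\<Sum>k\<in>UNIV. G2 k (H z) * dirD (N i m) (Y k) (H z))"
  have dN: "dirD (\<lambda>z. N i m (H z)) e3 z = ?dN m" for m
    unfolding dirD_uH[OF smooth_N z] h33 by (simp add: sum_negf)
  have "dirD (\<lambda>z. DX z $ i) e3 z = dirD (\<lambda>z. dirD (dirD h e1) e3 z $ i) e3 z + dirD (\<lambda>z. \<Sum>m\<in>UNIV. N i m (H z) * dirD h e1 z $ m) e3 z"
    unfolding DX_def vec_lambda_beta
    by (intro dirD_add_smooth[OF _ _ z] smooth_on_sum smooth_on_mult open_W smooth_dh_nth smooth_uH smooth_N)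
  also have "dirD (\<lambda>z. dirD (dirD h e1) e3 z $ i) e3 z = dirD (dirD (dirD h e1) e3) e3 z $ i"
    by (rule dirD_vec_nth[OF smooth_on_differentiable[OF smooth_dh(2) z]])
  also have "dirD (\<lambda>z. \<Sum>m\<in>UNIV. N i m (H z) * dirD h e1 z $ m) e3 z = (\<Sum>m\<in>UNIV. dirD (\<lambda>z. N i m (H z) * dirD h e1 z $ m) e3 z)"
    by (intro dirD_sum_smooth[OF _ z] smooth_on_mult open_W smooth_dh_nth smooth_uH smooth_N)
  also have "\<dots> = (\<Sum>m\<in>UNIV. N i m (H z) * ?h13 $ m + ?dN m * ?h1 $ m)"
    by (simp only: dirD_mult_smooth[OF smooth_uH[OF smooth_N] smooth_dh_nth(1) z] dN dirD_dh_nth[OF z])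
  finally have 1: "dirD (\<lambda>z. DX z $ i) e3 z = dirD (dirD (dirD h e1) e3) e3 z $ i + (\<Sum>m\<in>UNIV. N i m (H z) * ?h13 $ m) + (\<Sum>m\<in>UNIV. ?dN m * ?h1 $ m)"
    by (simp add: sum.distrib)
  have 2: "(\<Sum>m\<in>UNIV. N i m (H z) * DX z $ m) = (\<Sum>m\<in>UNIV. N i m (H z) * ?h13 $ m)
      + (\<Sum>k\<in>UNIV. (\<Sum>s\<in>UNIV. N i s (H z) * N s k (H z)) * ?h1 $ k)"
    unfolding DX_def vec_lambda_beta distrib_left sum.distrib sum_distrib_left sum_distrib_right
    by (subst (2) sum.swap) (simp add: mult.assoc)
  have "(\<Sum>a\<in>UNIV. \<Sum>b\<in>UNIV. \<Sum>k\<in>UNIV. uncurried (curv_h f i a b k) (H z) * ?h3 $ a * ?h3 $ b * ?h1 $ k)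
     = (\<Sum>a\<in>UNIV. \<Sum>k\<in>UNIV. \<Sum>b\<in>UNIV. uncurried (curv_h f i a b k) (H z) * ?h3 $ a * ?h3 $ b * ?h1 $ k)"
    by (intro sum.cong refl sum.swap)
  also have "\<dots> = (\<Sum>k\<in>UNIV. \<Sum>a\<in>UNIV. \<Sum>b\<in>UNIV. uncurried (curv_h f i a b k) (H z) * ?h3 $ a * ?h3 $ b * ?h1 $ k)"
    by (rule sum.swap)
  also have "\<dots> = (\<Sum>k\<in>UNIV. (\<Sum>a\<in>UNIV. \<Sum>b\<in>UNIV. uncurried (curv_h f i a b k) (H z) * y (H z) a * y (H z) b) * ?h1 $ k)"
    unfolding sum_distrib_right y ..
  also have "\<dots> = (\<Sum>k\<in>UNIV. dirD (G2 i) (X k) (H z) * ?h1 $ k - (\<Sum>s\<in>UNIV. N i s (H z) * N s k (H z)) * ?h1 $ k - ?dN k * ?h1 $ k)"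
    unfolding curv_h_yy[OF H_D[OF z]] unfolding y by (intro sum.cong refl) (simp only: algebra_simps)
  finally show ?thesis
    unfolding 1 2 dirD_S_e1[OF z] by (simp add: sum_subtractf)
qed

end


section \<open>Tangent vectors and charts\<close>

context connected_smooth_manifold
begin

lemma chart_homeomorphism:
  assumes "\<phi> \<in> A"
  shows "homeomorphism (fst \<phi>) (snd \<phi> ` fst \<phi>) (snd \<phi>) (chart_inv \<phi>)" "open (fst \<phi>)" "open (snd \<phi> ` fst \<phi>)"
  using charts[OF assms] by (auto simp: is_chart_def)

lemma chart_inv_left: "\<phi> \<in> A \<Longrightarrow> q \<in> fst \<phi> \<Longrightarrow> chart_inv \<phi> (snd \<phi> q) = q"
  using homeomorphism_apply1[OF chart_homeomorphism(1)] .

lemma chart_inv_in: "\<phi> \<in> A \<Longrightarrow> x \<in> snd \<phi> ` fst \<phi> \<Longrightarrow> chart_inv \<phi> x \<in> fst \<phi>"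
  using chart_inv_left by (metis imageE)

lemma overlap_eq:
  assumes "\<phi> \<in> A"
  shows "snd \<phi> ` (fst \<phi> \<inter> T) = snd \<phi> ` fst \<phi> \<inter> chart_inv \<phi> -` T"
  using chart_inv_left[OF assms] by (auto simp: image_iff)

lemma open_overlap:
  assumes "\<phi> \<in> A" "\<psi> \<in> A"
  shows "open (snd \<phi> ` (fst \<phi> \<inter> fst \<psi>))"
  unfolding overlap_eq[OF assms(1)]
  using chart_homeomorphism[OF assms(1)] chart_homeomorphism(2)[OF assms(2)]
  by (intro continuous_open_preimage) (auto simp: homeomorphism_def)

lemma charts_atD: "\<phi> \<in> charts_at A q \<Longrightarrow> \<phi> \<in> A" "\<phi> \<in> charts_at A q \<Longrightarrow> q \<in> fst \<phi>"
  by (auto simp: charts_at_def)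

section \<open>Coordinate changes of tangent vectors\<close>

definition "Tr \<phi> \<psi> q = frechet_derivative (transition \<phi> \<psi>) (at (snd \<phi> q))"

lemma transition_apply: "\<phi> \<in> A \<Longrightarrow> q \<in> fst \<phi> \<Longrightarrow> transition \<phi> \<psi> (snd \<phi> q) = snd \<psi> q"
  by (simp add: transition_def chart_inv_left)

lemma transition_derivative:
  assumes "\<phi> \<in> charts_at A q" "\<psi> \<in> charts_at A q"
  shows "(transition \<phi> \<psi> has_derivative Tr \<phi> \<psi> q) (at (snd \<phi> q))"
proof -
  have "transition \<phi> \<psi> differentiable (at (snd \<phi> q))"
    using assms by (intro smooth_on_differentiable[OF compatible]) (auto simp: charts_at_def)
  then show ?thesis by (simp add: Tr_def frechet_derivative_works)
qed

lemma Tr_unique: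
  assumes "\<phi> \<in> charts_at A q" "\<psi> \<in> charts_at A q" "(transition \<phi> \<psi> has_derivative T) (at (snd \<phi> q))"
  shows "Tr \<phi> \<psi> q = T"
  using frechet_derivative_at[OF assms(3)] by (simp add: Tr_def)

lemma Tr_same: assumes "\<phi> \<in> charts_at A q" shows "Tr \<phi> \<phi> q = (\<lambda>y. y)"
proof (rule Tr_unique[OF assms assms])
  show "(transition \<phi> \<phi> has_derivative (\<lambda>y. y)) (at (snd \<phi> q))"
  proof (rule has_derivative_transform_within_open[OF has_derivative_ident])
    show "open (snd \<phi> ` fst \<phi>)" using assms chart_homeomorphism(3) charts_atD by blast
    show "x = transition \<phi> \<phi> x" if "x \<in> snd \<phi> ` fst \<phi>" for x
      using that charts_atD[OF assms] by (auto simp: transition_apply)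
  qed (use charts_atD[OF assms] in auto)
qed

lemma Tr_comp:
  assumes "\<phi> \<in> charts_at A q" "\<psi> \<in> charts_at A q" "\<kappa> \<in> charts_at A q"
  shows "Tr \<psi> \<kappa> q (Tr \<phi> \<psi> q w) = Tr \<phi> \<kappa> q w"
proof -
  note c = charts_atD[OF assms(1)] charts_atD[OF assms(2)] charts_atD[OF assms(3)]
  have "((\<lambda>x. transition \<psi> \<kappa> (transition \<phi> \<psi> x)) has_derivative (\<lambda>w. Tr \<psi> \<kappa> q (Tr \<phi> \<psi> q w))) (at (snd \<phi> q))"
    using transition_derivative[OF assms(2,3)] transition_apply[OF c(1,2), of \<psi>]
    by (intro has_derivative_compose[OF transition_derivative[OF assms(1,2)]]) simp
  then have "(transition \<phi> \<kappa> has_derivative (\<lambda>w. Tr \<psi> \<kappa> q (Tr \<phi> \<psi> q w))) (at (snd \<phi> q))"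
  proof (rule has_derivative_transform_within_open[OF _ open_overlap[OF c(1,3)]])
    show "snd \<phi> q \<in> snd \<phi> ` (fst \<phi> \<inter> fst \<psi>)" using c by auto
    show "transition \<psi> \<kappa> (transition \<phi> \<psi> x) = transition \<phi> \<kappa> x" if "x \<in> snd \<phi> ` (fst \<phi> \<inter> fst \<psi>)" for x
      using that c by (auto simp: transition_apply)
  qed
  from Tr_unique[OF assms(1,3) this] show ?thesis by simp
qed

lemma tvec_of_apply: "\<psi> \<in> charts_at A q \<Longrightarrow> tvec_of A q \<phi> w \<psi> = Tr \<phi> \<psi> q w"
  by (simp add: tvec_of_def Tr_def)

lemma tvec_of_same: "\<phi> \<in> charts_at A q \<Longrightarrow> tvec_of A q \<phi> w \<phi> = w"
  by (simp add: tvec_of_apply Tr_same)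

lemma tvec_of_change:
  assumes "\<phi> \<in> charts_at A q" "\<psi> \<in> charts_at A q"
  shows "tvec_of A q \<psi> (tvec_of A q \<phi> w \<psi>) = tvec_of A q \<phi> w"
proof
  show "tvec_of A q \<psi> (tvec_of A q \<phi> w \<psi>) \<kappa> = tvec_of A q \<phi> w \<kappa>" for \<kappa>
    using Tr_comp[OF assms, of \<kappa>] by (cases "\<kappa> \<in> charts_at A q") (simp_all add: tvec_of_apply assms, simp add: tvec_of_def)
qed

lemma tvec_of_tangent:
  assumes "\<phi> \<in> charts_at A q"
  shows "tvec_of A q \<phi> w \<in> tangent_space A q"
  using Tr_comp[OF assms] unfolding tangent_space_def Tr_def[symmetric]
  by (auto simp: tvec_of_apply) (simp add: tvec_of_def)

lemma tvec_of_lin: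
  assumes "\<phi> \<in> charts_at A q"
  shows "tvec_of A q \<phi> (u + a *\<^sub>R w) \<psi> = tvec_of A q \<phi> u \<psi> + a *\<^sub>R tvec_of A q \<phi> w \<psi>"
    "tvec_of A q \<phi> (a *\<^sub>R w) \<psi> = a *\<^sub>R tvec_of A q \<phi> w \<psi>"
proof -
  have "linear (Tr \<phi> \<psi> q)" if "\<psi> \<in> charts_at A q"
    using has_derivative_linear[OF transition_derivative[OF assms that]] .
  then show "tvec_of A q \<phi> (u + a *\<^sub>R w) \<psi> = tvec_of A q \<phi> u \<psi> + a *\<^sub>R tvec_of A q \<phi> w \<psi>"
    "tvec_of A q \<phi> (a *\<^sub>R w) \<psi> = a *\<^sub>R tvec_of A q \<phi> w \<psi>"
    by (cases "\<psi> \<in> charts_at A q"; simp add: tvec_of_apply linear_add linear_cmul; simp add: tvec_of_def)+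
qed

lemma curve_in_chart:
  assumes \<phi>: "\<phi> \<in> charts_at A (\<gamma> t)" and ev: "\<forall>\<^sub>F \<tau> in at t within S. \<gamma> \<tau> \<in> fst \<phi>"
    and d: "((\<lambda>\<tau>. snd \<phi> (\<gamma> \<tau>)) has_vector_derivative w) (at t within S)"
    and t: "t \<in> S" and \<psi>: "\<psi> \<in> charts_at A (\<gamma> t)"
  shows "((\<lambda>\<tau>. snd \<psi> (\<gamma> \<tau>)) has_vector_derivative Tr \<phi> \<psi> (\<gamma> t) w) (at t within S)"
proof -
  note c = charts_atD[OF \<phi>] charts_atD[OF \<psi>]
  have "((\<lambda>\<tau>. transition \<phi> \<psi> (snd \<phi> (\<gamma> \<tau>))) has_derivative (\<lambda>h. Tr \<phi> \<psi> (\<gamma> t) (h *\<^sub>R w))) (at t within S)"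
    using has_derivative_compose[OF d[unfolded has_vector_derivative_def] transition_derivative[OF \<phi> \<psi>]] .
  moreover have "Tr \<phi> \<psi> (\<gamma> t) (h *\<^sub>R w) = h *\<^sub>R Tr \<phi> \<psi> (\<gamma> t) w" for h
    using linear_cmul[OF has_derivative_linear[OF transition_derivative[OF \<phi> \<psi>]]] .
  ultimately have "((\<lambda>\<tau>. transition \<phi> \<psi> (snd \<phi> (\<gamma> \<tau>))) has_vector_derivative Tr \<phi> \<psi> (\<gamma> t) w) (at t within S)"
    by (simp add: has_vector_derivative_def)
  moreover have "\<forall>\<^sub>F \<tau> in at t within S. transition \<phi> \<psi> (snd \<phi> (\<gamma> \<tau>)) = snd \<psi> (\<gamma> \<tau>)"
    using ev by eventually_elim (simp add: transition_apply c)
  ultimately show ?thesis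
    unfolding has_vector_derivative_def
    by (rule has_derivative_transform_eventually) (simp_all add: transition_apply c t)
qed

text \<open>The components in one chart determine those in all others, so a velocity may be computed
  in any single convenient chart. The filter must be nontrivial for the one-sided derivative to be
  unique.\<close>

lemma velocity_tvec_of:
  assumes "\<phi> \<in> charts_at A (\<gamma> t)" "\<forall>\<^sub>F \<tau> in at t within S. \<gamma> \<tau> \<in> fst \<phi>"
    "((\<lambda>\<tau>. snd \<phi> (\<gamma> \<tau>)) has_vector_derivative w) (at t within S)" "t \<in> S" "at t within S \<noteq> bot"
  shows "velocity A S \<gamma> t = tvec_of A (\<gamma> t) \<phi> w"
proof
  show "velocity A S \<gamma> t \<psi> = tvec_of A (\<gamma> t) \<phi> w \<psi>" for \<psi>
    using vector_derivative_within[OF assms(5) curve_in_chart[OF assms(1-4)], of \<psi>]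
    by (cases "\<psi> \<in> charts_at A (\<gamma> t)") (simp_all add: velocity_def tvec_of_apply, simp add: tvec_of_def)
qed

lemma variation_field_tvec_of:
  assumes "\<phi> \<in> charts_at A (\<gamma> 0 t)" "\<forall>\<^sub>F s in at 0. \<gamma> s t \<in> fst \<phi>"
    "((\<lambda>s. snd \<phi> (\<gamma> s t)) has_vector_derivative w) (at 0)"
  shows "variation_field A \<gamma> t = tvec_of A (\<gamma> 0 t) \<phi> w"
proof
  show "variation_field A \<gamma> t \<psi> = tvec_of A (\<gamma> 0 t) \<phi> w \<psi>" for \<psi>
    using vector_derivative_at[OF curve_in_chart[of \<phi> "\<lambda>s. \<gamma> s t", OF assms UNIV_I], of \<psi>]
    by (cases "\<psi> \<in> charts_at A (\<gamma> 0 t)") (simp_all add: variation_field_def tvec_of_apply, simp add: tvec_of_def)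
qed

end

context local_finsler
begin

lemma g_yy: assumes z: "z \<in> D" shows "(\<Sum>i\<in>UNIV. \<Sum>j\<in>UNIV. g i j z * y z i * y z j) = Q z"
proof -
  have "(\<Sum>i\<in>UNIV. \<Sum>j\<in>UNIV. g i j z * y z i * y z j) = (\<Sum>i\<in>UNIV. y z i * (\<Sum>j\<in>UNIV. y z j * g i j z))"
    by (simp add: sum_distrib_left ac_simps)
  then show ?thesis using y_q[OF z] by (simp add: y_g[OF z] flip: sum_divide_distrib)
qed

text \<open>The zero vector is covered too, as both sides are then powers of 0, which equal 0. Thus
  \<open>om_eq\<close> can rewrite F^p on a whole line of velocities and not only near one of
  them.\<close>

lemma Lag_f: "x \<in> U \<Longrightarrow> Lag p (x, w) = f x w powr p"
proof -
  assume x: "x \<in> U"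
  have "f x w \<ge> 0"
    using pos_f[OF x, of w] hom_f[OF x, of 0 w] by (cases "w = 0") auto
  then have "(f x w)\<^sup>2 = f x w powr 2"
    by (cases "f x w = 0") (auto simp: powr_numeral)
  then show ?thesis by (simp add: Lag_def Q_def uncurried_def powr_powr)
qed

end

context finsler_manifold
begin

lemma F_tvec_of: "\<phi> \<in> charts_at A q \<Longrightarrow> F q (tvec_of A q \<phi> w) = local_F A F \<phi> (snd \<phi> q) w"
  by (simp add: local_F_def chart_inv_left charts_atD)

lemma local_finsler: assumes \<phi>: "\<phi> \<in> A" shows "local_finsler (snd \<phi> ` fst \<phi>) (local_F A F \<phi>)"
proof
  show "open (snd \<phi> ` fst \<phi>)" using chart_homeomorphism(3)[OF \<phi>] .
  show "smooth_on (snd \<phi> ` fst \<phi> \<times> (UNIV - {0})) (\<lambda>(x, y). local_F A F \<phi> x y)" by (rule F_smooth[OF \<phi>])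
  show "0 < (\<Sum>i\<in>UNIV. \<Sum>j\<in>UNIV. fund_g (local_F A F \<phi>) i j x y * w $ i * w $ j)"
    if "x \<in> snd \<phi> ` fst \<phi>" "y \<noteq> 0" "w \<noteq> 0" for x y w by (rule g_pos_def[OF \<phi> that])
  fix x y and a :: real assume x: "x \<in> snd \<phi> ` fst \<phi>"
  define q where "q = chart_inv \<phi> x"
  have q: "\<phi> \<in> charts_at A q" using \<phi> chart_inv_in[OF \<phi> x] by (simp add: charts_at_def q_def)
  have "F q (tvec_of A q \<phi> (a *\<^sub>R y)) = \<bar>a\<bar> * F q (tvec_of A q \<phi> y)"
    unfolding F_homogeneous[OF tvec_of_tangent[OF q], symmetric] tvec_of_lin(2)[OF q, abs_def] ..
  then show "local_F A F \<phi> x (a *\<^sub>R y) = \<bar>a\<bar> * local_F A F \<phi> x y"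
    by (simp add: local_F_def q_def)
  assume "y \<noteq> 0"
  then have "tvec_of A q \<phi> y \<noteq> (\<lambda>\<phi>. 0)" using tvec_of_same[OF q, of y] by auto
  from F_pos[OF tvec_of_tangent[OF q] this] show "0 < local_F A F \<phi> x y"
    by (simp add: local_F_def q_def)
qed

lemma some_chart: "(SOME \<phi>. \<phi> \<in> charts_at A q) \<in> charts_at A q"
  using covering[of q] by (simp add: some_in_eq)

text \<open>\<open>inner_g\<close> is evaluated in an arbitrarily selected chart. For a vector
  paired with itself at itself, Euler's relation \<open>g_yy\<close> turns it into F^2, which is
  chart-free; this replaces the transformation law of the metric.\<close>

lemma inner_g_same:
  assumes \<phi>: "\<phi> \<in> charts_at A q" and w: "w \<noteq> 0"
  shows "sqrt (inner_g A F q (tvec_of A q \<phi> w) (tvec_of A q \<phi> w) (tvec_of A q \<phi> w)) = F q (tvec_of A q \<phi> w)"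
proof -
  define \<kappa> where "\<kappa> = (SOME \<phi>. \<phi> \<in> charts_at A q)"
  have \<kappa>: "\<kappa> \<in> charts_at A q" unfolding \<kappa>_def by (rule some_chart)
  interpret \<kappa>: local_finsler "snd \<kappa> ` fst \<kappa>" "local_F A F \<kappa>" by (rule local_finsler[OF charts_atD(1)[OF \<kappa>]])
  let ?u = "tvec_of A q \<phi> w"
  have "?u \<kappa> \<noteq> 0"
  proof
    assume "?u \<kappa> = 0"
    then have "?u = tvec_of A q \<kappa> (0 *\<^sub>R 0)" using tvec_of_change[OF \<phi> \<kappa>, of w] by simp
    then have "?u \<phi> = 0" using tvec_of_lin(2)[OF \<kappa>, of 0 0 \<phi>] by simp
    then show False using w tvec_of_same[OF \<phi>] by simp
  qed
  then have z: "(snd \<kappa> q, ?u \<kappa>) \<in> \<kappa>.D" using charts_atD[OF \<kappa>] by auto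
  have F: "F q ?u = local_F A F \<kappa> (snd \<kappa> q) (?u \<kappa>)"
    using F_tvec_of[OF \<kappa>, of "?u \<kappa>"] tvec_of_change[OF \<phi> \<kappa>, of w] by simp
  have "inner_g A F q ?u ?u ?u = (F q ?u)\<^sup>2"
    using \<kappa>.g_yy[OF z] unfolding inner_g_def \<kappa>_def[symmetric] Let_def F
    by (simp add: \<kappa>.g_def \<kappa>.Q_def uncurried_def)
  moreover have "F q ?u > 0" unfolding F using z by (auto intro!: \<kappa>.pos_f)
  ultimately show ?thesis by simp
qed

end


section \<open>One piece of the variation\<close>

lemma has_vector_derivative_slice1: "f differentiable (at (s1, s2, t)) \<Longrightarrow> ((\<lambda>s. f (s, s2, t)) has_vector_derivative dirD f e1 (s1, s2, t)) (at s1)"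
  for f :: "real \<times> real \<times> real \<Rightarrow> 'b::real_normed_vector"
  using has_vector_derivative_line[of f "(0, s2, t)" s1 e1] by simp

lemma has_vector_derivative_slice2: "f differentiable (at (s1, s2, t)) \<Longrightarrow> ((\<lambda>s. f (s1, s, t)) has_vector_derivative dirD f e2 (s1, s2, t)) (at s2)"
  for f :: "real \<times> real \<times> real \<Rightarrow> 'b::real_normed_vector"
  using has_vector_derivative_line[of f "(s1, 0, t)" s2 e2] by simp

lemma has_vector_derivative_slice3: "f differentiable (at (s1, s2, t)) \<Longrightarrow> ((\<lambda>s. f (s1, s2, s)) has_vector_derivative dirD f e3 (s1, s2, t)) (at t)"
  for f :: "real \<times> real \<times> real \<Rightarrow> 'b::real_normed_vector"
  using has_vector_derivative_line[of f "(s1, s2, 0)" t e3] by simp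

lemma eventually_slice:
  fixes W :: "(real \<times> real \<times> real) set"
  assumes "open W" "(s1, s2, t) \<in> W"
  shows "\<forall>\<^sub>F s in nhds s1. (s, s2, t) \<in> W" "\<forall>\<^sub>F s in nhds s2. (s1, s, t) \<in> W" "\<forall>\<^sub>F s in nhds t. (s1, s2, s) \<in> W"
proof -
  show "\<forall>\<^sub>F s in nhds s1. (s, s2, t) \<in> W"
    by (rule topological_tendstoD[OF _ assms]) (intro tendsto_intros filterlim_ident)
  show "\<forall>\<^sub>F s in nhds s2. (s1, s, t) \<in> W"
    by (rule topological_tendstoD[OF _ assms]) (intro tendsto_intros filterlim_ident)
  show "\<forall>\<^sub>F s in nhds t. (s1, s2, s) \<in> W"
    by (rule topological_tendstoD[OF _ assms]) (intro tendsto_intros filterlim_ident)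
qed

lemma has_vector_derivative_eventually_cong:
  assumes "(f has_vector_derivative d) (at x)" "\<forall>\<^sub>F s in nhds x. f s = g s"
  shows "(g has_vector_derivative d) (at x)"
  using assms has_vector_derivative_cong_ev[where S = UNIV and x = x and f = f and g = g] eventually_nhds_x_imp_x[OF assms(2)] by simp

lemma at_Icc_not_bot: "a < b \<Longrightarrow> t \<in> {a..b} \<Longrightarrow> at t within {a..b} \<noteq> bot" for t :: real
  using trivial_limit_within[of t "{a..b}"] islimpt_Icc[of a b t] by auto

lemma has_vector_derivative_vec_nth:
  fixes f :: "real \<Rightarrow> real^'n"
  assumes "\<And>i. ((\<lambda>t. f t $ i) has_vector_derivative d $ i) (at x)"
  shows "(f has_vector_derivative d) (at x)"
  unfolding has_vector_derivative_def has_derivative_componentwise_within[of f]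
  using assms by (auto simp: Basis_vec_def inner_axis has_vector_derivative_def)

text \<open>One closed time interval on which the whole family is smooth. The base curve is a
  geodesic, hence smooth, on all of [0,1]; break points belong to the variation alone.\<close>

locale piece = finsler_manifold A F
  for A :: "('m::{t2_space,second_countable_topology}, 'n::finite) chart set"
    and F :: "'m \<Rightarrow> ('m, 'n) tvec \<Rightarrow> real" +
  fixes c :: "real \<Rightarrow> 'm" and cs :: "real \<Rightarrow> real \<Rightarrow> real \<Rightarrow> 'm" and \<epsilon> p v a b :: real
  assumes geo: "geodesic A F c"
    and speed: "\<And>t. t \<in> {0..1} \<Longrightarrow> norm_along A F c t (velocity A {0..1} c t) = v"
    and cs_c: "\<And>t. t \<in> {0..1} \<Longrightarrow> cs 0 0 t = c t"
    and eps: "\<epsilon> > 0" and ab: "0 \<le> a" "a < b" "b \<le> 1"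
    and cs_smooth: "smooth_into A ({-\<epsilon><..<\<epsilon>} \<times> {-\<epsilon><..<\<epsilon>} \<times> {a..b}) (\<lambda>(s1, s2, t). cs s1 s2 t)"
begin

abbreviation "T \<equiv> velocity A {0..1} c"
abbreviation "Xf \<equiv> variation_field A (\<lambda>s. cs s 0)"
abbreviation "Yf \<equiv> variation_field A (\<lambda>s. cs 0 s)"
abbreviation "DXf \<equiv> covar_deriv A F c Xf"
abbreviation "Jf \<equiv> \<lambda>t \<phi>. covar_deriv A F c DXf t \<phi> + curv_R2 A F c Xf t \<phi>"

text \<open>The expression common to both parts of the formula: \<open>Z\<close> is the Jacobi
  expression in the integral and the jump in the sum.\<close>

definition "pairing t Z = g_along A F c t (Yf t) (\<lambda>\<phi>. v\<^sup>2 *\<^sub>R Z \<phi> + ((p - 2) * g_along A F c t Z (T t)) *\<^sub>R T t \<phi>)"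

text \<open>\<open>lag\<close>, the Hilbert form \<open>om\<close> and its derivative \<open>B\<close> are written in terms of \<open>F\<close> alone, hence
  without a chart. Velocities are taken within the piece, so that they are one-sided at break points.\<close>

definition "V s1 s2 t = velocity A {a..b} (cs s1 s2) t"
definition "Wf s1 t = variation_field A (\<lambda>s. cs s1 s) t"
definition "lag z = (case z of (s1, s2, t) \<Rightarrow> F (cs s1 s2 t) (V s1 s2 t) powr p)"
definition "om s1 t = deriv (\<lambda>\<alpha>. F (cs s1 0 t) (\<lambda>\<phi>. V s1 0 t \<phi> + \<alpha> *\<^sub>R Wf s1 t \<phi>) powr p) 0"
definition "B t = deriv (\<lambda>s. om s t) 0"
definition "energy_density s1 s2 t = norm_along A F (cs s1 s2) t (velocity A {0..1} (cs s1 s2) t) powr p"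

section \<open>The base geodesic in charts\<close>

lemma c_derivative:
  assumes t: "t \<in> {0..1}" and \<phi>: "\<phi> \<in> charts_at A (c t)"
  shows "((\<lambda>\<tau>. snd \<phi> (c \<tau>)) has_vector_derivative T t \<phi>) (at t within {0..1})"
    "\<forall>\<^sub>F \<tau> in at t within {0..1}. c \<tau> \<in> fst \<phi>"
proof -
  have "smooth_into A {0..1} c" using geo by (simp add: geodesic_def regular_on_def)
  then obtain W h where W: "open W" "t \<in> W" "smooth_on W h" "\<And>w. w \<in> W \<Longrightarrow> w \<in> {0..1} \<Longrightarrow> c w \<in> fst \<phi> \<and> snd \<phi> (c w) = h w"
    using t \<phi> unfolding smooth_into_def by (metis IntI)
  have ev: "\<forall>\<^sub>F \<tau> in nhds t. \<tau> \<in> {0..1} \<longrightarrow> c \<tau> \<in> fst \<phi> \<and> h \<tau> = snd \<phi> (c \<tau>)"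
    using W eventually_nhds_in_open[OF W(1,2)] by (auto elim!: eventually_mono)
  then show "\<forall>\<^sub>F \<tau> in at t within {0..1}. c \<tau> \<in> fst \<phi>"
    unfolding eventually_at_filter by eventually_elim auto
  have "((\<lambda>\<tau>. h \<tau>) has_vector_derivative dirD h 1 t) (at t within {0..1})"
    using has_vector_derivative_line[of h 0 t 1] smooth_on_differentiable[OF W(3,2)]
    by (simp add: has_vector_derivative_at_within)
  moreover have "(h has_vector_derivative d) (at t within {0..1}) = ((\<lambda>\<tau>. snd \<phi> (c \<tau>)) has_vector_derivative d) (at t within {0..1})" for d
    using ev eventually_nhds_x_imp_x[OF ev] t by (intro has_vector_derivative_cong_ev) (auto elim: eventually_mono)
  ultimately have d: "((\<lambda>\<tau>. snd \<phi> (c \<tau>)) has_vector_derivative dirD h 1 t) (at t within {0..1})" by simp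
  moreover have "T t \<phi> = dirD h 1 t"
    using vector_derivative_within[OF at_Icc_not_bot[of 0 1 t] d] t \<phi> by (simp add: velocity_def)
  ultimately show "((\<lambda>\<tau>. snd \<phi> (c \<tau>)) has_vector_derivative T t \<phi>) (at t within {0..1})" by simp
qed

lemma T_tvec_of:
  assumes t: "t \<in> {0..1}" and \<phi>: "\<phi> \<in> charts_at A (c t)"
  shows "T t = tvec_of A (c t) \<phi> (T t \<phi>)"
  by (rule velocity_tvec_of[OF \<phi> c_derivative(2,1)[OF t \<phi>] t at_Icc_not_bot]) (use t in auto)

lemma T_nonzero:
  assumes t: "t \<in> {0..1}" and \<phi>: "\<phi> \<in> charts_at A (c t)"
  shows "T t \<phi> \<noteq> 0"
proof
  assume "T t \<phi> = 0"
  then have "T t = (\<lambda>\<psi>. 0)"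
    using T_tvec_of[OF t \<phi>] tvec_of_lin(2)[OF \<phi>, of 0 0] by auto
  then show False using geo t by (simp add: geodesic_def regular_on_def)
qed

lemma F_T:
  assumes t: "t \<in> {0..1}" and \<phi>: "\<phi> \<in> charts_at A (c t)"
  shows "local_F A F \<phi> (snd \<phi> (c t)) (T t \<phi>) = v" "v > 0"
proof -
  have "F (c t) (T t) = v"
    using speed[OF t] inner_g_same[OF \<phi> T_nonzero[OF t \<phi>]]
    by (simp add: norm_along_def g_along_def flip: T_tvec_of[OF t \<phi>])
  then show 1: "local_F A F \<phi> (snd \<phi> (c t)) (T t \<phi>) = v"
    using F_tvec_of[OF \<phi>, of "T t \<phi>"] by (simp flip: T_tvec_of[OF t \<phi>])
  interpret local_finsler "snd \<phi> ` fst \<phi>" "local_F A F \<phi>" by (rule local_finsler[OF charts_atD(1)[OF \<phi>]])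
  show "v > 0"
    unfolding 1[symmetric] by (rule pos_f[OF _ T_nonzero[OF t \<phi>]]) (use charts_atD(2)[OF \<phi>] in auto)
qed

end

text \<open>\<open>h\<close> extends the coordinate expression of the variation to an open set, and
  \<open>coord\<close> ties the two together only for times in the piece; statements about
  \<open>cs\<close> therefore carry that restriction on \<open>t\<close>.\<close>

locale piece_chart = piece A F c cs \<epsilon> p v a b + local_variation "snd \<phi> ` fst \<phi>" "local_F A F \<phi>" W h p
  for A :: "('m::{t2_space,second_countable_topology}, 'n::finite) chart set"
    and F :: "'m \<Rightarrow> ('m, 'n) tvec \<Rightarrow> real"
    and c :: "real \<Rightarrow> 'm" and cs :: "real \<Rightarrow> real \<Rightarrow> real \<Rightarrow> 'm" and \<epsilon> p v a b :: real
    and \<phi> :: "('m, 'n) chart" and W :: "(real \<times> real \<times> real) set" and h :: "real \<times> real \<times> real \<Rightarrow> real^'n" +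
  assumes phi: "\<phi> \<in> A"
    and coord: "\<And>s1 s2 t. (s1, s2, t) \<in> W \<Longrightarrow> t \<in> {a..b} \<Longrightarrow> cs s1 s2 t \<in> fst \<phi> \<and> snd \<phi> (cs s1 s2 t) = h (s1, s2, t)"
begin

lemma chart_at: "(s1, s2, t) \<in> W \<Longrightarrow> t \<in> {a..b} \<Longrightarrow> \<phi> \<in> charts_at A (cs s1 s2 t)"
  using coord phi by (auto simp: charts_at_def)

lemma h_diff: "z \<in> W \<Longrightarrow> h differentiable (at z)"
  by (rule smooth_on_differentiable[OF smooth_h])

lemma cs_derivative:
  assumes z: "(s1, s2, t) \<in> W" "t \<in> {a..b}"
  shows "((\<lambda>\<tau>. snd \<phi> (cs s1 s2 \<tau>)) has_vector_derivative dirD h e3 (s1, s2, t)) (at t within {a..b})"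
    "\<forall>\<^sub>F \<tau> in at t within {a..b}. cs s1 s2 \<tau> \<in> fst \<phi>"
proof -
  have ev: "\<forall>\<^sub>F \<tau> in nhds t. \<tau> \<in> {a..b} \<longrightarrow> cs s1 s2 \<tau> \<in> fst \<phi> \<and> h (s1, s2, \<tau>) = snd \<phi> (cs s1 s2 \<tau>)"
    using eventually_slice(3)[OF open_W z(1)] by eventually_elim (simp add: coord)
  then show "\<forall>\<^sub>F \<tau> in at t within {a..b}. cs s1 s2 \<tau> \<in> fst \<phi>"
    unfolding eventually_at_filter by eventually_elim auto
  have cong: "((\<lambda>\<tau>. h (s1, s2, \<tau>)) has_vector_derivative d) (at t within {a..b})
     = ((\<lambda>\<tau>. snd \<phi> (cs s1 s2 \<tau>)) has_vector_derivative d) (at t within {a..b})" for d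
    using ev coord[OF z] by (intro has_vector_derivative_cong_ev) (auto elim: eventually_mono)
  show "((\<lambda>\<tau>. snd \<phi> (cs s1 s2 \<tau>)) has_vector_derivative dirD h e3 (s1, s2, t)) (at t within {a..b})"
    unfolding cong[symmetric] by (rule has_vector_derivative_at_within[OF has_vector_derivative_slice3[OF h_diff[OF z(1)]]])
qed

lemma V_tvec_of:
  assumes z: "(s1, s2, t) \<in> W" "t \<in> {a..b}"
  shows "V s1 s2 t = tvec_of A (cs s1 s2 t) \<phi> (dirD h e3 (s1, s2, t))"
  unfolding V_def
  by (rule velocity_tvec_of[OF chart_at[OF z] cs_derivative(2,1)[OF z] z(2) at_Icc_not_bot[OF ab(2) z(2)]])

lemma velocity_interior:
  assumes z: "(s1, s2, t) \<in> W" and t: "t \<in> {a<..<b}"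
  shows "velocity A {0..1} (cs s1 s2) t = tvec_of A (cs s1 s2 t) \<phi> (dirD h e3 (s1, s2, t))"
proof -
  have t': "t \<in> {a..b}" using t by simp
  have at: "at t within {a..b} = at t" "at t within {0..1} = at t"
    using t ab by (intro at_within_Icc_at; simp)+
  have "velocity A {0..1} (cs s1 s2) t = V s1 s2 t"
    unfolding V_def velocity_def at ..
  then show ?thesis using V_tvec_of[OF z t'] by simp
qed

lemma lag_eq:
  assumes z: "(s1, s2, t) \<in> W" "t \<in> {a..b}"
  shows "lag (s1, s2, t) = Lag p (H (s1, s2, t))"
  using V_tvec_of[OF z] F_tvec_of[OF chart_at[OF z]] coord[OF z] Lag_f[OF h_U[OF z(1)]]
  by (simp add: lag_def H_def)

text \<open>In the open interval the velocities within [0,1] and within the piece agree. At a break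
  point they may differ, and the two integrands with them.\<close>

lemma energy_density_eq:
  assumes z: "(s1, s2, t) \<in> W" and t: "t \<in> {a<..<b}"
  shows "energy_density s1 s2 t = lag (s1, s2, t)"
proof -
  have t': "t \<in> {a..b}" using t by simp
  show ?thesis
    unfolding energy_density_def norm_along_def g_along_def lag_def velocity_interior[OF z t] split
      V_tvec_of[OF z t'] inner_g_same[OF chart_at[OF z t'] h_regular[OF z]] ..
qed

section \<open>Variation fields and the Hilbert form in a chart\<close>

lemma Wf_tvec_of:
  assumes z: "(s1, 0, t) \<in> W" and t: "t \<in> {a..b}"
  shows "Wf s1 t = tvec_of A (cs s1 0 t) \<phi> (dirD h e2 (s1, 0, t))"
  unfolding Wf_def
proof (rule variation_field_tvec_of)
  have ev: "\<forall>\<^sub>F s in nhds 0. cs s1 s t \<in> fst \<phi> \<and> h (s1, s, t) = snd \<phi> (cs s1 s t)"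
    using eventually_slice(2)[OF open_W z] by eventually_elim (use coord t in auto)
  then show "\<forall>\<^sub>F s in at 0. cs s1 s t \<in> fst \<phi>"
    unfolding eventually_at_filter by eventually_elim auto
  show "((\<lambda>s. snd \<phi> (cs s1 s t)) has_vector_derivative dirD h e2 (s1, 0, t)) (at 0)"
    by (rule has_vector_derivative_eventually_cong[OF has_vector_derivative_slice2[OF h_diff[OF z]]]) (use ev in \<open>auto elim: eventually_mono\<close>)
qed (rule chart_at[OF z t])

lemma Xf_eq:
  assumes z: "(0, 0, t) \<in> W" and t: "t \<in> {a..b}"
  shows "Xf t \<phi> = dirD h e1 (0, 0, t)"
proof -
  have ev: "\<forall>\<^sub>F s in nhds 0. cs s 0 t \<in> fst \<phi> \<and> h (s, 0, t) = snd \<phi> (cs s 0 t)"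
    using eventually_slice(1)[OF open_W z] by eventually_elim (use coord t in auto)
  have "Xf t = tvec_of A (cs 0 0 t) \<phi> (dirD h e1 (0, 0, t))"
  proof (rule variation_field_tvec_of)
    show "\<forall>\<^sub>F s in at 0. cs s 0 t \<in> fst \<phi>"
      using ev unfolding eventually_at_filter by eventually_elim auto
    show "((\<lambda>s. snd \<phi> (cs s 0 t)) has_vector_derivative dirD h e1 (0, 0, t)) (at 0)"
      by (rule has_vector_derivative_eventually_cong[OF has_vector_derivative_slice1[OF h_diff[OF z]]]) (use ev in \<open>auto elim: eventually_mono\<close>)
  qed (rule chart_at[OF z t])
  then show ?thesis by (simp add: tvec_of_same[OF chart_at[OF z t]])
qed

lemma Yf_eq:
  assumes z: "(0, 0, t) \<in> W" and t: "t \<in> {a..b}"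
  shows "Yf t \<phi> = dirD h e2 (0, 0, t)"
  using Wf_tvec_of[OF z t] by (simp add: Wf_def tvec_of_same[OF chart_at[OF z t]])

lemma in_unit_interval: "t \<in> {a..b} \<Longrightarrow> t \<in> {0..1}"
  using ab by auto

lemma chart_c: "(0, 0, t) \<in> W \<Longrightarrow> t \<in> {a..b} \<Longrightarrow> \<phi> \<in> charts_at A (c t)"
  using chart_at[of 0 0 t] cs_c[OF in_unit_interval] by auto

lemma c_coord: "(0, 0, t) \<in> W \<Longrightarrow> t \<in> {a..b} \<Longrightarrow> snd \<phi> (c t) = h (0, 0, t)"
  using coord[of 0 0 t] cs_c[OF in_unit_interval] by auto

text \<open>Valid also at the ends \<open>a\<close> and \<open>b\<close>, because the geodesic
  itself is smooth across them; two adjacent pieces therefore see the same velocity at their common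
  end.\<close>

lemma T_eq:
  assumes z: "(0, 0, t) \<in> W" and t: "t \<in> {a..b}"
  shows "T t \<phi> = dirD h e3 (0, 0, t)"
proof -
  have "((\<lambda>\<tau>. snd \<phi> (c \<tau>)) has_vector_derivative T t \<phi>) (at t within {a..b})"
    using ab by (intro has_vector_derivative_within_subset[OF c_derivative(1)[OF in_unit_interval[OF t] chart_c[OF z t]]]) auto
  moreover have "((\<lambda>\<tau>. snd \<phi> (c \<tau>)) has_vector_derivative dirD h e3 (0, 0, t)) (at t within {a..b})"
    by (rule has_vector_derivative_transform[OF t _ cs_derivative(1)[OF z t]]) (metis cs_c in_unit_interval)
  ultimately show ?thesis
    using vector_derivative_unique_within[OF at_Icc_not_bot[OF ab(2) t]] by blast
qed

lemma H_eq: "(0, 0, t) \<in> W \<Longrightarrow> t \<in> {a..b} \<Longrightarrow> H (0, 0, t) = (snd \<phi> (c t), T t \<phi>)"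
  by (simp add: H_def T_eq c_coord)

lemma om_eq:
  assumes z: "(s1, 0, t) \<in> W" and t: "t \<in> {a..b}"
  shows "om s1 t = \<omega> (s1, 0, t)"
proof -
  let ?z = "(s1, 0, t)"
  note ch = chart_at[OF z t]
  have "F (cs s1 0 t) (\<lambda>\<phi>. V s1 0 t \<phi> + \<alpha> *\<^sub>R Wf s1 t \<phi>) powr p = Lag p (H ?z + \<alpha> *\<^sub>R (0, dirD h e2 ?z))" for \<alpha>
  proof -
    have "(\<lambda>\<psi>. V s1 0 t \<psi> + \<alpha> *\<^sub>R Wf s1 t \<psi>) = tvec_of A (cs s1 0 t) \<phi> (dirD h e3 ?z + \<alpha> *\<^sub>R dirD h e2 ?z)"
      unfolding V_tvec_of[OF z t] Wf_tvec_of[OF z t] tvec_of_lin(1)[OF ch, abs_def] ..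
    then show ?thesis
      using F_tvec_of[OF ch] coord[OF z t] Lag_f[OF h_U[OF z]] by (simp add: H_def)
  qed
  then have "om s1 t = deriv (\<lambda>\<alpha>. Lag p (H ?z + \<alpha> *\<^sub>R (0, dirD h e2 ?z))) 0"
    by (simp only: om_def)
  also have "\<dots> = dirD (Lag p) (0, dirD h e2 ?z) (H ?z)"
    by (rule deriv_line[OF smooth_Lag H_D[OF z]])
  finally show ?thesis
    by (simp add: dirD_Pair[OF smooth_Lag H_D[OF z]] \<omega>_def Ly_def mult.commute)
qed

lemma B_eq:
  assumes z: "(0, 0, t) \<in> W" and t: "t \<in> {a..b}"
  shows "B t = dirD \<omega> e1 (0, 0, t)"
  unfolding B_def
proof (rule DERIV_imp_deriv)
  have "((\<lambda>s. om s t) has_vector_derivative dirD \<omega> e1 (0, 0, t)) (at 0)"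
  proof (rule has_vector_derivative_eventually_cong[OF has_vector_derivative_slice1[OF smooth_on_differentiable[OF smooth_\<omega> z]]])
    show "\<forall>\<^sub>F s in nhds 0. \<omega> (s, 0, t) = om s t"
      using eventually_slice(1)[OF open_W z] by eventually_elim (rule om_eq[OF _ t, symmetric])
  qed
  then show "((\<lambda>s. om s t) has_real_derivative dirD \<omega> e1 (0, 0, t)) (at 0)"
    by (simp add: has_real_derivative_iff_has_vector_derivative)
qed

lemma B_derivative:
  assumes z: "(0, 0, t) \<in> W" and t: "t \<in> {a..b}"
  shows "(B has_vector_derivative dirD (dirD \<omega> e1) e3 (0, 0, t)) (at t within {a..b})"
proof -
  have "\<forall>\<^sub>F \<tau> in nhds t. \<tau> \<in> {a..b} \<longrightarrow> dirD \<omega> e1 (0, 0, \<tau>) = B \<tau>"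
    using eventually_slice(3)[OF open_W z] by eventually_elim (simp add: B_eq)
  from has_vector_derivative_cong_ev[OF this B_eq[OF z t, symmetric], THEN iffD1]
  show ?thesis
    using has_vector_derivative_at_within[OF has_vector_derivative_slice3[OF smooth_on_differentiable[OF smooth_on_dirD[OF smooth_\<omega>] z]]] .
qed

section \<open>Covariant derivatives and the Jacobi expression inside the piece\<close>

lemma eventually_interior:
  assumes "(0, 0, t) \<in> W" "t \<in> {a<..<b}"
  shows "\<forall>\<^sub>F \<tau> in nhds t. (0, 0, \<tau>) \<in> W \<and> \<tau> \<in> {a<..<b}"
  using eventually_slice(3)[OF open_W assms(1)] eventually_nhds_in_open[OF open_greaterThanLessThan assms(2)]
  by (rule eventually_conj)

lemma interior_derivative:
  assumes z: "(0, 0, t) \<in> W" and t: "t \<in> {a<..<b}"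
    and ev: "\<And>\<tau>. (0, 0, \<tau>) \<in> W \<Longrightarrow> \<tau> \<in> {a<..<b} \<Longrightarrow> Z \<tau> = \<zeta> \<tau>"
    and d: "(\<zeta> has_vector_derivative \<zeta>') (at t)"
  shows "vector_derivative Z (at t within {0..1}) = \<zeta>'"
proof -
  have "at t within {0..1} = at t"
    using t ab by (intro at_within_Icc_at) auto
  moreover have "(Z has_vector_derivative \<zeta>') (at t)"
    by (rule has_vector_derivative_eventually_cong[OF d]) (use eventually_interior[OF z t] in eventually_elim, simp add: ev)
  ultimately show ?thesis by (simp add: vector_derivative_at)
qed

lemma covar_deriv_eq:
  assumes z: "(0, 0, t) \<in> W" and t: "t \<in> {a<..<b}"
    and ev: "\<And>\<tau>. (0, 0, \<tau>) \<in> W \<Longrightarrow> \<tau> \<in> {a<..<b} \<Longrightarrow> Z \<tau> \<phi> = \<zeta> \<tau>"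
    and d: "(\<zeta> has_vector_derivative \<zeta>') (at t)"
  shows "covar_deriv A F c Z t \<phi> $ i = cov i (H (0, 0, t)) (dirD (dirD h e3) e3 (0, 0, t)) (\<zeta> t) \<zeta>'"
proof -
  have t': "t \<in> {a..b}" using t by simp
  have 1: "vector_derivative (\<lambda>\<tau>. T \<tau> \<phi>) (at t within {0..1}) = dirD (dirD h e3) e3 (0, 0, t)"
    by (rule interior_derivative[OF z t T_eq has_vector_derivative_slice3[OF smooth_on_differentiable[OF smooth_dh(1) z]]]) auto
  have 2: "vector_derivative (\<lambda>\<tau>. Z \<tau> \<phi>) (at t within {0..1}) = \<zeta>'"
    by (rule interior_derivative[OF z t ev d])
  show ?thesis
    unfolding covar_deriv_def Let_def 1 2 using chart_c[OF z t'] ev[OF z t]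
    by (simp add: H_eq[OF z t'] cov_def L_def C_def N_def uncurried_def)
qed

lemma S_zero:
  assumes z: "(0, 0, t) \<in> W" and t: "t \<in> {a<..<b}"
  shows "S j (0, 0, t) = 0"
proof -
  have t': "t \<in> {a..b}" using t by simp
  have "covar_deriv A F c T t \<phi> $ j = cov j (H (0, 0, t)) (dirD (dirD h e3) e3 (0, 0, t)) (dirD h e3 (0, 0, t)) (dirD (dirD h e3) e3 (0, 0, t))"
    by (rule covar_deriv_eq[OF z t, where Z = T and \<zeta> = "\<lambda>\<tau>. dirD h e3 (0, 0, \<tau>)"])
      (simp add: T_eq, rule has_vector_derivative_slice3[OF smooth_on_differentiable[OF smooth_dh(1) z]])
  moreover have "covar_deriv A F c T t \<phi> = 0"
    using geo in_unit_interval[OF t'] by (simp add: geodesic_def)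
  ultimately show ?thesis
    using cov_velocity[OF H_D[OF z], of j "dirD (dirD h e3) e3 (0, 0, t)"] by (simp add: H_def S_def)
qed

lemma S_geodesic:
  "(0, 0, t) \<in> W \<Longrightarrow> t \<in> {a<..<b} \<Longrightarrow> dirD (dirD h e3) e3 (0, 0, t) $ k + G2 k (H (0, 0, t)) = 0"
  using S_zero by (simp add: S_def)

text \<open>Stated in the open piece: at a break point X need not be differentiable within [0,1],
  and the left side then contains an arbitrary choice.\<close>

lemma DXf_eq:
  assumes z: "(0, 0, t) \<in> W" and t: "t \<in> {a<..<b}"
  shows "DXf t \<phi> = DX (0, 0, t)"
proof (rule vec_eq_iff[THEN iffD2], rule allI)
  fix i
  have "DXf t \<phi> $ i = cov i (H (0, 0, t)) (dirD (dirD h e3) e3 (0, 0, t)) (dirD h e1 (0, 0, t)) (dirD (dirD h e1) e3 (0, 0, t))"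
    by (rule covar_deriv_eq[OF z t, where Z = Xf and \<zeta> = "\<lambda>\<tau>. dirD h e1 (0, 0, \<tau>)"])
      (simp add: Xf_eq, rule has_vector_derivative_slice3[OF smooth_on_differentiable[OF smooth_dh(1) z]])
  then show "DXf t \<phi> $ i = DX (0, 0, t) $ i"
    unfolding cov_geodesic[OF H_D[OF z] S_geodesic[OF z t]] by (simp add: DX_def)
qed

lemma DX_derivative:
  assumes z: "(0, 0, t) \<in> W"
  shows "((\<lambda>\<tau>. DX (0, 0, \<tau>)) has_vector_derivative (\<chi> i. dirD (\<lambda>z. DX z $ i) e3 (0, 0, t))) (at t)"
  by (rule has_vector_derivative_vec_nth)
    (simp add: has_vector_derivative_slice3[OF smooth_on_differentiable[OF smooth_DX_nth z]])

lemma Jf_eq: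
  assumes z: "(0, 0, t) \<in> W" and t: "t \<in> {a<..<b}"
  shows "Jf t \<phi> $ i = dirD (S i) e1 (0, 0, t)"
proof -
  have t': "t \<in> {a..b}" using t by simp
  have "covar_deriv A F c DXf t \<phi> $ i = cov i (H (0, 0, t)) (dirD (dirD h e3) e3 (0, 0, t)) (DX (0, 0, t)) (\<chi> i. dirD (\<lambda>z. DX z $ i) e3 (0, 0, t))"
    by (rule covar_deriv_eq[OF z t, where Z = DXf and \<zeta> = "\<lambda>\<tau>. DX (0, 0, \<tau>)"])
      (simp add: DXf_eq, rule DX_derivative[OF z])
  then have "covar_deriv A F c DXf t \<phi> $ i = dirD (\<lambda>z. DX z $ i) e3 (0, 0, t) + (\<Sum>m\<in>UNIV. N i m (H (0, 0, t)) * DX (0, 0, t) $ m)"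
    unfolding cov_geodesic[OF H_D[OF z] S_geodesic[OF z t]] by simp
  moreover have "curv_R2 A F c Xf t \<phi> $ i = (\<Sum>j\<in>UNIV. \<Sum>b\<in>UNIV. \<Sum>k\<in>UNIV. uncurried (curv_h (local_F A F \<phi>) i j b k) (H (0, 0, t))
      * dirD h e3 (0, 0, t) $ j * dirD h e3 (0, 0, t) $ b * dirD h e1 (0, 0, t) $ k)"
    using chart_c[OF z t'] by (simp add: curv_R2_def Let_def H_eq[OF z t'] uncurried_def Xf_eq[OF z t'] T_eq[OF z t'])
  ultimately show ?thesis
    using Jacobi[OF z S_zero[OF z t], of i] by simp
qed

text \<open>The chart is the one that \<open>inner_g\<close> selects. In this way \<open>Z\<close>
  can be any family of components, and nothing about its behaviour under coordinate changes
  enters.\<close>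

lemma pairing_eq:
  assumes z: "(0, 0, t) \<in> W" and t: "t \<in> {a..b}" and \<phi>: "\<phi> = (SOME \<phi>. \<phi> \<in> charts_at A (c t))"
  shows "p * v powr (p - 4) * pairing t Z =
    (\<Sum>i\<in>UNIV. \<Sum>j\<in>UNIV. M p i j (H (0, 0, t)) * Z \<phi> $ j * dirD h e2 (0, 0, t) $ i)"
proof -
  have f_pos: "local_F A F \<phi> (snd \<phi> (c t)) (T t \<phi>) = v" "v > 0"
    using F_T[OF in_unit_interval[OF t] chart_c[OF z t]] .
  have "Q (H (0, 0, t)) = v\<^sup>2"
    unfolding H_eq[OF z t] using f_pos by (simp add: Q_def uncurried_def)
  from M_contract[OF H_D[OF z] this f_pos(2), of p "\<lambda>j. Z \<phi> $ j" "\<lambda>i. dirD h e2 (0, 0, t) $ i"]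
  show ?thesis
    unfolding pairing_def g_along_def inner_g_def \<phi>[symmetric] Let_def
    by (simp add: H_eq[OF z t] Yf_eq[OF z t] g_def uncurried_def)
qed

lemma pairing_Jf:
  assumes z: "(0, 0, t) \<in> W" and t: "t \<in> {a<..<b}" and \<phi>: "\<phi> = (SOME \<phi>. \<phi> \<in> charts_at A (c t))"
  shows "p * v powr (p - 4) * pairing t (Jf t) =
    dirD (dirD \<omega> e1) e3 (0, 0, t) - dirD (dirD (\<lambda>z. Lag p (H z)) e2) e1 (0, 0, t)"
proof -
  have t': "t \<in> {a..b}" using t by simp
  show ?thesis
    unfolding pairing_eq[OF z t' \<phi>] Jf_eq[OF z t] second_variation_density[OF z S_zero[OF z t]] by simp
qed

end

context piece
begin

lemma chart_local:
  assumes t: "t \<in> {a..b}" and \<phi>: "\<phi> \<in> charts_at A (c t)"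
  obtains W h where "piece_chart A F c cs \<epsilon> v a b \<phi> W h" "(0, 0, t) \<in> W"
proof -
  have t': "t \<in> {0..1}" using t ab by auto
  interpret lf: local_finsler "snd \<phi> ` fst \<phi>" "local_F A F \<phi>" by (rule local_finsler[OF charts_atD(1)[OF \<phi>]])
  let ?box = "{-\<epsilon><..<\<epsilon>} \<times> {-\<epsilon><..<\<epsilon>} \<times> {a..b}"
  have z0: "(0, 0, t) \<in> ?box" using t eps by auto
  have \<phi>': "\<phi> \<in> charts_at A (case (0, 0, t) of (s1, s2, t) \<Rightarrow> cs s1 s2 t)" using \<phi> cs_c[OF t'] by simp
  obtain W\<^sub>0 h where W\<^sub>0: "open W\<^sub>0" "(0, 0, t) \<in> W\<^sub>0" "smooth_on W\<^sub>0 h"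
    "\<forall>w\<in>W\<^sub>0 \<inter> ?box. (case w of (s1, s2, t) \<Rightarrow> cs s1 s2 t) \<in> fst \<phi> \<and> snd \<phi> (case w of (s1, s2, t) \<Rightarrow> cs s1 s2 t) = h w"
    using cs_smooth[unfolded smooth_into_def, THEN bspec, OF z0, THEN bspec, OF \<phi>'] by (elim exE conjE)
  define W\<^sub>1 where "W\<^sub>1 = W\<^sub>0 \<inter> {-\<epsilon><..<\<epsilon>} \<times> {-\<epsilon><..<\<epsilon>} \<times> UNIV"
  \<comment> \<open>Shrinks the domain until positions stay in the chart image and velocities stay
    nonzero. The point (0, 0, t) survives because there the time derivative of \<open>h\<close> is
    the velocity of the geodesic.\<close>
  define W where "W = W\<^sub>1 \<inter> (\<lambda>z. (h z, dirD h e3 z)) -` lf.D"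
  have W1: "open W\<^sub>1" "smooth_on W\<^sub>1 h"
    unfolding W\<^sub>1_def by (intro open_Int open_Times W\<^sub>0 open_greaterThanLessThan open_UNIV) (rule smooth_on_subset[OF W\<^sub>0(3)], simp)
  have oW: "open W"
    unfolding W_def
    by (intro continuous_open_preimage W1 lf.open_D continuous_on_Pair smooth_on_continuous_on smooth_on_dirD)
  have coord: "cs s1 s2 t \<in> fst \<phi> \<and> snd \<phi> (cs s1 s2 t) = h (s1, s2, t)" if "(s1, s2, t) \<in> W\<^sub>1" "t \<in> {a..b}" for s1 s2 t
    using bspec[OF W\<^sub>0(4), of "(s1, s2, t)"] that by (simp add: W\<^sub>1_def)
  have z1: "(0, 0, t) \<in> W\<^sub>1" using W\<^sub>0 eps by (simp add: W\<^sub>1_def)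
  have ev: "\<forall>\<^sub>F \<tau> in nhds t. \<tau> \<in> {a..b} \<longrightarrow> snd \<phi> (c \<tau>) = h (0, 0, \<tau>)"
    using eventually_slice(3)[OF W1(1) z1] by eventually_elim (use coord cs_c ab in force)
  have eq: "snd \<phi> (c t) = h (0, 0, t)" using eventually_nhds_x_imp_x[OF ev] t by blast
  have "((\<lambda>\<tau>. snd \<phi> (c \<tau>)) has_vector_derivative T t \<phi>) (at t within {a..b})"
    using ab by (intro has_vector_derivative_within_subset[OF c_derivative(1)[OF t' \<phi>]]) auto
  then have "((\<lambda>\<tau>. h (0, 0, \<tau>)) has_vector_derivative T t \<phi>) (at t within {a..b})"
    by (rule iffD1[OF has_vector_derivative_cong_ev[OF ev eq]])
  moreover have "((\<lambda>\<tau>. h (0, 0, \<tau>)) has_vector_derivative dirD h e3 (0, 0, t)) (at t within {a..b})"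
    by (rule has_vector_derivative_at_within[OF has_vector_derivative_slice3[OF smooth_on_differentiable[OF W1(2) z1]]])
  ultimately have "dirD h e3 (0, 0, t) = T t \<phi>"
    using vector_derivative_unique_within[OF at_Icc_not_bot[OF ab(2) t]] by blast
  moreover note eq[symmetric]
  ultimately have "(0, 0, t) \<in> W"
    using z1 T_nonzero[OF t' \<phi>] charts_atD(2)[OF \<phi>] by (simp add: W_def)
  moreover have "piece_chart A F c cs \<epsilon> v a b \<phi> W h"
  proof
    show "smooth_on W h" by (rule smooth_on_subset[OF W1(2)]) (simp add: W_def)
    show "h z \<in> snd \<phi> ` fst \<phi>" "dirD h e3 z \<noteq> 0" if "z \<in> W" for z using that by (auto simp: W_def)
    show "cs s1 s2 t \<in> fst \<phi> \<and> snd \<phi> (cs s1 s2 t) = h (s1, s2, t)" if "(s1, s2, t) \<in> W" "t \<in> {a..b}" for s1 s2 t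
      using coord that by (auto simp: W_def)
  qed (use oW charts_atD(1)[OF \<phi>] in auto)
  ultimately show ?thesis by (rule that[rotated])
qed

end


section \<open>Differentiation under the integral and jumps\<close>

text \<open>Local extendability as in \<open>smooth_into\<close>, for a real function with time
  restricted to the piece. Being a pointwise property, it lets \<open>lag\<close> be treated as one
  function although its extensions come from different charts.\<close>

definition smooth_ext :: "real \<Rightarrow> real \<Rightarrow> (real \<times> real \<times> real \<Rightarrow> real) \<Rightarrow> real \<times> real \<times> real \<Rightarrow> bool" where
  "smooth_ext a b u z \<longleftrightarrow> (\<exists>W l. open W \<and> z \<in> W \<and> smooth_on W l \<and>
     (\<forall>s1 s2 t. (s1, s2, t) \<in> W \<longrightarrow> t \<in> {a..b} \<longrightarrow> u (s1, s2, t) = l (s1, s2, t)))"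

text \<open>The parameters are not confined to an interval with ends, so these derivatives are
  two-sided and determined by \<open>u\<close> at times in the piece, even at \<open>a\<close> and
  \<open>b\<close>.\<close>

definition D1 :: "(real \<times> real \<times> real \<Rightarrow> real) \<Rightarrow> real \<times> real \<times> real \<Rightarrow> real" where
  "D1 u = (\<lambda>(s1, s2, t). deriv (\<lambda>s. u (s, s2, t)) s1)"

definition D2 :: "(real \<times> real \<times> real \<Rightarrow> real) \<Rightarrow> real \<times> real \<times> real \<Rightarrow> real" where
  "D2 u = (\<lambda>(s1, s2, t). deriv (\<lambda>s. u (s1, s, t)) s2)"

lemma slice_derivative:
  assumes W: "open W" "smooth_on W l" "\<forall>s1 s2 t. (s1, s2, t) \<in> W \<longrightarrow> t \<in> {a..b} \<longrightarrow> u (s1, s2, t) = l (s1, s2, t)"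
    and z: "(s1, s2, t) \<in> W" "t \<in> {a..b}"
  shows "((\<lambda>s. u (s, s2, t)) has_real_derivative dirD l e1 (s1, s2, t)) (at s1)"
    "((\<lambda>s. u (s1, s, t)) has_real_derivative dirD l e2 (s1, s2, t)) (at s2)"
    "D1 u (s1, s2, t) = dirD l e1 (s1, s2, t)" "D2 u (s1, s2, t) = dirD l e2 (s1, s2, t)"
proof -
  note d = smooth_on_differentiable[OF W(2) z(1)]
  show 1: "((\<lambda>s. u (s, s2, t)) has_real_derivative dirD l e1 (s1, s2, t)) (at s1)"
    unfolding has_real_derivative_iff_has_vector_derivative
    by (rule has_vector_derivative_eventually_cong[OF has_vector_derivative_slice1[OF d]])
      (use eventually_slice(1)[OF W(1) z(1)] in eventually_elim, use W(3) z(2) in simp)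
  show 2: "((\<lambda>s. u (s1, s, t)) has_real_derivative dirD l e2 (s1, s2, t)) (at s2)"
    unfolding has_real_derivative_iff_has_vector_derivative
    by (rule has_vector_derivative_eventually_cong[OF has_vector_derivative_slice2[OF d]])
      (use eventually_slice(2)[OF W(1) z(1)] in eventually_elim, use W(3) z(2) in simp)
  show "D1 u (s1, s2, t) = dirD l e1 (s1, s2, t)" "D2 u (s1, s2, t) = dirD l e2 (s1, s2, t)"
    unfolding D1_def D2_def split by (rule DERIV_imp_deriv[OF 1], rule DERIV_imp_deriv[OF 2])
qed

lemma smooth_ext_derivative:
  assumes u: "smooth_ext a b u (s1, s2, t)" and t: "t \<in> {a..b}"
  shows "((\<lambda>s. u (s, s2, t)) has_real_derivative D1 u (s1, s2, t)) (at s1)"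
    "((\<lambda>s. u (s1, s, t)) has_real_derivative D2 u (s1, s2, t)) (at s2)"
    "smooth_ext a b (D1 u) (s1, s2, t)" "smooth_ext a b (D2 u) (s1, s2, t)"
proof -
  obtain W l where W: "open W" "(s1, s2, t) \<in> W" "smooth_on W l"
    "\<forall>s1 s2 t. (s1, s2, t) \<in> W \<longrightarrow> t \<in> {a..b} \<longrightarrow> u (s1, s2, t) = l (s1, s2, t)"
    using u unfolding smooth_ext_def by blast
  note sd = slice_derivative[OF W(1,3,4)]
  show "((\<lambda>s. u (s, s2, t)) has_real_derivative D1 u (s1, s2, t)) (at s1)"
    using sd(1)[OF W(2) t] unfolding sd(3)[OF W(2) t] .
  show "((\<lambda>s. u (s1, s, t)) has_real_derivative D2 u (s1, s2, t)) (at s2)"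
    using sd(2)[OF W(2) t] unfolding sd(4)[OF W(2) t] .
  show "smooth_ext a b (D1 u) (s1, s2, t)"
    unfolding smooth_ext_def using W(1,2) smooth_on_dirD[OF W(3), of e1] sd(3) by blast
  show "smooth_ext a b (D2 u) (s1, s2, t)"
    unfolding smooth_ext_def using W(1,2) smooth_on_dirD[OF W(3), of e2] sd(4) by blast
qed

lemma smooth_ext_continuous:
  assumes "smooth_ext a b u (s1, s2, t)" and t: "t \<in> {a..b}"
  shows "continuous (at (s1, s2, t) within UNIV \<times> UNIV \<times> {a..b}) u"
proof -
  obtain W l where W: "open W" "(s1, s2, t) \<in> W" "smooth_on W l"
    "\<And>s1 s2 t. (s1, s2, t) \<in> W \<Longrightarrow> t \<in> {a..b} \<Longrightarrow> u (s1, s2, t) = l (s1, s2, t)"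
    using assms unfolding smooth_ext_def by blast
  have "isCont l (s1, s2, t)"
    using smooth_on_continuous_on[OF W(3)] W(1,2) by (simp add: continuous_on_eq_continuous_at)
  then have "(l \<longlongrightarrow> u (s1, s2, t)) (at (s1, s2, t) within UNIV \<times> UNIV \<times> {a..b})"
    unfolding W(4)[OF W(2) t] isCont_def by (rule tendsto_within_subset) simp
  moreover have "\<forall>\<^sub>F w in at (s1, s2, t) within UNIV \<times> UNIV \<times> {a..b}. l w = u w"
  proof -
    have "l w = u w" if "w \<in> W" "w \<in> UNIV \<times> UNIV \<times> {a..b}" for w
      using W(4)[of "fst w" "fst (snd w)" "snd (snd w)"] that by (simp add: mem_Times_iff)
    then show ?thesis
      unfolding eventually_at_filter using eventually_nhds_in_open[OF W(1,2)] by (auto elim!: eventually_mono)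
  qed
  ultimately show ?thesis unfolding continuous_within by (rule Lim_transform_eventually)
qed

text \<open>A witness \<open>W\<close> for one point serves all of its own points.\<close>

lemma open_smooth_ext: "open {z. smooth_ext a b u z}"
proof (subst open_subopen, intro ballI)
  fix z assume "z \<in> {z. smooth_ext a b u z}"
  then obtain W l where "open W" "z \<in> W" "smooth_on W l"
    "\<forall>s1 s2 t. (s1, s2, t) \<in> W \<longrightarrow> t \<in> {a..b} \<longrightarrow> u (s1, s2, t) = l (s1, s2, t)"
    unfolding smooth_ext_def by blast
  then show "\<exists>T. open T \<and> z \<in> T \<and> T \<subseteq> {z. smooth_ext a b u z}"
    unfolding smooth_ext_def by (intro exI[of _ W]) blast
qed

text \<open>Compactness of the time segment turns neighbourhoods of its points into one parameter
  range valid for all times.\<close>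

lemma tube_around_segment:
  fixes O1 :: "(real \<times> real \<times> real) set"
  assumes "open O1" "\<And>t. t \<in> {a..b} \<Longrightarrow> (0, 0, t) \<in> O1"
  obtains \<delta> where "\<delta> > 0" "\<And>s1 s2 t. \<bar>s1\<bar> < \<delta> \<Longrightarrow> \<bar>s2\<bar> < \<delta> \<Longrightarrow> t \<in> {a..b} \<Longrightarrow> (s1, s2, t) \<in> O1"
proof -
  have "compact ({0} \<times> {0} \<times> {a..b})" by (intro compact_Times) auto
  moreover have "{0} \<times> {0} \<times> {a..b} \<subseteq> O1" using assms(2) by auto
  ultimately obtain e where e: "e > 0" "(\<Union>x\<in>{0} \<times> {0} \<times> {a..b}. ball x e) \<subseteq> O1"
    using compact_subset_open_imp_ball_epsilon_subset[OF _ assms(1)] by blast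
  show ?thesis
  proof
    \<comment> \<open>Half of \<open>e\<close> suffices because the distance to (0, 0, t) is at most
      the sum of the two absolute parameters.\<close>
    show "e / 2 > 0" using e by simp
    fix s1 s2 t assume s: "\<bar>s1\<bar> < e / 2" "\<bar>s2\<bar> < e / 2" "t \<in> {a..b}"
    have "dist (0, 0, t) (s1, s2, t) = sqrt (s1\<^sup>2 + s2\<^sup>2)"
      by (simp add: dist_Pair_Pair dist_real_def)
    also have "\<dots> < e" using sqrt_sum_squares_le_sum_abs[of s1 s2] s by simp
    finally have "(s1, s2, t) \<in> ball (0, 0, t) e" by simp
    then show "(s1, s2, t) \<in> O1" using e(2) s(3) by blast
  qed
qed

section \<open>Differentiation under the integral sign\<close>

lemma leibniz_Icc:
  fixes f f' :: "real \<Rightarrow> real \<Rightarrow> real"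
  assumes \<delta>: "\<delta> > 0"
    and d: "\<And>s t. \<bar>s\<bar> < \<delta> \<Longrightarrow> t \<in> {a..b} \<Longrightarrow> ((\<lambda>s. f s t) has_real_derivative f' s t) (at s)"
    and i: "\<And>s. \<bar>s\<bar> < \<delta> \<Longrightarrow> f s integrable_on {a..b}"
    and c: "continuous_on ({-\<delta><..<\<delta>} \<times> {a..b}) (\<lambda>(s, t). f' s t)"
  shows "((\<lambda>s. integral {a..b} (f s)) has_real_derivative integral {a..b} (f' 0)) (at 0)"
proof -
  have "((\<lambda>s. integral (cbox a b) (f s)) has_real_derivative integral (cbox a b) (f' 0)) (at 0 within {-\<delta><..<\<delta>})"
    using c d i \<delta>
    by (intro leibniz_rule_field_derivative) (auto intro: has_field_derivative_at_within)
  moreover have "at 0 within {-\<delta><..<\<delta>} = at (0::real)"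
    using \<delta> by (intro at_within_open) auto
  ultimately show ?thesis by simp
qed

text \<open>The second parameter is differentiated first, at 0 but for all small \<open>s1\<close>,
  and then the first one, in the order of \<open>second_variation\<close>.\<close>

lemma second_derivative_integral:
  assumes ext: "\<And>t. t \<in> {a..b} \<Longrightarrow> smooth_ext a b u (0, 0, t)"
  obtains \<delta> where "\<delta> > 0"
    "\<And>s1 s2. \<bar>s1\<bar> < \<delta> \<Longrightarrow> \<bar>s2\<bar> < \<delta> \<Longrightarrow> (\<lambda>t. u (s1, s2, t)) integrable_on {a..b}"
    "\<And>s1. \<bar>s1\<bar> < \<delta> \<Longrightarrow> ((\<lambda>s. integral {a..b} (\<lambda>t. u (s1, s, t))) has_real_derivative
        integral {a..b} (\<lambda>t. D2 u (s1, 0, t))) (at 0)"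
    "((\<lambda>s. integral {a..b} (\<lambda>t. D2 u (s, 0, t))) has_real_derivative integral {a..b} (\<lambda>t. D1 (D2 u) (0, 0, t))) (at 0)"
    "(\<lambda>t. D1 (D2 u) (0, 0, t)) integrable_on {a..b}"
proof -
  obtain \<delta> where \<delta>: "\<delta> > 0" and "\<And>s1 s2 t. \<bar>s1\<bar> < \<delta> \<Longrightarrow> \<bar>s2\<bar> < \<delta> \<Longrightarrow> t \<in> {a..b} \<Longrightarrow> (s1, s2, t) \<in> {z. smooth_ext a b u z}"
    using tube_around_segment[OF open_smooth_ext[of a b u], of a b] ext by blast
  then have u: "smooth_ext a b u (s1, s2, t)" if "\<bar>s1\<bar> < \<delta>" "\<bar>s2\<bar> < \<delta>" "t \<in> {a..b}" for s1 s2 t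
    using that by blast
  let ?S = "{-\<delta><..<\<delta>}" and ?I = "{a..b}"
  have cont: "continuous_on (?S \<times> ?S \<times> ?I) w"
    if "\<And>s1 s2 t. \<bar>s1\<bar> < \<delta> \<Longrightarrow> \<bar>s2\<bar> < \<delta> \<Longrightarrow> t \<in> ?I \<Longrightarrow> smooth_ext a b w (s1, s2, t)" for w
    unfolding continuous_on_eq_continuous_within
  proof
    fix z assume z: "z \<in> ?S \<times> ?S \<times> ?I"
    then obtain s1 s2 t where "z = (s1, s2, t)" "\<bar>s1\<bar> < \<delta>" "\<bar>s2\<bar> < \<delta>" "t \<in> ?I" by (auto simp: abs_less_iff)
    then have "continuous (at z within UNIV \<times> UNIV \<times> ?I) w" using smooth_ext_continuous[OF that] by simp
    then show "continuous (at z within ?S \<times> ?S \<times> ?I) w" by (rule continuous_within_subset) auto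
  qed
  note u2 = smooth_ext_derivative(4)[OF u]
  note u12 = smooth_ext_derivative(3)[OF u2]
  have int: "(\<lambda>t. w (s1, s2, t)) integrable_on ?I"
    if "continuous_on (?S \<times> ?S \<times> ?I) w" "\<bar>s1\<bar> < \<delta>" "\<bar>s2\<bar> < \<delta>" for w :: "real \<times> real \<times> real \<Rightarrow> real" and s1 s2
  proof (rule integrable_continuous_real, rule continuous_on_compose2[OF that(1)])
    show "continuous_on ?I (\<lambda>t. (s1, s2, t))" by (intro continuous_intros)
  qed (use that in \<open>auto simp: abs_less_iff\<close>)
  show ?thesis
  proof (rule that[OF \<delta>])
    show "(\<lambda>t. u (s1, s2, t)) integrable_on {a..b}" if "\<bar>s1\<bar> < \<delta>" "\<bar>s2\<bar> < \<delta>" for s1 s2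
      by (rule int[OF cont[OF u] that])
    show "(\<lambda>t. D1 (D2 u) (0, 0, t)) integrable_on {a..b}"
      by (rule int[OF cont[OF u12]]) (use \<delta> in auto)
    show "((\<lambda>s. integral {a..b} (\<lambda>t. u (s1, s, t))) has_real_derivative integral {a..b} (\<lambda>t. D2 u (s1, 0, t))) (at 0)"
      if s1: "\<bar>s1\<bar> < \<delta>" for s1
    proof (rule leibniz_Icc[OF \<delta>, where f = "\<lambda>s t. u (s1, s, t)" and f' = "\<lambda>s t. D2 u (s1, s, t)"])
      show "((\<lambda>s. u (s1, s, t)) has_real_derivative D2 u (s1, s, t)) (at s)" if "\<bar>s\<bar> < \<delta>" "t \<in> ?I" for s t
        by (rule smooth_ext_derivative(2)[OF u[OF s1 that] that(2)])
      show "(\<lambda>t. u (s1, s, t)) integrable_on ?I" if "\<bar>s\<bar> < \<delta>" for s by (rule int[OF cont[OF u] s1 that])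
      show "continuous_on (?S \<times> ?I) (\<lambda>(s, t). D2 u (s1, s, t))"
        unfolding case_prod_beta'
        by (rule continuous_on_compose2[OF cont[OF u2]])
          (use s1 in \<open>auto simp: abs_less_iff intro!: continuous_intros\<close>)
    qed
    show "((\<lambda>s. integral {a..b} (\<lambda>t. D2 u (s, 0, t))) has_real_derivative integral {a..b} (\<lambda>t. D1 (D2 u) (0, 0, t))) (at 0)"
    proof (rule leibniz_Icc[OF \<delta>, where f = "\<lambda>s t. D2 u (s, 0, t)" and f' = "\<lambda>s t. D1 (D2 u) (s, 0, t)"])
      show "((\<lambda>s. D2 u (s, 0, t)) has_real_derivative D1 (D2 u) (s, 0, t)) (at s)" if "\<bar>s\<bar> < \<delta>" "t \<in> ?I" for s t
        by (rule smooth_ext_derivative(1)[OF u2[OF that(1) _ that(2,2)] that(2)]) (use \<delta> in simp)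
      show "(\<lambda>t. D2 u (s, 0, t)) integrable_on ?I" if "\<bar>s\<bar> < \<delta>" for s
        by (rule int[OF cont[OF u2] that]) (use \<delta> in auto)
      show "continuous_on (?S \<times> ?I) (\<lambda>(s, t). D1 (D2 u) (s, 0, t))"
        unfolding case_prod_beta'
        by (rule continuous_on_compose2[OF cont[OF u12]])
          (use \<delta> in \<open>auto simp: abs_less_iff intro!: continuous_intros\<close>)
    qed
  qed
qed

context piece_chart
begin

lemma smooth_ext_lag: "(s1, s2, t) \<in> W \<Longrightarrow> smooth_ext a b lag (s1, s2, t)"
  unfolding smooth_ext_def using open_W smooth_LagH lag_eq by blast

lemma D1_D2_lag:
  assumes z: "(s1, s2, t) \<in> W" and t: "t \<in> {a..b}"
  shows "D1 (D2 lag) (s1, s2, t) = dirD (dirD (\<lambda>z. Lag p (H z)) e2) e1 (s1, s2, t)"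
proof -
  have 1: "\<forall>s1 s2 t. (s1, s2, t) \<in> W \<longrightarrow> t \<in> {a..b} \<longrightarrow> lag (s1, s2, t) = Lag p (H (s1, s2, t))"
    using lag_eq by blast
  have 2: "\<forall>s1 s2 t. (s1, s2, t) \<in> W \<longrightarrow> t \<in> {a..b} \<longrightarrow> D2 lag (s1, s2, t) = dirD (\<lambda>z. Lag p (H z)) e2 (s1, s2, t)"
    using slice_derivative(4)[OF open_W smooth_LagH 1] by blast
  show ?thesis by (rule slice_derivative(3)[OF open_W smooth_on_dirD[OF smooth_LagH] 2 z t])
qed

text \<open>\<open>Wf\<close> is defined from the variation without reference to a piece, so this
  identifies the mixed parameter derivatives of the extensions \<open>h\<close> from both sides of a
  break point.\<close>

lemma Wf_derivative:
  assumes z: "(0, 0, t) \<in> W" and t: "t \<in> {a..b}"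
  shows "((\<lambda>s. Wf s t \<phi>) has_vector_derivative dirD (dirD h e2) e1 (0, 0, t)) (at 0)"
proof (rule has_vector_derivative_eventually_cong[OF has_vector_derivative_slice1[OF smooth_on_differentiable[OF smooth_dh(1) z]]])
  show "\<forall>\<^sub>F s in nhds 0. dirD h e2 (s, 0, t) = Wf s t \<phi>"
    using eventually_slice(1)[OF open_W z]
    by eventually_elim (simp only: Wf_tvec_of[OF _ t] tvec_of_same[OF chart_at[OF _ t]])
qed

section \<open>Continuity and one-sided limits of the covariant derivative of X\<close>

lemma DXf_continuous:
  assumes z: "(0, 0, t) \<in> W" and t: "t \<in> {a<..<b}"
  shows "continuous (at t) (\<lambda>\<tau>. DXf \<tau> \<phi>)"
proof -
  have "\<forall>\<^sub>F \<tau> in nhds t. DX (0, 0, \<tau>) = DXf \<tau> \<phi>"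
    using eventually_interior[OF z t] by eventually_elim (simp add: DXf_eq)
  from has_vector_derivative_eventually_cong[OF DX_derivative[OF z] this]
  show ?thesis by (rule has_vector_derivative_continuous)
qed

lemma DX_tendsto: "(0, 0, t) \<in> W \<Longrightarrow> ((\<lambda>\<tau>. DX (0, 0, \<tau>)) \<longlongrightarrow> DX (0, 0, t)) (at t within R)"
  using has_vector_derivative_continuous[OF has_vector_derivative_at_within[OF DX_derivative]]
  by (simp add: continuous_within)

lemma DXf_at_left:
  assumes z: "(0, 0, b) \<in> W"
  shows "((\<lambda>\<tau>. DXf \<tau> \<phi>) \<longlongrightarrow> DX (0, 0, b)) (at_left b)"
proof (rule Lim_transform_eventually[OF DX_tendsto[OF z]])
  have "\<forall>\<^sub>F \<tau> in at_left b. (0, 0, \<tau>) \<in> W"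
    unfolding eventually_at_filter using eventually_slice(3)[OF open_W z] by eventually_elim simp
  moreover have "\<forall>\<^sub>F \<tau> in at_left b. \<tau> \<in> {a<..<b}" using ab(2) by (rule eventually_at_left_real)
  ultimately show "\<forall>\<^sub>F \<tau> in at_left b. DX (0, 0, \<tau>) = DXf \<tau> \<phi>"
    by eventually_elim (rule DXf_eq[symmetric])
qed

lemma DXf_at_right:
  assumes z: "(0, 0, a) \<in> W"
  shows "((\<lambda>\<tau>. DXf \<tau> \<phi>) \<longlongrightarrow> DX (0, 0, a)) (at_right a)"
proof (rule Lim_transform_eventually[OF DX_tendsto[OF z]])
  have "\<forall>\<^sub>F \<tau> in at_right a. (0, 0, \<tau>) \<in> W"
    unfolding eventually_at_filter using eventually_slice(3)[OF open_W z] by eventually_elim simp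
  moreover have "\<forall>\<^sub>F \<tau> in at_right a. \<tau> \<in> {a<..<b}" using ab(2) by (rule eventually_at_right_real)
  ultimately show "\<forall>\<^sub>F \<tau> in at_right a. DX (0, 0, \<tau>) = DXf \<tau> \<phi>"
    by eventually_elim (rule DXf_eq[symmetric])
qed

end

context piece
begin

lemma continuity_in_piece:
  assumes "t \<in> {a<..<b}"
  shows "t \<notin> discontinuities A c DXf"
proof -
  have "continuous (at t) (\<lambda>\<tau>. DXf \<tau> \<phi>)" if \<phi>: "\<phi> \<in> charts_at A (c t)" for \<phi>
  proof -
    obtain W h where W: "piece_chart A F c cs \<epsilon> v a b \<phi> W h" "(0, 0, t) \<in> W"
      using chart_local[OF _ \<phi>] assms by auto
    interpret piece_chart A F c cs \<epsilon> p v a b \<phi> W h by (rule W(1))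
    show ?thesis by (rule DXf_continuous[OF W(2) assms])
  qed
  then show ?thesis by (auto simp: discontinuities_def)
qed

text \<open>At a fixed point the second variation field vanishes for every value of the first
  parameter, so the Hilbert form is identically zero there.\<close>

lemma fixed_point_B_zero:
  assumes "\<And>s1 s2. \<bar>s1\<bar> < \<epsilon> \<Longrightarrow> \<bar>s2\<bar> < \<epsilon> \<Longrightarrow> cs s1 s2 t = x"
  shows "B t = 0"
proof -
  have om0: "om s1 t = 0" if s1: "\<bar>s1\<bar> < \<epsilon>" for s1
  proof -
    have "\<forall>\<^sub>F s in nhds 0. s \<in> {-\<epsilon><..<\<epsilon>}" using eps by (intro eventually_nhds_in_open) auto
    then have "\<forall>\<^sub>F s in nhds 0. snd \<psi> x = snd \<psi> (cs s1 s t)" for \<psi> :: "('m, 'n) chart"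
      by eventually_elim (use assms s1 in \<open>simp add: abs_less_iff\<close>)
    then have "((\<lambda>s. snd \<psi> (cs s1 s t)) has_vector_derivative 0) (at 0)" for \<psi> :: "('m, 'n) chart"
      by (rule has_vector_derivative_eventually_cong[OF has_vector_derivative_const])
    then have "Wf s1 t = (\<lambda>\<psi>. 0)"
      by (auto simp: Wf_def variation_field_def fun_eq_iff intro: vector_derivative_at)
    then show ?thesis by (simp add: om_def)
  qed
  have "\<forall>\<^sub>F s in nhds 0. s \<in> {-\<epsilon><..<\<epsilon>}" using eps by (intro eventually_nhds_in_open) auto
  then have "\<forall>\<^sub>F s in nhds 0. 0 = om s t"
    by eventually_elim (simp add: om0 abs_less_iff)
  then have "((\<lambda>s. om s t) has_vector_derivative 0) (at 0)"
    by (rule has_vector_derivative_eventually_cong[OF has_vector_derivative_const])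
  then show ?thesis
    unfolding B_def by (intro DERIV_imp_deriv) (simp add: has_real_derivative_iff_has_vector_derivative)
qed

lemma energy_density_near:
  obtains \<delta> where "\<delta> > 0"
    "\<And>s1 s2 t. \<bar>s1\<bar> < \<delta> \<Longrightarrow> \<bar>s2\<bar> < \<delta> \<Longrightarrow> t \<in> {a<..<b} \<Longrightarrow> energy_density s1 s2 t = lag (s1, s2, t)"
proof -
  \<comment> \<open>Agreement is turned into an open condition so that compactness of the closed
    segment gives one range; at its end points the neighbourhood still constrains only times in the
    open interval.\<close>
  let ?O = "{z. \<exists>W. open W \<and> z \<in> W \<and> (\<forall>s1 s2 t. (s1, s2, t) \<in> W \<longrightarrow> t \<in> {a<..<b} \<longrightarrow> energy_density s1 s2 t = lag (s1, s2, t))}"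
  have opn: "open ?O"
  proof (subst open_subopen, intro ballI)
    fix z assume "z \<in> ?O"
    then obtain W where "open W" "z \<in> W"
      "\<forall>s1 s2 t. (s1, s2, t) \<in> W \<longrightarrow> t \<in> {a<..<b} \<longrightarrow> energy_density s1 s2 t = lag (s1, s2, t)" by blast
    then show "\<exists>T. open T \<and> z \<in> T \<and> T \<subseteq> ?O" by (intro exI[of _ W]) blast
  qed
  have mem: "(0, 0, t) \<in> ?O" if t: "t \<in> {a..b}" for t
  proof -
    obtain \<phi> where \<phi>: "\<phi> \<in> charts_at A (c t)" using some_chart by blast
    obtain W h where W: "piece_chart A F c cs \<epsilon> v a b \<phi> W h" "(0, 0, t) \<in> W"
      using chart_local[OF t \<phi>] by auto
    interpret piece_chart A F c cs \<epsilon> p v a b \<phi> W h by (rule W(1))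
    have "\<forall>s1 s2 t. (s1, s2, t) \<in> W \<longrightarrow> t \<in> {a<..<b} \<longrightarrow> energy_density s1 s2 t = lag (s1, s2, t)"
      using energy_density_eq by blast
    with open_W W(2) show ?thesis by (intro CollectI exI[of _ W] conjI)
  qed
  show ?thesis
  proof (rule tube_around_segment[OF opn mem])
    fix \<delta> assume \<delta>: "\<delta> > 0" "\<And>s1 s2 t. \<bar>s1\<bar> < \<delta> \<Longrightarrow> \<bar>s2\<bar> < \<delta> \<Longrightarrow> t \<in> {a..b} \<Longrightarrow> (s1, s2, t) \<in> ?O"
    show thesis
    proof (rule that[OF \<delta>(1)])
      fix s1 s2 t assume s: "\<bar>s1\<bar> < \<delta>" "\<bar>s2\<bar> < \<delta>" "t \<in> {a<..<b}"
      then have "(s1, s2, t) \<in> ?O" by (intro \<delta>(2)) auto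
      then show "energy_density s1 s2 t = lag (s1, s2, t)" using s(3) by blast
    qed
  qed
qed

lemma smooth_ext_lag_base: assumes t: "t \<in> {a..b}" shows "smooth_ext a b lag (0, 0, t)"
proof -
  obtain \<phi> where \<phi>: "\<phi> \<in> charts_at A (c t)" using some_chart by blast
  obtain W h where W: "piece_chart A F c cs \<epsilon> v a b \<phi> W h" "(0, 0, t) \<in> W"
    using chart_local[OF t \<phi>] by auto
  interpret piece_chart A F c cs \<epsilon> p v a b \<phi> W h by (rule W(1))
  show ?thesis by (rule smooth_ext_lag[OF W(2)])
qed

lemma B_continuous: "continuous_on {a..b} B"
  unfolding continuous_on_eq_continuous_within
proof
  fix t assume t: "t \<in> {a..b}"
  obtain \<phi> where \<phi>: "\<phi> \<in> charts_at A (c t)" using some_chart by blast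
  obtain W h where W: "piece_chart A F c cs \<epsilon> v a b \<phi> W h" "(0, 0, t) \<in> W"
    using chart_local[OF t \<phi>] by auto
  interpret piece_chart A F c cs \<epsilon> p v a b \<phi> W h by (rule W(1))
  show "continuous (at t within {a..b}) B"
    by (rule has_vector_derivative_continuous[OF B_derivative[OF W(2) t]])
qed

lemma B_interior:
  assumes t: "t \<in> {a<..<b}"
  shows "(B has_vector_derivative (D1 (D2 lag) (0, 0, t) + p * v powr (p - 4) * pairing t (Jf t))) (at t)"
proof -
  have t': "t \<in> {a..b}" using t by simp
  \<comment> \<open>The chart selected by \<open>inner_g\<close> at this time, as
    \<open>pairing_Jf\<close> demands; it may change with \<open>t\<close>, while \<open>B\<close>
    and \<open>lag\<close> are free of charts.\<close>
  define \<phi> where "\<phi> = (SOME \<phi>. \<phi> \<in> charts_at A (c t))"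
  have \<phi>: "\<phi> \<in> charts_at A (c t)" unfolding \<phi>_def by (rule some_chart)
  obtain W h where W: "piece_chart A F c cs \<epsilon> v a b \<phi> W h" "(0, 0, t) \<in> W"
    using chart_local[OF t' \<phi>] by auto
  interpret piece_chart A F c cs \<epsilon> p v a b \<phi> W h by (rule W(1))
  have "at t within {a..b} = at t" using t by (intro at_within_Icc_at) auto
  then show ?thesis
    using B_derivative[OF W(2) t'] unfolding pairing_Jf[OF W(2) t \<phi>_def] D1_D2_lag[OF W(2) t'] by simp
qed

text \<open>\<open>E1\<close> and \<open>E2\<close> are the first derivative of the energy of the
  piece in the second parameter and the mixed second derivative. They are kept abstract so that the
  contributions of finitely many pieces can simply be added.\<close>

lemma piece_second_variation:
  obtains \<delta> E1 E2 where "\<delta> > 0"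
    "\<And>s1 s2. \<bar>s1\<bar> < \<delta> \<Longrightarrow> \<bar>s2\<bar> < \<delta> \<Longrightarrow> energy_density s1 s2 integrable_on {a..b}"
    "\<And>s1. \<bar>s1\<bar> < \<delta> \<Longrightarrow> ((\<lambda>s. integral {a..b} (energy_density s1 s)) has_real_derivative E1 s1) (at 0)"
    "(E1 has_real_derivative E2) (at 0)"
    "((\<lambda>t. p * v powr (p - 4) * pairing t (Jf t)) has_integral (B b - B a - E2)) {a..b}"
proof -
  obtain \<delta>1 where \<delta>1: "\<delta>1 > 0"
    "\<And>s1 s2. \<bar>s1\<bar> < \<delta>1 \<Longrightarrow> \<bar>s2\<bar> < \<delta>1 \<Longrightarrow> (\<lambda>t. lag (s1, s2, t)) integrable_on {a..b}"
    "\<And>s1. \<bar>s1\<bar> < \<delta>1 \<Longrightarrow> ((\<lambda>s. integral {a..b} (\<lambda>t. lag (s1, s, t))) has_real_derivative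
        integral {a..b} (\<lambda>t. D2 lag (s1, 0, t))) (at 0)"
    "((\<lambda>s. integral {a..b} (\<lambda>t. D2 lag (s, 0, t))) has_real_derivative integral {a..b} (\<lambda>t. D1 (D2 lag) (0, 0, t))) (at 0)"
    "(\<lambda>t. D1 (D2 lag) (0, 0, t)) integrable_on {a..b}"
    using second_derivative_integral[OF smooth_ext_lag_base] by blast
  obtain \<delta>2 where \<delta>2: "\<delta>2 > 0"
    "\<And>s1 s2 t. \<bar>s1\<bar> < \<delta>2 \<Longrightarrow> \<bar>s2\<bar> < \<delta>2 \<Longrightarrow> t \<in> {a<..<b} \<Longrightarrow> energy_density s1 s2 t = lag (s1, s2, t)"
    using energy_density_near by blast
  define \<delta> where "\<delta> = min \<delta>1 \<delta>2"
  \<comment> \<open>The two integrands may differ at \<open>a\<close> and \<open>b\<close>, a null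
    set.\<close>
  have hi: "(energy_density s1 s2 has_integral integral {a..b} (\<lambda>t. lag (s1, s2, t))) {a..b}"
    if "\<bar>s1\<bar> < \<delta>" "\<bar>s2\<bar> < \<delta>" for s1 s2
    by (rule has_integral_spike_finite[where S = "{a, b}", OF _ _ integrable_integral[OF \<delta>1(2)]])
      (use that \<delta>2(2)[of s1 s2] in \<open>auto simp: \<delta>_def\<close>)
  show ?thesis
  proof (rule that)
    show "\<delta> > 0" using \<delta>1(1) \<delta>2(1) by (simp add: \<delta>_def)
    show "energy_density s1 s2 integrable_on {a..b}" if "\<bar>s1\<bar> < \<delta>" "\<bar>s2\<bar> < \<delta>" for s1 s2
      using hi[OF that] by blast
    show "((\<lambda>s. integral {a..b} (energy_density s1 s)) has_real_derivative integral {a..b} (\<lambda>t. D2 lag (s1, 0, t))) (at 0)"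
      if s1: "\<bar>s1\<bar> < \<delta>" for s1
    proof (rule has_field_derivative_transform_within_open[of _ _ _ "{-\<delta><..<\<delta>}"])
      show "((\<lambda>s. integral {a..b} (\<lambda>t. lag (s1, s, t))) has_real_derivative integral {a..b} (\<lambda>t. D2 lag (s1, 0, t))) (at 0)"
        using s1 by (intro \<delta>1(3)) (simp add: \<delta>_def)
      show "integral {a..b} (\<lambda>t. lag (s1, s, t)) = integral {a..b} (energy_density s1 s)" if "s \<in> {-\<delta><..<\<delta>}" for s
        using integral_unique[OF hi[OF s1, of s]] that by (simp add: abs_less_iff)
    qed (use \<open>\<delta> > 0\<close> in auto)
    show "((\<lambda>s. integral {a..b} (\<lambda>t. D2 lag (s, 0, t))) has_real_derivative integral {a..b} (\<lambda>t. D1 (D2 lag) (0, 0, t))) (at 0)"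
      by (rule \<delta>1(4))
    have "((\<lambda>t. D1 (D2 lag) (0, 0, t) + p * v powr (p - 4) * pairing t (Jf t)) has_integral (B b - B a)) {a..b}"
      by (rule fundamental_theorem_of_calculus_interior[OF _ B_continuous B_interior]) (use ab in auto)
    from has_integral_diff[OF this integrable_integral[OF \<delta>1(5)]]
    show "((\<lambda>t. p * v powr (p - 4) * pairing t (Jf t)) has_integral (B b - B a - integral {a..b} (\<lambda>t. D1 (D2 lag) (0, 0, t)))) {a..b}"
      by simp
  qed
qed

end

text \<open>Position, velocity, X, Y and the mixed parameter derivative agree from both sides. By
  \<open>dirD_\<omega>\<close> only the time derivative of X can then make a difference, and it
  enters through the Hessian; the N part of \<open>DX\<close> is the same on both sides.\<close>

lemma jump_pairing:
  assumes p1: "piece A F c cs \<epsilon> v a b" and p2: "piece A F c cs \<epsilon> v b d"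
  shows "piece.B A F cs p b d b - piece.B A F cs p a b b =
    p * v powr (p - 4) * piece.pairing A F c cs p v b (jump A c (covar_deriv A F c (variation_field A (\<lambda>s. cs s 0))) b)"
proof -
  interpret P1: piece A F c cs \<epsilon> p v a b by (rule p1)
  interpret P2: piece A F c cs \<epsilon> p v b d by (rule p2)
  define \<phi> where "\<phi> = (SOME \<phi>. \<phi> \<in> charts_at A (c b))"
  have \<phi>: "\<phi> \<in> charts_at A (c b)" unfolding \<phi>_def by (rule P1.some_chart)
  have t1: "b \<in> {a..b}" and t2: "b \<in> {b..d}" using P1.ab P2.ab by auto
  obtain W1 h1 where W1: "piece_chart A F c cs \<epsilon> v a b \<phi> W1 h1" "(0, 0, b) \<in> W1"
    using P1.chart_local[OF t1 \<phi>] by auto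
  obtain W2 h2 where W2: "piece_chart A F c cs \<epsilon> v b d \<phi> W2 h2" "(0, 0, b) \<in> W2"
    using P2.chart_local[OF t2 \<phi>] by auto
  interpret C1: piece_chart A F c cs \<epsilon> p v a b \<phi> W1 h1 by (rule W1(1))
  interpret C2: piece_chart A F c cs \<epsilon> p v b d \<phi> W2 h2 by (rule W2(1))
  let ?z = "(0::real, 0::real, b)" and ?J = "jump A c P1.DXf b"
  have H: "C2.H ?z = C1.H ?z"
    unfolding C1.H_eq[OF W1(2) t1] C2.H_eq[OF W2(2) t2] ..
  have h1: "dirD h2 e1 ?z = dirD h1 e1 ?z"
    using C1.Xf_eq[OF W1(2) t1] C2.Xf_eq[OF W2(2) t2] by simp
  have h2: "dirD h2 e2 ?z = dirD h1 e2 ?z"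
    using C1.Yf_eq[OF W1(2) t1] C2.Yf_eq[OF W2(2) t2] by simp
  have h21: "dirD (dirD h2 e2) e1 ?z = dirD (dirD h1 e2) e1 ?z"
    by (rule vector_derivative_unique_at[OF C2.Wf_derivative[OF W2(2) t2] C1.Wf_derivative[OF W1(2) t1]])
  have c1: "dirD (dirD h1 e3) e1 ?z = dirD (dirD h1 e1) e3 ?z"
    by (rule dirD_commute[OF C1.smooth_h C1.open_W W1(2)])
  have c2: "dirD (dirD h2 e3) e1 ?z = dirD (dirD h2 e1) e3 ?z"
    by (rule dirD_commute[OF C2.smooth_h C2.open_W W2(2)])
  \<comment> \<open>The value of \<open>covar_deriv\<close> at the break point is bypassed: both
    limits are values of the smooth expressions \<open>DX\<close> of the adjacent pieces.\<close>
  have "?J \<phi> = C2.DX ?z - C1.DX ?z"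
    using \<phi> tendsto_Lim[OF _ C1.DXf_at_left[OF W1(2)]] tendsto_Lim[OF _ C2.DXf_at_right[OF W2(2)]]
    by (simp add: jump_def)
  then have J: "?J \<phi> $ k = dirD (dirD h2 e3) e1 ?z $ k - dirD (dirD h1 e3) e1 ?z $ k" for k
    by (simp add: C1.DX_def C2.DX_def H h1 c1 c2)
  have "P2.B b - P1.B b = (\<Sum>i\<in>UNIV. \<Sum>j\<in>UNIV. C1.M p i j (C1.H ?z) * ?J \<phi> $ j * dirD h1 e2 ?z $ i)"
    unfolding C1.B_eq[OF W1(2) t1] C2.B_eq[OF W2(2) t2] C1.dirD_\<omega>[OF W1(2)] C2.dirD_\<omega>[OF W2(2)] H h1 h2 h21 J
    by (simp add: sum_subtractf[symmetric] sum_distrib_left sum_distrib_right algebra_simps)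
  also have "\<dots> = p * v powr (p - 4) * P1.pairing b ?J"
    by (rule C1.pairing_eq[OF W1(2) t1 \<phi>_def, symmetric])
  finally show ?thesis .
qed


section \<open>The second variation formula\<close>

lemma subdivision_mono:
  assumes "subdivision r \<tau>" "j \<le> k" "k \<le> r"
  shows "\<tau> j \<le> \<tau> k"
  using assms(2,3)
proof (induction k rule: dec_induct)
  case (step m)
  then have "\<tau> m < \<tau> (Suc m)" using assms(1) by (simp add: subdivision_def)
  with step show ?case by simp
qed simp

lemma has_integral_subdivision:
  fixes f :: "real \<Rightarrow> real"
  assumes "subdivision r \<tau>" "\<And>k. k < r \<Longrightarrow> (f has_integral I k) {\<tau> k..\<tau> (Suc k)}"
  shows "(f has_integral (\<Sum>k<r. I k)) {0..1}"
proof -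
  have "(f has_integral (\<Sum>k<n. I k)) {\<tau> 0..\<tau> n}" if "n \<le> r" for n
    using that
  proof (induction n)
    case (Suc n)
    then have "(f has_integral (\<Sum>k<n. I k) + I n) {\<tau> 0..\<tau> (Suc n)}"
      using subdivision_mono[OF assms(1), of 0 n] subdivision_mono[OF assms(1), of n "Suc n"]
      by (intro has_integral_combine[OF _ _ _ assms(2)]) auto
    then show ?case by simp
  qed (use has_integral_refl(2)[of f "\<tau> 0"] in simp)
  from this[of r] show ?thesis using assms(1) by (simp add: subdivision_def)
qed

text \<open>Boundary terms regrouped by node: n + 1 pieces have n interior nodes, and each
  contributes the difference between the following and the preceding piece.\<close>

lemma sum_telescope_pieces:
  fixes B :: "nat \<Rightarrow> real \<Rightarrow> real"
  shows "(\<Sum>k<Suc n. B k (\<tau> (Suc k)) - B k (\<tau> k))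
    = B n (\<tau> (Suc n)) - B 0 (\<tau> 0) - (\<Sum>k<n. B (Suc k) (\<tau> (Suc k)) - B k (\<tau> (Suc k)))"
  by (induction n) auto

theorem mainTheorem3:
  fixes A :: "('m::{t2_space,second_countable_topology}, 'n::finite) chart set"
    and F :: "'m \<Rightarrow> ('m, 'n) tvec \<Rightarrow> real"
    and x\<^sub>0 x\<^sub>1 :: 'm and p v \<epsilon> :: real
    and c :: "real \<Rightarrow> 'm" and cs :: "real \<Rightarrow> real \<Rightarrow> real \<Rightarrow> 'm"
    and X Y :: "real \<Rightarrow> ('m, 'n) tvec"
  assumes "finsler_manifold A F"
    and "p \<noteq> 0"
    and "c \<in> path_space A x\<^sub>0 x\<^sub>1"
    and "geodesic A F c"
    and "\<And>t. t \<in> {0..1} \<Longrightarrow> norm_along A F c t (velocity A {0..1} c t) = v"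
    and "two_param_variation A x\<^sub>0 x\<^sub>1 c \<epsilon> cs"
    and "X = variation_field A (\<lambda>s. cs s 0)"
    and "Y = variation_field A (\<lambda>s. cs 0 s)"
  shows "(let T = velocity A {0..1} c;
              g = g_along A F c;
              DX = covar_deriv A F c X;
              \<Delta> = jump A c DX;
              J = (\<lambda>t \<phi>. covar_deriv A F c DX t \<phi> + curv_R2 A F c X t \<phi>)
          in 1 / (p * v powr (p - 4)) * second_variation A F p cs =
             - (\<Sum>t\<in>discontinuities A c DX.
                  g t (Y t) (\<lambda>\<phi>. v\<^sup>2 *\<^sub>R \<Delta> t \<phi> + ((p - 2) * g t (\<Delta> t) (T t)) *\<^sub>R T t \<phi>))
             - integral {0..1} (\<lambda>t.
                  g t (Y t) (\<lambda>\<phi>. v\<^sup>2 *\<^sub>R J t \<phi> + ((p - 2) * g t (J t) (T t)) *\<^sub>R T t \<phi>)))"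
proof -
  note variation = assms(6)[unfolded two_param_variation_def]
  obtain r \<tau> where sub: "subdivision r \<tau>"
    and sm: "\<And>k. k < r \<Longrightarrow> smooth_into A ({-\<epsilon><..<\<epsilon>} \<times> {-\<epsilon><..<\<epsilon>} \<times> {\<tau> k..\<tau> (Suc k)}) (\<lambda>(s\<^sub>1, s\<^sub>2, t). cs s\<^sub>1 s\<^sub>2 t)"
    using variation by blast
  have \<tau>0: "\<tau> 0 = 0" and \<tau>1: "\<tau> r = 1" and \<tau>less: "\<And>k. k < r \<Longrightarrow> \<tau> k < \<tau> (Suc k)"
    using sub by (auto simp: subdivision_def)
  have ends: "cs s1 s2 0 = x\<^sub>0" "cs s1 s2 1 = x\<^sub>1" if "\<bar>s1\<bar> < \<epsilon>" "\<bar>s2\<bar> < \<epsilon>" for s1 s2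
    using variation that by (auto simp: path_space_def abs_less_iff)
  have piece: "piece A F c cs \<epsilon> v (\<tau> k) (\<tau> (Suc k))" if "k < r" for k
  proof (intro piece.intro piece_axioms.intro assms(1,4,5) sm[OF that] \<tau>less[OF that])
    show "0 \<le> \<tau> k" "\<tau> (Suc k) \<le> 1"
      using subdivision_mono[OF sub, of 0 k] subdivision_mono[OF sub, of "Suc k" r] that \<tau>0 \<tau>1 by auto
    show "cs 0 0 t = c t" if "t \<in> {0..1}" for t using variation that by blast
    show "0 < \<epsilon>" using variation by blast
  qed
  \<comment> \<open>There is at least one piece since 0 and 1 differ; \<open>n\<close> counts the
    interior nodes of the subdivision.\<close>
  obtain n where n: "r = Suc n" using \<tau>0 \<tau>1 by (cases r) auto
  interpret P0: piece A F c cs \<epsilon> p v "\<tau> 0" "\<tau> (Suc 0)" using piece n by blast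
  define K where "K = p * v powr (p - 4)"
  define DX where "DX = covar_deriv A F c X"
  define J where "J = (\<lambda>t \<phi>. covar_deriv A F c DX t \<phi> + curv_R2 A F c X t \<phi>)"
  \<comment> \<open>\<open>pairing\<close> and \<open>e\<close> are independent of the piece,
    whereas \<open>B k\<close> and \<open>B (Suc k)\<close> may differ at their common node.\<close>
  define pairing where "pairing = piece.pairing A F c cs p v"
  define e where "e = piece.energy_density A F cs p"
  define B where "B k = piece.B A F cs p (\<tau> k) (\<tau> (Suc k))" for k
  \<comment> \<open>Positivity of the speed, a consequence of regularity, permits division by p
    v^(p-4).\<close>
  have "v > 0" using P0.F_T(2)[OF _ P0.some_chart, of 0] by simp
  then have K: "K \<noteq> 0" using assms(2) by (simp add: K_def)
  \<comment> \<open>The conclusions for one piece as a single predicate on a triple, so that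
    witnesses for all pieces can be chosen at once.\<close>
  define R where "R k x \<longleftrightarrow> (case x of (\<delta>, E1, E2) \<Rightarrow> \<delta> > 0 \<and>
    (\<forall>s1 s2. \<bar>s1\<bar> < \<delta> \<longrightarrow> \<bar>s2\<bar> < \<delta> \<longrightarrow> e s1 s2 integrable_on {\<tau> k..\<tau> (Suc k)}) \<and>
    (\<forall>s1. \<bar>s1\<bar> < \<delta> \<longrightarrow> ((\<lambda>s. integral {\<tau> k..\<tau> (Suc k)} (e s1 s)) has_real_derivative E1 s1) (at 0)) \<and>
    (E1 has_real_derivative E2) (at 0) \<and>
    ((\<lambda>t. K * pairing t (J t)) has_integral (B k (\<tau> (Suc k)) - B k (\<tau> k) - E2)) {\<tau> k..\<tau> (Suc k)})" for k x
  have "\<exists>x. R k x" if "k < r" for k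
  proof -
    interpret P: piece A F c cs \<epsilon> p v "\<tau> k" "\<tau> (Suc k)" by (rule piece[OF that])
    show ?thesis
    proof (rule P.piece_second_variation, goal_cases)
      case (1 \<delta> E1 E2)
      then have "R k (\<delta>, E1, E2)"
        unfolding R_def e_def K_def pairing_def J_def DX_def assms(7) B_def split by blast
      then show ?case ..
    qed
  qed
  then obtain w where w: "\<And>k. k < r \<Longrightarrow> R k (w k)" by metis
  define \<delta> E1 E2 where "\<delta> k = fst (w k)" "E1 k = fst (snd (w k))" "E2 k = snd (snd (w k))" for k
  have \<delta>: "\<And>k. k < r \<Longrightarrow> \<delta> k > 0"
    and int: "\<And>k s1 s2. k < r \<Longrightarrow> \<bar>s1\<bar> < \<delta> k \<Longrightarrow> \<bar>s2\<bar> < \<delta> k \<Longrightarrow> e s1 s2 integrable_on {\<tau> k..\<tau> (Suc k)}"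
    and E1: "\<And>k s1. k < r \<Longrightarrow> \<bar>s1\<bar> < \<delta> k \<Longrightarrow> ((\<lambda>s. integral {\<tau> k..\<tau> (Suc k)} (e s1 s)) has_real_derivative E1 k s1) (at 0)"
    and E2: "\<And>k. k < r \<Longrightarrow> (E1 k has_real_derivative E2 k) (at 0)"
    and I: "\<And>k. k < r \<Longrightarrow> ((\<lambda>t. K * pairing t (J t)) has_integral (B k (\<tau> (Suc k)) - B k (\<tau> k) - E2 k)) {\<tau> k..\<tau> (Suc k)}"
    using w unfolding R_def \<delta>_E1_E2_def case_prod_beta by blast+
  define d where "d = Min (\<delta> ` {..<r})"
  have d: "d > 0" unfolding d_def by (subst Min_gr_iff) (use \<delta> n in auto)
  have d_le: "d \<le> \<delta> k" if "k < r" for k unfolding d_def using that by simp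
  have energy: "p_energy A F p (cs s1 s2) = (\<Sum>k<r. integral {\<tau> k..\<tau> (Suc k)} (e s1 s2))" if "\<bar>s1\<bar> < d" "\<bar>s2\<bar> < d" for s1 s2
  proof -
    have "(e s1 s2 has_integral (\<Sum>k<r. integral {\<tau> k..\<tau> (Suc k)} (e s1 s2))) {0..1}"
    proof (rule has_integral_subdivision[OF sub], rule integrable_integral, rule int)
      show "\<bar>s1\<bar> < \<delta> k" "\<bar>s2\<bar> < \<delta> k" if "k < r" for k
        using d_le[OF that] \<open>\<bar>s1\<bar> < d\<close> \<open>\<bar>s2\<bar> < d\<close> by linarith+
    qed
    then show ?thesis
      by (simp add: p_energy_def e_def P0.energy_density_def[abs_def] integral_unique)
  qed
  have first: "deriv (\<lambda>s2. p_energy A F p (cs s1 s2)) 0 = (\<Sum>k<r. E1 k s1)" if s1: "\<bar>s1\<bar> < d" for s1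
  proof (rule DERIV_imp_deriv, rule has_field_derivative_transform_within_open[of _ _ _ "{-d<..<d}"])
    show "((\<lambda>s2. \<Sum>k<r. integral {\<tau> k..\<tau> (Suc k)} (e s1 s2)) has_real_derivative (\<Sum>k<r. E1 k s1)) (at 0)"
      using s1 by (intro DERIV_sum E1) (auto intro: less_le_trans[OF _ d_le])
    show "(\<Sum>k<r. integral {\<tau> k..\<tau> (Suc k)} (e s1 s2)) = p_energy A F p (cs s1 s2)" if "s2 \<in> {-d<..<d}" for s2
      using energy[OF s1, of s2] that by (simp add: abs_less_iff)
  qed (use d in auto)
  have second: "second_variation A F p cs = (\<Sum>k<r. E2 k)"
    unfolding second_variation_def
  proof (rule DERIV_imp_deriv, rule has_field_derivative_transform_within_open[of _ _ _ "{-d<..<d}"])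
    show "((\<lambda>s1. \<Sum>k<r. E1 k s1) has_real_derivative (\<Sum>k<r. E2 k)) (at 0)"
      by (intro DERIV_sum E2) simp
    show "(\<Sum>k<r. E1 k s1) = deriv (\<lambda>s2. p_energy A F p (cs s1 s2)) 0" if "s1 \<in> {-d<..<d}" for s1
      using first[of s1] that by (simp add: abs_less_iff)
  qed (use d in auto)
  have jump_B: "B (Suc k) (\<tau> (Suc k)) - B k (\<tau> (Suc k)) = K * pairing (\<tau> (Suc k)) (jump A c DX (\<tau> (Suc k)))" if "k < n" for k
    using jump_pairing[OF piece piece, of k] that n
    unfolding B_def K_def pairing_def DX_def assms(7) by simp
  have B0: "B 0 (\<tau> 0) = 0"
    unfolding B_def by (rule P0.fixed_point_B_zero[of _ x\<^sub>0]) (use ends \<tau>0 in simp)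
  interpret Pn: piece A F c cs \<epsilon> p v "\<tau> n" "\<tau> (Suc n)" using piece n by blast
  have B1: "B n (\<tau> (Suc n)) = 0"
    unfolding B_def by (rule Pn.fixed_point_B_zero[of _ x\<^sub>1]) (use ends \<tau>1 n in simp)
  have inj: "inj_on (\<lambda>k. \<tau> (Suc k)) {..<n}"
  proof (rule linorder_inj_onI')
    fix i j assume "i \<in> {..<n}" "j \<in> {..<n}" "i < j"
    then have "\<tau> (Suc i) < \<tau> (Suc (Suc i))" "\<tau> (Suc (Suc i)) \<le> \<tau> (Suc j)"
      using \<tau>less n by (auto intro!: subdivision_mono[OF sub])
    then show "\<tau> (Suc i) \<noteq> \<tau> (Suc j)" by simp
  qed
  \<comment> \<open>The sum in the theorem runs over discontinuities, the telescoped sum over all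
    interior nodes. They agree because discontinuities occur only at nodes and a node of continuity
    has zero jump.\<close>
  have disc: "discontinuities A c DX \<subseteq> (\<lambda>k. \<tau> (Suc k)) ` {..<n}"
  proof
    fix t assume t: "t \<in> discontinuities A c DX"
    then have t01: "0 < t" "t < 1" by (auto simp: discontinuities_def)
    \<comment> \<open>The least node not before \<open>t\<close>: then \<open>t\<close> lies in the
      half-open interval ending there, and continuity inside the piece forces equality.\<close>
    define k where "k = (LEAST k. t \<le> \<tau> k)"
    have k: "t \<le> \<tau> k" "k \<le> r"
      unfolding k_def using t01 \<tau>1 by (auto intro: LeastI[of _ r] Least_le)
    then obtain j where j: "k = Suc j" using t01 \<tau>0 by (cases k) auto
    have "\<tau> j < t" using not_less_Least[of j "\<lambda>k. t \<le> \<tau> k"] j unfolding k_def by auto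
    interpret Pj: piece A F c cs \<epsilon> p v "\<tau> j" "\<tau> (Suc j)" using piece k j by auto
    have "t \<notin> {\<tau> j<..<\<tau> (Suc j)}"
      using Pj.continuity_in_piece[of t] t unfolding DX_def assms(7) by blast
    then have tj: "t = \<tau> (Suc j)" using \<open>\<tau> j < t\<close> k j by auto
    then have "j \<noteq> n" using t01 \<tau>1 n by auto
    then show "t \<in> (\<lambda>k. \<tau> (Suc k)) ` {..<n}" using tj k j n by auto
  qed
  have nojump: "pairing t (jump A c DX t) = 0" if t: "t \<in> (\<lambda>k. \<tau> (Suc k)) ` {..<n} - discontinuities A c DX" for t
  proof -
    obtain k where k: "k < n" "t = \<tau> (Suc k)" using t by auto
    define \<phi> where "\<phi> = (SOME \<phi>. \<phi> \<in> charts_at A (c t))"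
    have \<phi>: "\<phi> \<in> charts_at A (c t)" unfolding \<phi>_def by (rule P0.some_chart)
    have "\<tau> 0 \<le> \<tau> k" "\<tau> k < t" "t < \<tau> (Suc (Suc k))" "\<tau> (Suc (Suc k)) \<le> \<tau> r"
      using k n \<tau>less by (auto intro!: subdivision_mono[OF sub])
    then have "continuous (at t) (\<lambda>\<tau>. DX \<tau> \<phi>)"
      using t \<phi> \<tau>0 \<tau>1 by (auto simp: discontinuities_def)
    then have "((\<lambda>\<tau>. DX \<tau> \<phi>) \<longlongrightarrow> DX t \<phi>) (at_left t)" "((\<lambda>\<tau>. DX \<tau> \<phi>) \<longlongrightarrow> DX t \<phi>) (at_right t)"
      by (auto simp: continuous_within filterlim_at_split)
    then have "jump A c DX t \<phi> = 0"
      by (simp add: jump_def tendsto_Lim)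
    then show ?thesis
      unfolding pairing_def P0.pairing_def g_along_def inner_g_def \<phi>_def[symmetric] Let_def by simp
  qed
  have "(\<Sum>t\<in>discontinuities A c DX. pairing t (jump A c DX t)) = (\<Sum>t\<in>(\<lambda>k. \<tau> (Suc k)) ` {..<n}. pairing t (jump A c DX t))"
    using disc nojump by (intro sum.mono_neutral_left) auto
  also have "\<dots> = (\<Sum>k<n. pairing (\<tau> (Suc k)) (jump A c DX (\<tau> (Suc k))))"
    by (subst sum.reindex[OF inj]) simp
  \<comment> \<open>The outer boundary terms vanish at the fixed end points; the sign comes from the
    order later piece minus earlier piece in each jump.\<close>
  finally have jumps: "K * (\<Sum>t\<in>discontinuities A c DX. pairing t (jump A c DX t)) = - (\<Sum>k<r. B k (\<tau> (Suc k)) - B k (\<tau> k))"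
    unfolding n sum_telescope_pieces B0 B1 by (simp add: jump_B sum_distrib_left)
  have "((\<lambda>t. K * pairing t (J t)) has_integral (\<Sum>k<r. B k (\<tau> (Suc k)) - B k (\<tau> k) - E2 k)) {0..1}"
    by (rule has_integral_subdivision[OF sub I])
  then have "K * integral {0..1} (\<lambda>t. pairing t (J t)) = (\<Sum>k<r. B k (\<tau> (Suc k)) - B k (\<tau> k)) - second_variation A F p cs"
    unfolding second by (simp add: integral_unique sum_subtractf flip: integral_mult_right)
  then have "1 / K * second_variation A F p cs =
      - (\<Sum>t\<in>discontinuities A c DX. pairing t (jump A c DX t)) - integral {0..1} (\<lambda>t. pairing t (J t))"
    using jumps K by (simp add: field_simps)
  then show ?thesis
    unfolding pairing_def P0.pairing_def K_def J_def DX_def Let_def assms(7,8) .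
qed

end
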